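(* Let $E$ be an arbitrary directed graph, $K$ a field, $L=L_K(E)$, and $n$ a positive integer. The following are equivalent: (1) $L$ has index of nilpotence at most $n$, i.e. $x^n=0$ for every nilpotent $x\in L$; (2) no cycle in $E$ has an exit, and for every vertex $v\in E^0$ the number of distinct paths in $E$ ending at $v$ (counting the trivial path $v$, and, when $v$ lies on a cycle $c$, counting only paths that do not traverse the entire cycle $c$) is at most $n$; (3) for every graded prime ideal $P$ of $L$, $L/P$ is graded-isomorphic to $M_t(K)$ or to $M_t(K[x,x^{-1}])$, equipped with a suitable matrix grading, for some $t\le n$; (4) $L$ is a graded subdirect product of a family of graded rings $\{A_i:i\in I\}$ where each $A_i$ is graded-isomorphic to $M_{t_i}(K)$ or $M_{t_i}(K[x,x^{-1}])$, with a suitable matrix grading, and $t_i\le n$ for all $i$. Moreover, $L$ has bounded index of nilpotence (i.e. (1) holds for some $n$) if and only if $L$ satisfies a polynomial identity.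
   Context: Graphs, paths, cycles, exits and the Leavitt path algebra $L_K(E)$: a directed graph $E=(E^0,E^1,r,s)$ (arbitrary); a path is a finite sequence of edges $e_1\cdots e_m$ with $r(e_i)=s(e_{i+1})$, vertices being paths of length $0$; a cycle is a closed path $e_1\cdots e_m$ ($r(e_m)=s(e_1)$) with $s(e_i)\neq s(e_j)$ for $i\ne j$; an exit for a path $e_1\cdots e_m$ is an edge $e$ with $s(e)=s(e_i)$ for some $i$ and $e\ne e_i$. $L_K(E)$ is the $K$-algebra generated by pairwise orthogonal idempotents $v\in E^0$ and elements $e,e^*$ ($e\in E^1$) with relations $s(e)e=e=er(e)$, $r(e)e^*=e^*=e^*s(e)$, $e^*e=r(e)$, $e^*f=0$ for $e\ne f$, and $v=\sum_{s(e)=v}ee^*$ for each vertex $v$ emitting a nonempty finite set of edges. $L_K(E)$ is $\mathbb Z$-graded by $\deg v=0$, $\deg e=1$, $\deg e^*=-1$. A graded ideal is an ideal $I$ with $I=\bigoplus_n (I\cap L_n)$; a graded prime ideal is a graded ideal that is prime. A matrix grading on $M_t(A)$ for a $\mathbb Z$-graded ring $A$ is one given by integers $d_1,\dots,d_t$ with $a\,e_{ij}$ homogeneous of degree $\deg a+d_i-d_j$ for homogeneous $a\in A$; here $K$ is trivially graded and $K[x,x^{-1}]$ is graded with $x$ homogeneous of some positive degree. A graded subdirect product means a graded embedding into $\prod_i A_i$ with each projection surjective. $L$ satisfies a polynomial identity if there is a nonzero noncommutative polynomial $f(x_1,\dots,x_m)$ over $K$ with $f(a_1,\dots,a_m)=0$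 for all $a_i\in L$. *)

theory Defs
  imports Main
begin

definition graph :: "'v set \<Rightarrow> 'e set \<Rightarrow> ('e \<Rightarrow> 'v) \<Rightarrow> ('e \<Rightarrow> 'v) \<Rightarrow> bool" where
  "graph V0 E1 s r \<longleftrightarrow> (\<forall>e\<in>E1. s e \<in> V0 \<and> r e \<in> V0)"

definition epath :: "'e set \<Rightarrow> ('e \<Rightarrow> 'v) \<Rightarrow> ('e \<Rightarrow> 'v) \<Rightarrow> 'e list \<Rightarrow> bool" where
  "epath E1 s r p \<longleftrightarrow> p \<noteq> [] \<and> set p \<subseteq> E1 \<and>
     (\<forall>i. Suc i < length p \<longrightarrow> r (p ! i) = s (p ! Suc i))"

definition is_cycle :: "'e set \<Rightarrow> ('e \<Rightarrow> 'v) \<Rightarrow> ('e \<Rightarrow> 'v) \<Rightarrow> 'e list \<Rightarrow> bool" where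
  "is_cycle E1 s r c \<longleftrightarrow> epath E1 s r c \<and> r (last c) = s (hd c) \<and> distinct (map s c)"

definition has_exit :: "'e set \<Rightarrow> ('e \<Rightarrow> 'v) \<Rightarrow> 'e list \<Rightarrow> bool" where
  "has_exit E1 s p \<longleftrightarrow> (\<exists>e\<in>E1. \<exists>i<length p. s e = s (p ! i) \<and> e \<noteq> p ! i)"

text \<open>Nontrivial paths ending at v which do not traverse the entire cycle c for any
  cycle c through v (the trivial path v is counted separately).\<close>
definition paths_to :: "'e set \<Rightarrow> ('e \<Rightarrow> 'v) \<Rightarrow> ('e \<Rightarrow> 'v) \<Rightarrow> 'v \<Rightarrow> 'e list set" where
  "paths_to E1 s r v = {p. epath E1 s r p \<and> r (last p) = v \<and>
     (\<forall>c. is_cycle E1 s r c \<and> v \<in> s ` set c \<longrightarrow> \<not> set c \<subseteq> set p)}"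

definition cond2 :: "'v set \<Rightarrow> 'e set \<Rightarrow> ('e \<Rightarrow> 'v) \<Rightarrow> ('e \<Rightarrow> 'v) \<Rightarrow> nat \<Rightarrow> bool" where
  "cond2 V0 E1 s r n \<longleftrightarrow> (\<forall>c. is_cycle E1 s r c \<longrightarrow> \<not> has_exit E1 s c) \<and>
     (\<forall>v\<in>V0. finite (paths_to E1 s r v) \<and> card (paths_to E1 s r v) + 1 \<le> n)"

section \<open>The (non-unital) free algebra on the generators v, e, e*\<close>

datatype ('v,'e) gen = Vx 'v | Ed 'e | Gh 'e

definition validgen :: "'v set \<Rightarrow> 'e set \<Rightarrow> ('v,'e) gen \<Rightarrow> bool" where
  "validgen V0 E1 g = (case g of Vx v \<Rightarrow> v \<in> V0 | Ed e \<Rightarrow> e \<in> E1 | Gh e \<Rightarrow> e \<in> E1)"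

definition FA :: "'v set \<Rightarrow> 'e set \<Rightarrow> (('v,'e) gen list \<Rightarrow> 'k::field) set" where
  "FA V0 E1 = {p. finite {w. p w \<noteq> 0} \<and>
     (\<forall>w. p w \<noteq> 0 \<longrightarrow> w \<noteq> [] \<and> (\<forall>g\<in>set w. validgen V0 E1 g))}"

definition fadd :: "('a \<Rightarrow> 'k::field) \<Rightarrow> ('a \<Rightarrow> 'k) \<Rightarrow> 'a \<Rightarrow> 'k" where
  "fadd p q = (\<lambda>w. p w + q w)"

definition fsub :: "('a \<Rightarrow> 'k::field) \<Rightarrow> ('a \<Rightarrow> 'k) \<Rightarrow> 'a \<Rightarrow> 'k" where
  "fsub p q = (\<lambda>w. p w - q w)"

definition fsc :: "'k::field \<Rightarrow> ('a \<Rightarrow> 'k) \<Rightarrow> 'a \<Rightarrow> 'k" where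
  "fsc c p = (\<lambda>w. c * p w)"

definition fmul :: "('a list \<Rightarrow> 'k::field) \<Rightarrow> ('a list \<Rightarrow> 'k) \<Rightarrow> 'a list \<Rightarrow> 'k" where
  "fmul p q = (\<lambda>w. \<Sum>i\<le>length w. p (take i w) * q (drop i w))"

definition wd :: "'a list \<Rightarrow> 'a list \<Rightarrow> 'k::field" where
  "wd u = (\<lambda>w. if w = u then 1 else 0)"

fun lprod :: "('a list \<Rightarrow> 'k::field) list \<Rightarrow> 'a list \<Rightarrow> 'k" where
  "lprod [] = wd []"
| "lprod (a # as) = fmul a (lprod as)"

definition fpow :: "('a list \<Rightarrow> 'k::field) \<Rightarrow> nat \<Rightarrow> 'a list \<Rightarrow> 'k" where
  "fpow x k = lprod (replicate k x)"

fun gdeg1 :: "('v,'e) gen \<Rightarrow> int" where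
  "gdeg1 (Vx v) = 0" | "gdeg1 (Ed e) = 1" | "gdeg1 (Gh e) = -1"

definition gdeg :: "('v,'e) gen list \<Rightarrow> int" where
  "gdeg w = sum_list (map gdeg1 w)"

definition Rel :: "'v set \<Rightarrow> 'e set \<Rightarrow> ('e \<Rightarrow> 'v) \<Rightarrow> ('e \<Rightarrow> 'v) \<Rightarrow>
    (('v,'e) gen list \<Rightarrow> 'k::field) set" where
  "Rel V0 E1 s r =
     {fsub (wd [Vx v, Vx v]) (wd [Vx v]) | v. v \<in> V0}
   \<union> {wd [Vx v, Vx w] | v w. v \<in> V0 \<and> w \<in> V0 \<and> v \<noteq> w}
   \<union> {fsub (wd [Vx (s e), Ed e]) (wd [Ed e]) | e. e \<in> E1}
   \<union> {fsub (wd [Ed e, Vx (r e)]) (wd [Ed e]) | e. e \<in> E1}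
   \<union> {fsub (wd [Vx (r e), Gh e]) (wd [Gh e]) | e. e \<in> E1}
   \<union> {fsub (wd [Gh e, Vx (s e)]) (wd [Gh e]) | e. e \<in> E1}
   \<union> {fsub (wd [Gh e, Ed e]) (wd [Vx (r e)]) | e. e \<in> E1}
   \<union> {wd [Gh e, Ed f] | e f. e \<in> E1 \<and> f \<in> E1 \<and> e \<noteq> f}
   \<union> {fsub (wd [Vx v]) (\<lambda>w. \<Sum>e\<in>{e\<in>E1. s e = v}. wd [Ed e, Gh e] w) | v.
        v \<in> V0 \<and> {e\<in>E1. s e = v} \<noteq> {} \<and> finite {e\<in>E1. s e = v}}"

text \<open>The ideal J of the free algebra generated by the relations; L_K(E) = FA / J.\<close>
inductive_set LJ :: "'v set \<Rightarrow> 'e set \<Rightarrow> ('e \<Rightarrow> 'v) \<Rightarrow> ('e \<Rightarrow> 'v) \<Rightarrow>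
    (('v,'e) gen list \<Rightarrow> 'k::field) set"
  for V0 E1 s r where
  zero: "(\<lambda>w. 0) \<in> LJ V0 E1 s r"
| add: "p \<in> LJ V0 E1 s r \<Longrightarrow> q \<in> LJ V0 E1 s r \<Longrightarrow> fadd p q \<in> LJ V0 E1 s r"
| scal: "p \<in> LJ V0 E1 s r \<Longrightarrow> fsc c p \<in> LJ V0 E1 s r"
| gen: "q \<in> Rel V0 E1 s r \<Longrightarrow> \<forall>g\<in>set u. validgen V0 E1 g \<Longrightarrow> \<forall>g\<in>set u'. validgen V0 E1 g
        \<Longrightarrow> fmul (fmul (wd u) q) (wd u') \<in> LJ V0 E1 s r"

definition nil_index_le :: "'v set \<Rightarrow> 'e set \<Rightarrow> ('e \<Rightarrow> 'v) \<Rightarrow> ('e \<Rightarrow> 'v) \<Rightarrow> 'k::field itself \<Rightarrow> nat \<Rightarrow> bool" where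
  "nil_index_le V0 E1 s r TYPE('k) n \<longleftrightarrow>
     (\<forall>x \<in> (FA V0 E1 :: (('v,'e) gen list \<Rightarrow> 'k) set).
        (\<exists>k\<ge>1. fpow x k \<in> LJ V0 E1 s r) \<longrightarrow> fpow x n \<in> LJ V0 E1 s r)"

definition fideal :: "'v set \<Rightarrow> 'e set \<Rightarrow> (('v,'e) gen list \<Rightarrow> 'k::field) set \<Rightarrow> bool" where
  "fideal V0 E1 I \<longleftrightarrow> I \<subseteq> FA V0 E1 \<and> (\<lambda>w. 0) \<in> I \<and>
     (\<forall>p\<in>I. \<forall>q\<in>I. fadd p q \<in> I) \<and> (\<forall>c. \<forall>p\<in>I. fsc c p \<in> I) \<and>
     (\<forall>p\<in>I. \<forall>q\<in>FA V0 E1. fmul p q \<in> I \<and> fmul q p \<in> I)"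

definition hcomp :: "int \<Rightarrow> (('v,'e) gen list \<Rightarrow> 'k::field) \<Rightarrow> ('v,'e) gen list \<Rightarrow> 'k" where
  "hcomp d p = (\<lambda>w. if gdeg w = d then p w else 0)"

text \<open>P is (the preimage in FA of) a graded prime ideal of L = FA/J.\<close>
definition graded_prime :: "'v set \<Rightarrow> 'e set \<Rightarrow> ('e \<Rightarrow> 'v) \<Rightarrow> ('e \<Rightarrow> 'v) \<Rightarrow>
    (('v,'e) gen list \<Rightarrow> 'k::field) set \<Rightarrow> bool" where
  "graded_prime V0 E1 s r P \<longleftrightarrow> LJ V0 E1 s r \<subseteq> P \<and> fideal V0 E1 P \<and>
     (\<forall>p\<in>P. \<forall>d. hcomp d p \<in> P) \<and> P \<noteq> FA V0 E1 \<and>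
     (\<forall>A B. fideal V0 E1 A \<and> fideal V0 E1 B \<and> (\<forall>a\<in>A. \<forall>b\<in>B. fmul a b \<in> P)
        \<longrightarrow> A \<subseteq> P \<or> B \<subseteq> P)"

text \<open>Laurent polynomials: finitely supported functions int => K (coefficient of x^k).\<close>
definition lmul :: "(int \<Rightarrow> 'k::field) \<Rightarrow> (int \<Rightarrow> 'k) \<Rightarrow> int \<Rightarrow> 'k" where
  "lmul a b = (\<lambda>k. \<Sum>i\<in>{i. a i \<noteq> 0}. a i * b (k - i))"

text \<open>MatSet t True = M_t(K[x,x^-1]); MatSet t False = M_t(K) (constant entries).\<close>
definition MatSet :: "nat \<Rightarrow> bool \<Rightarrow> (nat \<Rightarrow> nat \<Rightarrow> int \<Rightarrow> 'k::field) set" where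
  "MatSet t b = {M. (\<forall>i j. (t \<le> i \<or> t \<le> j) \<longrightarrow> M i j = (\<lambda>k. 0)) \<and>
      (\<forall>i j. finite {k. M i j k \<noteq> 0}) \<and> (\<not> b \<longrightarrow> (\<forall>i j k. M i j k \<noteq> 0 \<longrightarrow> k = 0))}"

definition madd :: "(nat \<Rightarrow> nat \<Rightarrow> int \<Rightarrow> 'k::field) \<Rightarrow> (nat \<Rightarrow> nat \<Rightarrow> int \<Rightarrow> 'k) \<Rightarrow> nat \<Rightarrow> nat \<Rightarrow> int \<Rightarrow> 'k" where
  "madd M N = (\<lambda>i j k. M i j k + N i j k)"

definition mmul :: "nat \<Rightarrow> (nat \<Rightarrow> nat \<Rightarrow> int \<Rightarrow> 'k::field) \<Rightarrow> (nat \<Rightarrow> nat \<Rightarrow> int \<Rightarrow> 'k) \<Rightarrow> nat \<Rightarrow> nat \<Rightarrow> int \<Rightarrow> 'k" where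
  "mmul t M N = (\<lambda>i j k. \<Sum>l<t. lmul (M i l) (N l j) k)"

definition msc :: "'k::field \<Rightarrow> (nat \<Rightarrow> nat \<Rightarrow> int \<Rightarrow> 'k) \<Rightarrow> nat \<Rightarrow> nat \<Rightarrow> int \<Rightarrow> 'k" where
  "msc c M = (\<lambda>i j k. c * M i j k)"

text \<open>Homogeneous component of degree D of the matrix grading given by d_1..d_t,
  where x has degree m (entries c x^k at (i,j) have degree k*m + d_i - d_j).\<close>
definition MatComp :: "int \<Rightarrow> (nat \<Rightarrow> int) \<Rightarrow> int \<Rightarrow> (nat \<Rightarrow> nat \<Rightarrow> int \<Rightarrow> 'k::field) set" where
  "MatComp m d D = {M. \<forall>i j k. M i j k \<noteq> 0 \<longrightarrow> k * m + d i - d j = D}"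

definition ghom :: "'v set \<Rightarrow> 'e set \<Rightarrow> nat \<Rightarrow> int \<Rightarrow> (nat \<Rightarrow> int) \<Rightarrow>
    ((('v,'e) gen list \<Rightarrow> 'k::field) \<Rightarrow> nat \<Rightarrow> nat \<Rightarrow> int \<Rightarrow> 'k) \<Rightarrow> bool" where
  "ghom V0 E1 t m d \<phi> \<longleftrightarrow>
     (\<forall>p\<in>FA V0 E1. \<forall>q\<in>FA V0 E1. \<phi> (fadd p q) = madd (\<phi> p) (\<phi> q) \<and>
                                  \<phi> (fmul p q) = mmul t (\<phi> p) (\<phi> q)) \<and>
     (\<forall>c. \<forall>p\<in>FA V0 E1. \<phi> (fsc c p) = msc c (\<phi> p)) \<and>
     (\<forall>p\<in>FA V0 E1. \<forall>D. (\<forall>w. p w \<noteq> 0 \<longrightarrow> gdeg w = D) \<longrightarrow> \<phi> p \<in> MatComp m d D)"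

text \<open>FA/P (= L/(P/J)) is graded-isomorphic to MatSet t b with a suitable matrix grading.\<close>
definition quot_iso :: "'v set \<Rightarrow> 'e set \<Rightarrow> (('v,'e) gen list \<Rightarrow> 'k::field) set \<Rightarrow> nat \<Rightarrow> bool \<Rightarrow> bool" where
  "quot_iso V0 E1 P t b \<longleftrightarrow> (\<exists>\<phi> m d. 0 < m \<and> ghom V0 E1 t m d \<phi> \<and>
      \<phi> ` FA V0 E1 = (MatSet t b :: (nat \<Rightarrow> nat \<Rightarrow> int \<Rightarrow> 'k) set) \<and>
      {p \<in> FA V0 E1. \<phi> p = (\<lambda>i j k. 0)} = P)"

definition cond3 :: "'v set \<Rightarrow> 'e set \<Rightarrow> ('e \<Rightarrow> 'v) \<Rightarrow> ('e \<Rightarrow> 'v) \<Rightarrow> 'k::field itself \<Rightarrow> nat \<Rightarrow> bool" where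
  "cond3 V0 E1 s r TYPE('k) n \<longleftrightarrow>
     (\<forall>P :: (('v,'e) gen list \<Rightarrow> 'k) set. graded_prime V0 E1 s r P \<longrightarrow>
        (\<exists>t b. 1 \<le> t \<and> t \<le> n \<and> quot_iso V0 E1 P t b))"

text \<open>Graded subdirect product: a family of surjective graded homomorphisms from L onto
  matrix rings whose kernels intersect in 0 (i.e. in J inside FA).\<close>
definition cond4 :: "'v set \<Rightarrow> 'e set \<Rightarrow> ('e \<Rightarrow> 'v) \<Rightarrow> ('e \<Rightarrow> 'v) \<Rightarrow> 'k::field itself \<Rightarrow> nat \<Rightarrow> bool" where
  "cond4 V0 E1 s r TYPE('k) n \<longleftrightarrow>
     (\<exists>S :: (nat \<times> bool \<times> int \<times> (nat \<Rightarrow> int) \<times>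
              ((('v,'e) gen list \<Rightarrow> 'k) \<Rightarrow> nat \<Rightarrow> nat \<Rightarrow> int \<Rightarrow> 'k)) set.
        (\<forall>(t, b, m, d, \<phi>) \<in> S. 1 \<le> t \<and> t \<le> n \<and> 0 < m \<and> ghom V0 E1 t m d \<phi> \<and>
            \<phi> ` FA V0 E1 = MatSet t b \<and> (\<forall>p \<in> LJ V0 E1 s r. \<phi> p = (\<lambda>i j k. 0))) \<and>
        {p \<in> FA V0 E1. \<forall>(t, b, m, d, \<phi>) \<in> S. \<phi> p = (\<lambda>i j k. 0)} = LJ V0 E1 s r)"

text \<open>Noncommutative polynomials over K in variables x_0, x_1, ...: finitely supported
  functions on words of variables; no constant term (L is in general non-unital).\<close>
definition evalp :: "(nat list \<Rightarrow> 'k::field) \<Rightarrow> (nat \<Rightarrow> 'a list \<Rightarrow> 'k) \<Rightarrow> 'a list \<Rightarrow> 'k" where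
  "evalp f a = (\<lambda>w. \<Sum>u\<in>{u. f u \<noteq> 0}. f u * lprod (map a u) w)"

definition satisfies_PI :: "'v set \<Rightarrow> 'e set \<Rightarrow> ('e \<Rightarrow> 'v) \<Rightarrow> ('e \<Rightarrow> 'v) \<Rightarrow> 'k::field itself \<Rightarrow> bool" where
  "satisfies_PI V0 E1 s r TYPE('k) \<longleftrightarrow>
     (\<exists>f :: nat list \<Rightarrow> 'k. finite {u. f u \<noteq> 0} \<and> f [] = 0 \<and> f \<noteq> (\<lambda>u. 0) \<and>
        (\<forall>a. (\<forall>i. a i \<in> FA V0 E1) \<longrightarrow> evalp f a \<in> LJ V0 E1 s r))"

end

theory Submission
  imports Defs "HOL-Library.Poly_Mapping" "HOL-Library.Sublist" "Jordan_Normal_Form.Determinant"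
begin

text \<open>
  If \<open>P\<close> is a graded prime ideal and (2) holds, some vertex \<open>w \<notin> P\<close> either lies on a cycle \<open>c\<close>
  (without exits) or has all its edges leading into \<open>P\<close>. Let \<open>p\<^sub>1, \<dots>, p\<^sub>t\<close> be the paths ending at \<open>w\<close>
  that do not traverse the entire cycle. Modulo \<open>P\<close> the left module \<open>Lw\<close> is free over the corner
  \<open>wLw\<close>, which is \<open>K[c, c\<^sup>*]\<close> or \<open>K\<close>, with basis \<open>p\<^sub>1, \<dots>, p\<^sub>t\<close>; its annihilator is \<open>P\<close> by primeness, and
  the elements \<open>p\<^sub>i p\<^sub>j\<^sup>*\<close> show that \<open>L\<close> acts through all matrices. This gives (3).

  A nonzero homogeneous element can be multiplied on both sides to a nonzero multiple of a vertex,
  and a graded ideal maximal among those avoiding a given vertex is prime. So the graded primes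
  intersect in 0, which gives (4). A nilpotent \<open>t \<times> t\<close> matrix over a domain has \<open>t\<close>-th power 0, and
  \<open>M\<^sub>t\<close> satisfies the standard identity of degree \<open>t\<^sup>2 + 1\<close>; so (4) implies (1) and a polynomial identity.

  If (2) fails for \<open>n\<close>, then \<open>L\<close> contains \<open>(n+1) \<times> (n+1)\<close> matrix units, built from \<open>n+1\<close> paths ending at one
  vertex or from a cycle with an exit. They survive in a graded prime quotient, contain a
  nilpotent element of index \<open>n+1\<close>, and, when \<open>n\<close> is the length of a word with nonzero
  coefficient, an evaluation at sums of matrix units isolates this coefficient; so (1), (3)
  and the polynomial identity fail.
\<close>

text \<open>No basis of \<open>L\<close> is constructed. Everything is computed modulo an arbitrary
  ideal containing the relations (\<open>leavitt_ideal\<close>), so the same calculations serve for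
  \<open>J\<close> and for graded prime ideals. Two facts do not come from such calculations. That
  no vertex vanishes in \<open>L\<close> needs a concrete module; it starts Zorn's lemma and is what
  every refutation finally contradicts. That the powers of a cycle are independent modulo a graded
  ideal comes from the grading, since they have different degrees.

  The grading also shapes the route to (4): with a cycle \<open>c\<close> without exits at
  \<open>v\<close>, an element such as \<open>v + c\<close> need not reduce to a vertex, while a
  homogeneous one does. On the other hand \<open>graded_prime\<close> tests all ideals and not just
  graded ones, so an ideal maximal among graded ideals has to be compared with arbitrary ideals
  through components of top degree.

  The degree \<open>t\<^sup>2 + 1\<close> of the standard identity, instead of the optimal
  \<open>2t\<close>, is what a determinant with two equal rows yields; any bound depending on
  \<open>t\<close> alone suffices.\<close>

section \<open>The free algebra as the monoid algebra of words\<close>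

instantiation list :: (type) monoid_add
begin
definition zero_list :: "'a list" where "zero_list = []"
definition plus_list :: "'a list \<Rightarrow> 'a list \<Rightarrow> 'a list" where "plus_list = (@)"
instance by standard (simp_all add: zero_list_def plus_list_def)
end

abbreviation lookup :: "('a \<Rightarrow>\<^sub>0 'b::zero) \<Rightarrow> 'a \<Rightarrow> 'b" where "lookup \<equiv> Poly_Mapping.lookup"
abbreviation keys :: "('a \<Rightarrow>\<^sub>0 'b::zero) \<Rightarrow> 'a set" where "keys \<equiv> Poly_Mapping.keys"

text \<open>With concatenation as the addition of \<open>monoid_add\<close>,
  \<open>'a list \<Rightarrow>\<^sub>0 'k\<close> is the unital free algebra. A word splits only at
  its finitely many positions \<open>i\<close>, which turns the product into the convolution
  \<open>fmul\<close>.\<close>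

lemma lookup_times_list:
  fixes p q :: "'a list \<Rightarrow>\<^sub>0 'b::semiring_0"
  shows "lookup (p * q) w = (\<Sum>i\<le>length w. lookup p (take i w) * lookup q (drop i w))"
proof -
  have inner: "(\<Sum>v. lookup q v when w = l + v) = (lookup q (drop (length l) w) when take (length l) w = l)" for l
  proof (cases "take (length l) w = l")
    case True
    then have "(w = l + v) = (drop (length l) w = v)" for v
      by (metis append_eq_conv_conj append_take_drop_id plus_list_def)
    then show ?thesis using True by simp
  next
    case False
    then have "w \<noteq> l + v" for v by (auto simp: plus_list_def)
    then show ?thesis using False by simp
  qed
  have "lookup (p * q) w = (\<Sum>l. lookup p l * (lookup q (drop (length l) w) when take (length l) w = l))"
    by (simp add: lookup_mult inner)
  also have "\<dots> = (\<Sum>l\<in>(\<lambda>i. take i w) ` {..length w}. lookup p l * (lookup q (drop (length l) w) when take (length l) w = l))"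
  proof (rule Sum_any.expand_superset)
    show "{a. lookup p a * (lookup q (drop (length a) w) when take (length a) w = a) \<noteq> 0}
        \<subseteq> (\<lambda>i. take i w) ` {..length w}"
    proof
      fix a assume "a \<in> {a. lookup p a * (lookup q (drop (length a) w) when take (length a) w = a) \<noteq> 0}"
      then have t: "take (length a) w = a" by (auto simp: when_def split: if_splits)
      then have "length a \<le> length w" by (metis length_take min.cobounded2 min.commute linorder_le_cases take_all)
      with t show "a \<in> (\<lambda>i. take i w) ` {..length w}" by force
    qed
  qed simp
  also have "\<dots> = (\<Sum>i\<le>length w. lookup p (take i w) * lookup q (drop i w))"
  proof (subst sum.reindex)
    show "inj_on (\<lambda>i. take i w) {..length w}"
      by (rule inj_on_inverseI[of _ length]) simp
  qed (auto intro!: sum.cong simp: min_def)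
  finally show ?thesis .
qed

lemma lookup_times_int:
  fixes p q :: "int \<Rightarrow>\<^sub>0 'b::semiring_0"
  shows "lookup (p * q) k = (\<Sum>i\<in>keys p. lookup p i * lookup q (k - i))"
proof -
  have "(k = l + v) = (k - l = v)" for l v :: int by auto
  then have "lookup (p * q) k = (\<Sum>l. lookup p l * lookup q (k - l))"
    by (simp add: lookup_mult)
  also have "\<dots> = (\<Sum>l\<in>keys p. lookup p l * lookup q (k - l))"
    by (rule Sum_any.expand_superset) (auto simp: in_keys_iff)
  finally show ?thesis .
qed

lemma poly_mapping_expand:
  fixes x :: "'a \<Rightarrow>\<^sub>0 'b::comm_monoid_add"
  shows "x = (\<Sum>k\<in>keys x. Poly_Mapping.single k (lookup x k))"
  by (rule poly_mapping_eqI) (simp add: lookup_sum lookup_single when_def in_keys_iff)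

lemma poly_mapping_add_induct [case_names zero single add]:
  fixes x :: "'a \<Rightarrow>\<^sub>0 'b::comm_monoid_add"
  assumes "P 0" "\<And>u c. P (Poly_Mapping.single u c)" "\<And>x y. P x \<Longrightarrow> P y \<Longrightarrow> P (x + y)"
  shows "P x"
proof -
  have "P (\<Sum>k\<in>A. Poly_Mapping.single k (lookup x k))" if "finite A" for A
    using that by (induction A) (auto intro: assms)
  then show ?thesis by (subst poly_mapping_expand) auto
qed

abbreviation mon :: "'a list \<Rightarrow> ('a list \<Rightarrow>\<^sub>0 'k::field)" where
  "mon u \<equiv> Poly_Mapping.single u 1"

abbreviation scal :: "'k::field \<Rightarrow> ('a list \<Rightarrow>\<^sub>0 'k)" where
  "scal c \<equiv> Poly_Mapping.single [] c"

lemma mon_mult: "mon u * mon v = mon (u @ v)"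
  by (simp add: mult_single plus_list_def)

lemma mon_Nil: "mon [] = 1"
  by (metis single_one zero_list_def)

lemma scal_mon: "scal c * mon u = Poly_Mapping.single u c"
  by (simp add: mult_single plus_list_def)

lemma scal_commute: "scal c * x = x * scal c"
  by (induction x rule: poly_mapping_add_induct)
     (simp_all add: mult_single plus_list_def algebra_simps)

lemma scal_mult: "scal c * scal d = scal (c * d)"
  by (simp add: mult_single plus_list_def)

lemma scal_left_commute: "x * (scal c * y) = scal c * (x * y)"
  by (metis mult.assoc scal_commute)

lemma lookup_scal_mult: "lookup (scal c * x) w = c * lookup x w"
  by (induction x rule: poly_mapping_add_induct)
     (simp_all add: mult_single plus_list_def algebra_simps lookup_add lookup_single when_def)

lemma wd_lookup: "wd u = lookup (mon u)"
  by (rule ext) (simp add: wd_def lookup_single when_def)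

lemma fadd_lookup: "fadd (lookup x) (lookup y) = lookup (x + y)"
  by (rule ext) (simp add: fadd_def lookup_add)

lemma fsub_lookup: "fsub (lookup x) (lookup y) = lookup (x - y)"
  by (rule ext) (simp add: fsub_def lookup_minus)

lemma fsc_lookup: "fsc c (lookup x) = lookup (scal c * x)"
  by (rule ext) (simp add: fsc_def lookup_scal_mult)

lemma fmul_lookup: "fmul (lookup x) (lookup y) = lookup (x * y)"
  by (rule ext) (simp add: fmul_def lookup_times_list)

lemma lprod_lookup: "lprod (map (\<lambda>u. lookup (f u)) us) = lookup (prod_list (map f us))"
  by (induction us) (simp_all add: fmul_lookup wd_lookup mon_Nil)

lemma fpow_lookup: "fpow (lookup x) k = lookup (x ^ k)"
  by (induction k) (simp_all add: fpow_def fmul_lookup wd_lookup mon_Nil)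

lemma evalp_lookup:
  "evalp f (\<lambda>i. lookup (a i)) = lookup (\<Sum>u\<in>{u. f u \<noteq> 0}. scal (f u) * prod_list (map a u))"
  by (rule ext) (simp add: evalp_def lprod_lookup lookup_sum lookup_scal_mult)

section \<open>Congruence modulo a two-sided ideal\<close>

locale two_sided =
  fixes Q :: "'r::ring_1 set"
  assumes zero: "0 \<in> Q"
    and add: "x \<in> Q \<Longrightarrow> y \<in> Q \<Longrightarrow> x + y \<in> Q"
    and mult: "x \<in> Q \<Longrightarrow> a * x * b \<in> Q"
begin

lemma mult_l: "x \<in> Q \<Longrightarrow> a * x \<in> Q" using mult[of x a 1] by simp
lemma mult_r: "x \<in> Q \<Longrightarrow> x * b \<in> Q" using mult[of x 1 b] by simp
lemma uminus_mem: "x \<in> Q \<Longrightarrow> - x \<in> Q" using mult_l[of x "-1"] by simp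
lemma diff_mem: "x \<in> Q \<Longrightarrow> y \<in> Q \<Longrightarrow> x - y \<in> Q" using add[of x "-y"] uminus_mem[of y] by simp
lemma sum_mem: "(\<And>i. i \<in> A \<Longrightarrow> f i \<in> Q) \<Longrightarrow> sum f A \<in> Q"
  by (induction A rule: infinite_finite_induct) (auto intro: zero add)

definition cong :: "'r \<Rightarrow> 'r \<Rightarrow> bool" (infix "\<approx>" 50) where "a \<approx> b \<longleftrightarrow> a - b \<in> Q"

lemma cong_refl [simp, intro]: "a \<approx> a" by (simp add: cong_def zero)
lemma cong_refl': "a = b \<Longrightarrow> a \<approx> b" by simp
lemma cong_sym: "a \<approx> b \<Longrightarrow> b \<approx> a" using uminus_mem[of "a - b"] by (simp add: cong_def)
lemma cong_trans [trans]: "a \<approx> b \<Longrightarrow> b \<approx> c \<Longrightarrow> a \<approx> c"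
  using add[of "a - b" "b - c"] by (simp add: cong_def)
lemma cong_add: "a \<approx> b \<Longrightarrow> c \<approx> d \<Longrightarrow> a + c \<approx> b + d"
  using add[of "a - b" "c - d"] by (simp add: cong_def algebra_simps)
lemma cong_diff: "a \<approx> b \<Longrightarrow> c \<approx> d \<Longrightarrow> a - c \<approx> b - d"
  using diff_mem[of "a - b" "c - d"] by (simp add: cong_def algebra_simps)
lemma cong_mult: "a \<approx> b \<Longrightarrow> c \<approx> d \<Longrightarrow> a * c \<approx> b * d"
  using add[OF mult_r[of "a - b" c] mult_l[of "c - d" b]] by (simp add: cong_def algebra_simps)
lemma cong_sum: "(\<And>i. i \<in> A \<Longrightarrow> f i \<approx> g i) \<Longrightarrow> sum f A \<approx> sum g A"
  by (induction A rule: infinite_finite_induct) (auto intro: cong_add)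
lemma cong_0: "a \<approx> 0 \<longleftrightarrow> a \<in> Q" by (simp add: cong_def)
lemma cong_mem: "a \<approx> b \<Longrightarrow> a \<in> Q \<longleftrightarrow> b \<in> Q"
  using cong_sym cong_trans cong_0 by blast
lemma cong_mult_l: "a \<approx> b \<Longrightarrow> c * a \<approx> c * b" by (rule cong_mult) auto
lemma cong_mult_r: "a \<approx> b \<Longrightarrow> a * c \<approx> b * c" by (rule cong_mult) auto
lemma cong_mult_0l: "a \<approx> 0 \<Longrightarrow> a * c \<approx> 0" using mult_r by (simp add: cong_0)
lemma cong_mult_0r: "a \<approx> 0 \<Longrightarrow> c * a \<approx> 0" using mult_l by (simp add: cong_0)
lemma cong_sum_0: "(\<And>i. i \<in> A \<Longrightarrow> f i \<approx> 0) \<Longrightarrow> sum f A \<approx> 0"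
  using sum_mem[of A f] by (simp add: cong_0)
lemma cong_eq_r [trans]: "a \<approx> b \<Longrightarrow> b = c \<Longrightarrow> a \<approx> c" by simp
lemma cong_eq_l [trans]: "a = b \<Longrightarrow> b \<approx> c \<Longrightarrow> a \<approx> c" by simp

end

text \<open>Discarding words with invalid letters turns an ideal of \<open>FA\<close> into an ideal of the unital ring of
  all finitely supported functions, so that congruences need no membership side conditions.\<close>

definition vres :: "'v set \<Rightarrow> 'e set \<Rightarrow> (('v,'e) gen list \<Rightarrow> 'k::field) \<Rightarrow> ('v,'e) gen list \<Rightarrow> 'k" where
  "vres V0 E1 p = (\<lambda>w. if \<forall>g\<in>set w. validgen V0 E1 g then p w else 0)"

definition lift_ideal :: "'v set \<Rightarrow> 'e set \<Rightarrow> (('v,'e) gen list \<Rightarrow> 'k::field) set \<Rightarrow> (('v,'e) gen list \<Rightarrow>\<^sub>0 'k) set" where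
  "lift_ideal V0 E1 P = {x. vres V0 E1 (lookup x) \<in> P}"

lemma vres_fmul: "vres V0 E1 (fmul p q) = fmul (vres V0 E1 p) (vres V0 E1 q)"
proof (rule ext)
  fix w :: "('a,'b) gen list"
  have *: "(\<forall>g\<in>set w. validgen V0 E1 g) \<longleftrightarrow>
    (\<forall>g\<in>set (take i w). validgen V0 E1 g) \<and> (\<forall>g\<in>set (drop i w). validgen V0 E1 g)" for i
    by (metis Un_iff append_take_drop_id set_append)
  show "vres V0 E1 (fmul p q) w = fmul (vres V0 E1 p) (vres V0 E1 q) w"
  proof (cases "\<forall>g\<in>set w. validgen V0 E1 g")
    case True
    then have "\<forall>g\<in>set (take i w). validgen V0 E1 g" "\<forall>g\<in>set (drop i w). validgen V0 E1 g" for i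
      using *[of i] True by simp_all
    then show ?thesis using True by (simp add: fmul_def vres_def)
  next
    case False
    then have "vres V0 E1 p (take i w) * vres V0 E1 q (drop i w) = 0" for i
      using *[of i] unfolding vres_def by (simp only: mult_eq_0_iff) argo
    then have "fmul (vres V0 E1 p) (vres V0 E1 q) w = 0" unfolding fmul_def by (intro sum.neutral) blast
    moreover have "vres V0 E1 (fmul p q) w = 0"
      using False unfolding vres_def by (rule if_not_P)
    ultimately show ?thesis by (simp only:)
  qed
qed

lemma FA_lookup: "p \<in> FA V0 E1 \<Longrightarrow> lookup (Abs_poly_mapping p) = p"
  by (simp add: FA_def)

lemma FA_vres: "p \<in> FA V0 E1 \<Longrightarrow> vres V0 E1 p = p"
  by (rule ext) (auto simp: FA_def vres_def)

text \<open>Splits off the constant term, which acts as a scalar. An ideal of \<open>FA\<close>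
  absorbs only factors without constant term; this splitting extends absorption to factors from the
  unital algebra.\<close>

lemma fmul_decomp_l:
  "fmul p q = fadd (fsc (p []) q) (fmul (\<lambda>w. if w = [] then 0 else p w) q)"
proof (rule ext)
  fix w
  show "fmul p q w = fadd (fsc (p []) q) (fmul (\<lambda>w. if w = [] then 0 else p w) q) w"
    unfolding fmul_def fadd_def fsc_def
    by (cases w) (simp_all add: sum.atMost_Suc_shift del: sum.atMost_Suc)
qed

lemma fmul_decomp_r:
  "fmul q p = fadd (fsc (p []) q) (fmul q (\<lambda>w. if w = [] then 0 else p w))"
proof (rule ext)
  fix w
  have "(\<Sum>i\<le>length w. q (take i w) * p (drop i w)) = 
        (\<Sum>i<length w. q (take i w) * p (drop i w)) + q w * p []"
    by (simp add: lessThan_Suc_atMost[symmetric])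
  moreover have "(\<Sum>i\<le>length w. q (take i w) * (if drop i w = [] then 0 else p (drop i w))) = 
        (\<Sum>i<length w. q (take i w) * p (drop i w))"
    by (simp add: lessThan_Suc_atMost[symmetric])
  ultimately show "fmul q p w = fadd (fsc (p []) q) (fmul q (\<lambda>w. if w = [] then 0 else p w)) w"
    unfolding fmul_def fadd_def fsc_def by (simp add: mult.commute)
qed

lemma FA_aug:
  "(\<lambda>w. if w = [] then 0 else vres V0 E1 (lookup x) w) \<in> FA V0 E1"
proof -
  have "{w. (if w = [] then 0 else vres V0 E1 (lookup x) w) \<noteq> 0} \<subseteq> keys x"
    by (auto simp: vres_def in_keys_iff split: if_splits)
  then show ?thesis
    unfolding FA_def by (auto intro: finite_subset simp: vres_def split: if_splits)
qed

lemma fideal_mult_aug: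
  assumes "fideal V0 E1 P" "p \<in> P"
  shows "fmul (vres V0 E1 (lookup x)) p \<in> P" "fmul p (vres V0 E1 (lookup x)) \<in> P"
proof -
  let ?a = "\<lambda>w. if w = [] then 0 else vres V0 E1 (lookup x) w"
  have "fmul ?a p \<in> P" "fmul p ?a \<in> P" "fsc (vres V0 E1 (lookup x) []) p \<in> P"
    using assms FA_aug[of V0 E1 x] by (simp_all add: fideal_def)
  then have "fadd (fsc (vres V0 E1 (lookup x) []) p) (fmul ?a p) \<in> P"
    "fadd (fsc (vres V0 E1 (lookup x) []) p) (fmul p ?a) \<in> P"
    using assms(1) by (simp_all add: fideal_def)
  then show "fmul (vres V0 E1 (lookup x)) p \<in> P" "fmul p (vres V0 E1 (lookup x)) \<in> P"
    by (simp_all only: fmul_decomp_l[of "vres V0 E1 (lookup x)" p] fmul_decomp_r[of p "vres V0 E1 (lookup x)"])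
qed

lemma lift_two_sided:
  assumes "fideal V0 E1 P"
  shows "two_sided (lift_ideal V0 E1 P)"
proof
  have z: "vres V0 E1 (lookup 0) = (\<lambda>w. 0)" by (auto simp: vres_def)
  show "0 \<in> lift_ideal V0 E1 P"
    using assms by (simp add: lift_ideal_def z fideal_def)
  fix x assume x: "x \<in> lift_ideal V0 E1 P"
  { fix y assume y: "y \<in> lift_ideal V0 E1 P"
    have "vres V0 E1 (lookup (x + y)) = fadd (vres V0 E1 (lookup x)) (vres V0 E1 (lookup y))"
      by (auto simp: vres_def fadd_def lookup_add)
    then show "x + y \<in> lift_ideal V0 E1 P"
      using assms x y by (auto simp: lift_ideal_def fideal_def) }
  fix a b
  have "vres V0 E1 (lookup (a * x * b)) = fmul (fmul (vres V0 E1 (lookup a)) (vres V0 E1 (lookup x))) (vres V0 E1 (lookup b))"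
    by (simp add: fmul_lookup[symmetric] vres_fmul)
  then show "a * x * b \<in> lift_ideal V0 E1 P"
    using fideal_mult_aug[OF assms] x by (auto simp: lift_ideal_def)
qed

lemma lift_mem: "lookup x \<in> FA V0 E1 \<Longrightarrow> x \<in> lift_ideal V0 E1 P \<longleftrightarrow> lookup x \<in> P"
  by (simp add: lift_ideal_def FA_vres)

lemma mon_FA: "u \<noteq> [] \<Longrightarrow> \<forall>g\<in>set u. validgen V0 E1 g \<Longrightarrow> lookup (mon u) \<in> FA V0 E1"
  by (auto simp: FA_def wd_lookup[symmetric] wd_def)

lemma FA_iff: "lookup x \<in> FA V0 E1 \<longleftrightarrow> (\<forall>w\<in>keys x. w \<noteq> [] \<and> (\<forall>g\<in>set w. validgen V0 E1 g))"
  by (auto simp: FA_def in_keys_iff)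

lemma FA_0: "lookup 0 \<in> FA V0 E1" by (simp add: FA_iff)

lemma FA_add: "lookup x \<in> FA V0 E1 \<Longrightarrow> lookup y \<in> FA V0 E1 \<Longrightarrow> lookup (x + y) \<in> FA V0 E1"
  using keys_add[of x y] by (auto simp: FA_iff)

lemma FA_sum: "(\<And>i. i \<in> A \<Longrightarrow> lookup (f i) \<in> FA V0 E1) \<Longrightarrow> lookup (sum f A) \<in> FA V0 E1"
  by (induction A rule: infinite_finite_induct) (auto intro: FA_0 FA_add)

lemma FA_mult: "lookup x \<in> FA V0 E1 \<Longrightarrow> lookup y \<in> FA V0 E1 \<Longrightarrow> lookup (x * y) \<in> FA V0 E1"
  using keys_mult[of x y] unfolding FA_iff by (fastforce simp: plus_list_def)

lemma FA_scal: "lookup x \<in> FA V0 E1 \<Longrightarrow> lookup (scal c * x) \<in> FA V0 E1"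
  by (auto simp: FA_iff in_keys_iff lookup_scal_mult)

lemma FA_minus: "lookup x \<in> FA V0 E1 \<Longrightarrow> lookup y \<in> FA V0 E1 \<Longrightarrow> lookup (x - y) \<in> FA V0 E1"
proof -
  assume *: "lookup x \<in> FA V0 E1" "lookup y \<in> FA V0 E1"
  have "w \<in> keys x \<or> w \<in> keys y" if "w \<in> keys (x - y)" for w
    using that by (auto simp: in_keys_iff lookup_minus)
  then show ?thesis using * unfolding FA_iff by blast
qed

section \<open>Ideals containing the Leavitt relations\<close>

abbreviation vx :: "'v \<Rightarrow> (('v,'e) gen list \<Rightarrow>\<^sub>0 'k::field)" where "vx v \<equiv> mon [Vx v]"
abbreviation ed :: "'e \<Rightarrow> (('v,'e) gen list \<Rightarrow>\<^sub>0 'k::field)" where "ed e \<equiv> mon [Ed e]"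
abbreviation gh :: "'e \<Rightarrow> (('v,'e) gen list \<Rightarrow>\<^sub>0 'k::field)" where "gh e \<equiv> mon [Gh e]"

locale digraph =
  fixes V0 :: "'v set" and E1 :: "'e set" and s r :: "'e \<Rightarrow> 'v"
  assumes src_V0: "e \<in> E1 \<Longrightarrow> s e \<in> V0" and rng_V0: "e \<in> E1 \<Longrightarrow> r e \<in> V0"

text \<open>\<open>Q\<close> stands for any ideal containing the relations and all letters outside
  the graph. It is instantiated both with \<open>J\<close> and with graded primes, so that one set
  of calculations serves for \<open>L\<close> and for its quotients.\<close>

locale leavitt_ideal = two_sided Q + digraph V0 E1 s r
  for Q :: "(('v,'e) gen list \<Rightarrow>\<^sub>0 'k::field) set"
    and V0 :: "'v set" and E1 :: "'e set" and s r :: "'e \<Rightarrow> 'v" +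
  assumes invalid: "\<not> validgen V0 E1 g \<Longrightarrow> mon [g] \<in> Q"
    and vv': "v \<in> V0 \<Longrightarrow> vx v * vx v \<approx> vx v"
    and vw': "v \<in> V0 \<Longrightarrow> w \<in> V0 \<Longrightarrow> v \<noteq> w \<Longrightarrow> vx v * vx w \<approx> 0"
    and se': "e \<in> E1 \<Longrightarrow> vx (s e) * ed e \<approx> ed e"
    and er': "e \<in> E1 \<Longrightarrow> ed e * vx (r e) \<approx> ed e"
    and rg': "e \<in> E1 \<Longrightarrow> vx (r e) * gh e \<approx> gh e"
    and gs': "e \<in> E1 \<Longrightarrow> gh e * vx (s e) \<approx> gh e"
    and ge': "e \<in> E1 \<Longrightarrow> gh e * ed e \<approx> vx (r e)"
    and gf': "e \<in> E1 \<Longrightarrow> f \<in> E1 \<Longrightarrow> e \<noteq> f \<Longrightarrow> gh e * ed f \<approx> 0"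
    and ck2: "v \<in> V0 \<Longrightarrow> {e\<in>E1. s e = v} \<noteq> {} \<Longrightarrow> finite {e\<in>E1. s e = v}
       \<Longrightarrow> vx v \<approx> (\<Sum>e\<in>{e\<in>E1. s e = v}. ed e * gh e)"

lemma fmul_wd_Nil: "fmul (wd []) q = q" "fmul q (wd []) = q"
proof -
  have 0: "fmul (\<lambda>w. if w = [] then 0 else wd [] w) q = (\<lambda>w. 0)"
    "fmul q (\<lambda>w. if w = [] then 0 else wd [] w) = (\<lambda>w. 0)"
    unfolding fmul_def by (intro ext sum.neutral; auto simp: wd_def)+
  have "fsc (wd [] []) q = q" by (simp add: fsc_def wd_def)
  then show "fmul (wd []) q = q" "fmul q (wd []) = q"
    unfolding fmul_decomp_l[of "wd []" q] fmul_decomp_r[of q "wd []"] 0 by (simp_all add: fadd_def)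
qed

lemma Rel_LJ:
  assumes "q \<in> Rel V0 E1 s r" shows "q \<in> LJ V0 E1 s r"
proof -
  have "fmul (fmul (wd []) q) (wd []) \<in> LJ V0 E1 s r"
    using LJ.gen[OF assms, of "[]" "[]"] by simp
  then show ?thesis by (simp add: fmul_wd_Nil)
qed

lemma Rel_I:
  "v \<in> V0 \<Longrightarrow> fsub (wd [Vx v, Vx v]) (wd [Vx v]) \<in> Rel V0 E1 s r"
  "v \<in> V0 \<Longrightarrow> w \<in> V0 \<Longrightarrow> v \<noteq> w \<Longrightarrow> wd [Vx v, Vx w] \<in> Rel V0 E1 s r"
  "e \<in> E1 \<Longrightarrow> fsub (wd [Vx (s e), Ed e]) (wd [Ed e]) \<in> Rel V0 E1 s r"
  "e \<in> E1 \<Longrightarrow> fsub (wd [Ed e, Vx (r e)]) (wd [Ed e]) \<in> Rel V0 E1 s r"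
  "e \<in> E1 \<Longrightarrow> fsub (wd [Vx (r e), Gh e]) (wd [Gh e]) \<in> Rel V0 E1 s r"
  "e \<in> E1 \<Longrightarrow> fsub (wd [Gh e, Vx (s e)]) (wd [Gh e]) \<in> Rel V0 E1 s r"
  "e \<in> E1 \<Longrightarrow> fsub (wd [Gh e, Ed e]) (wd [Vx (r e)]) \<in> Rel V0 E1 s r"
  "e \<in> E1 \<Longrightarrow> f \<in> E1 \<Longrightarrow> e \<noteq> f \<Longrightarrow> wd [Gh e, Ed f] \<in> Rel V0 E1 s r"
  "v \<in> V0 \<Longrightarrow> {e\<in>E1. s e = v} \<noteq> {} \<Longrightarrow> finite {e\<in>E1. s e = v} \<Longrightarrow>
     fsub (wd [Vx v]) (\<lambda>w. \<Sum>e\<in>{e\<in>E1. s e = v}. wd [Ed e, Gh e] w) \<in> Rel V0 E1 s r"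
  subgoal unfolding Rel_def by (rule UnI1, rule UnI1, rule UnI1, rule UnI1, rule UnI1, rule UnI1, rule UnI1, rule UnI1, rule CollectI, intro exI conjI, rule refl, assumption+)
  subgoal unfolding Rel_def by (rule UnI1, rule UnI1, rule UnI1, rule UnI1, rule UnI1, rule UnI1, rule UnI1, rule UnI2, rule CollectI, intro exI conjI, rule refl, assumption+)
  subgoal unfolding Rel_def by (rule UnI1, rule UnI1, rule UnI1, rule UnI1, rule UnI1, rule UnI1, rule UnI2, rule CollectI, intro exI conjI, rule refl, assumption+)
  subgoal unfolding Rel_def by (rule UnI1, rule UnI1, rule UnI1, rule UnI1, rule UnI1, rule UnI2, rule CollectI, intro exI conjI, rule refl, assumption+)
  subgoal unfolding Rel_def by (rule UnI1, rule UnI1, rule UnI1, rule UnI1, rule UnI2, rule CollectI, intro exI conjI, rule refl, assumption+)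
  subgoal unfolding Rel_def by (rule UnI1, rule UnI1, rule UnI1, rule UnI2, rule CollectI, intro exI conjI, rule refl, assumption+)
  subgoal unfolding Rel_def by (rule UnI1, rule UnI1, rule UnI2, rule CollectI, intro exI conjI, rule refl, assumption+)
  subgoal unfolding Rel_def by (rule UnI1, rule UnI2, rule CollectI, intro exI conjI, rule refl, assumption+)
  subgoal unfolding Rel_def by (rule UnI2, rule CollectI, intro exI conjI, rule refl, assumption+)
  done

lemma lift_leavitt_ideal:
  fixes P :: "(('a,'b) gen list \<Rightarrow> 'c::field) set"
  assumes "fideal V0 E1 P" "LJ V0 E1 s r \<subseteq> P" "graph V0 E1 s r"
  shows "leavitt_ideal (lift_ideal V0 E1 P) V0 E1 s r"
proof -
  interpret two_sided "lift_ideal V0 E1 P" using lift_two_sided assms(1) .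
  have rel: "x \<in> lift_ideal V0 E1 P" if "lookup x \<in> Rel V0 E1 s r" for x
  proof -
    have "lookup x \<in> P" using Rel_LJ[OF that] assms(2) by blast
    then show ?thesis using assms(1) lift_mem unfolding fideal_def by blast
  qed
  have sg: "e \<in> E1 \<Longrightarrow> s e \<in> V0" "e \<in> E1 \<Longrightarrow> r e \<in> V0" for e
    using assms(3) by (auto simp: graph_def)
  show ?thesis
  proof
    show "mon [g] \<in> lift_ideal V0 E1 P" if "\<not> validgen V0 E1 g" for g
    proof -
      have "vres V0 E1 (lookup (mon [g])) = (\<lambda>w. 0 :: 'c)"
        using that unfolding wd_lookup[symmetric] by (auto simp: vres_def wd_def)
      moreover have "(\<lambda>w. 0) \<in> P" using assms(1) by (simp add: fideal_def)
      ultimately show ?thesis unfolding lift_ideal_def mem_Collect_eq by (simp only:)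
    qed
  next
    fix v assume *: "v \<in> V0" "{e\<in>E1. s e = v} \<noteq> {}" "finite {e\<in>E1. s e = v}"
    have eq: "lookup (\<Sum>e | e \<in> E1 \<and> s e = v. mon [Ed e, Gh e]) = (\<lambda>w. \<Sum>e\<in>{e\<in>E1. s e = v}. (wd [Ed e, Gh e] w :: 'c))"
      by (rule ext) (simp add: lookup_sum wd_lookup)
    show "cong (vx v) ((\<Sum>e\<in>{e\<in>E1. s e = v}. ed e * gh e))"
      unfolding cong_def mon_mult
      by (rule rel) (simp only: mon_mult append_Cons append_Nil fsub_lookup[symmetric] wd_lookup[symmetric] eq Rel_I(9)[OF *])
  next
    show "cong (vx v * vx v) (vx v)" if "v \<in> V0" for v
      unfolding cong_def mon_mult using that
      by (intro rel) (simp add: fsub_lookup[symmetric] wd_lookup[symmetric] Rel_I)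
    show "cong (vx v * vx w) (0)" if "v \<in> V0" "w \<in> V0" "v \<noteq> w" for v w
      unfolding cong_0 mon_mult using that
      by (intro rel) (simp add: wd_lookup[symmetric] Rel_I)
    show "cong (gh e * ed f) (0)" if "e \<in> E1" "f \<in> E1" "e \<noteq> f" for e f
      unfolding cong_0 mon_mult using that
      by (intro rel) (simp add: wd_lookup[symmetric] Rel_I)
    fix e assume e: "e \<in> E1"
    show "cong (vx (s e) * ed e) (ed e)" "cong (ed e * vx (r e)) (ed e)" "cong (vx (r e) * gh e) (gh e)"
      "cong (gh e * vx (s e)) (gh e)" "cong (gh e * ed e) (vx (r e))"
      unfolding cong_def mon_mult using e
      by (intro rel; simp add: fsub_lookup[symmetric] wd_lookup[symmetric] Rel_I)+
  qed (use sg in auto)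
qed

section \<open>Paths and cycles\<close>

context digraph
begin

text \<open>A path is stored as its list of edges. The trivial path is then \<open>[]\<close>, and
  its source has to be supplied: it is the endpoint \<open>w\<close>.\<close>

definition src :: "'v \<Rightarrow> 'e list \<Rightarrow> 'v" where
  "src w p = (if p = [] then w else s (hd p))"

fun ends_at :: "'v \<Rightarrow> 'e list \<Rightarrow> bool" where
  "ends_at w [] = True"
| "ends_at w (e # p) = (e \<in> E1 \<and> r e = src w p \<and> ends_at w p)"

lemma src_simps [simp]: "src w [] = w" "src w (e # p) = s e"
  by (simp_all add: src_def)

lemma src_append: "src w (p @ q) = src (src w q) p"
  by (cases p) auto

lemma ends_at_append: "ends_at w (p @ q) \<longleftrightarrow> ends_at (src w q) p \<and> ends_at w q"
  by (induction p) (auto simp: src_append)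

lemma ends_at_unique: "ends_at w p \<Longrightarrow> ends_at w' p \<Longrightarrow> p \<noteq> [] \<Longrightarrow> w = w'"
  by (induction p) (auto simp: src_def split: if_splits)

lemma ends_at_E1: "ends_at w p \<Longrightarrow> set p \<subseteq> E1"
  by (induction p) auto

lemma epath_iff: "epath E1 s r p \<and> r (last p) = w \<longleftrightarrow> p \<noteq> [] \<and> ends_at w p"
proof (induction p)
  case Nil then show ?case by (simp add: epath_def)
next
  case (Cons e p)
  show ?case
  proof (cases p)
    case Nil then show ?thesis by (auto simp: epath_def)
  next
    case (Cons f q)
    have "epath E1 s r (e # p) \<longleftrightarrow> e \<in> E1 \<and> r e = s f \<and> epath E1 s r p"
      unfolding epath_def Cons
      by (auto simp: nth_Cons split: nat.splits)
    then show ?thesis using Cons.IH Cons by auto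
  qed
qed

lemma is_cycle_iff:
  "is_cycle E1 s r c \<longleftrightarrow> c \<noteq> [] \<and> ends_at (s (hd c)) c \<and> distinct (map s c)"
  unfolding is_cycle_def using epath_iff[of c "s (hd c)"] by auto

lemma no_exit_iff:
  "\<not> has_exit E1 s c \<longleftrightarrow> (\<forall>e\<in>E1. \<forall>f\<in>set c. s e = s f \<longrightarrow> e = f)"
  unfolding has_exit_def all_set_conv_all_nth by blast

text \<open>If two edges have the same source, cutting out the part from the first of them up to the
  second leaves a shorter closed path at the same vertex. Induction on the length ends with distinct
  sources.\<close>

lemma closed_path_contains_cycle:
  assumes "ends_at w p" "p \<noteq> []" "src w p = w"
  shows "\<exists>c. is_cycle E1 s r c \<and> w \<in> s ` set c \<and> set c \<subseteq> set p"
  using assms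
proof (induction "length p" arbitrary: p rule: less_induct)
  case less
  show ?case
  proof (cases "distinct (map s p)")
    case True
    then show ?thesis using less.prems
      by (intro exI[of _ p]) (auto simp: is_cycle_iff src_def)
  next
    case False
    then obtain xs y ys zs where "map s p = xs @ [y] @ ys @ [y] @ zs"
      using not_distinct_decomp by blast
    then obtain as a bs b cs where p: "p = as @ [a] @ bs @ [b] @ cs" and ab: "s a = s b"
      by (clarsimp simp: map_eq_append_conv append_eq_map_conv map_eq_Cons_conv Cons_eq_map_conv)
    let ?q = "as @ [b] @ cs"
    have "ends_at w ?q" "src w ?q = w" "?q \<noteq> []" "length ?q < length p" "set ?q \<subseteq> set p"
      using less.prems ab unfolding p by (auto simp: ends_at_append src_append)
    then show ?thesis using less.hyps[of ?q] by blast
  qed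
qed

lemma cycle_rotate:
  assumes "is_cycle E1 s r c" "w \<in> s ` set c"
  shows "\<exists>c'. is_cycle E1 s r c' \<and> s (hd c') = w \<and> set c' = set c"
proof -
  obtain a where ac: "a \<in> set c" and a: "s a = w" using assms(2) by blast
  obtain xs ys where c: "c = xs @ a # ys" using split_list[OF ac] by blast
  have hd: "s (hd c) = src (s a) xs" by (cases xs) (simp_all add: c)
  have e: "ends_at (src (s a) xs) (xs @ a # ys)" "distinct (map s (xs @ a # ys))"
    using assms(1) unfolding is_cycle_iff hd by (simp_all add: c)
  then have "ends_at (s a) xs" "ends_at (src (s a) xs) (a # ys)"
    unfolding ends_at_append by (simp_all only: src_simps)
  then have "ends_at (s a) ((a # ys) @ xs)" unfolding ends_at_append by blast
  then have "is_cycle E1 s r (a # ys @ xs)"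
    using e(2) unfolding is_cycle_iff by (auto simp del: ends_at.simps)
  moreover have "s (hd (a # ys @ xs)) = w" "set (a # ys @ xs) = set c" using a c by auto
  ultimately show ?thesis by blast
qed

text \<open>The paths counted in (2), including the trivial one as \<open>[]\<close>. They index the
  rows and columns of the matrix rings below.\<close>

definition short_paths :: "'v \<Rightarrow> 'e list set" where
  "short_paths w = {p. ends_at w p \<and> (\<forall>c. is_cycle E1 s r c \<and> w \<in> s ` set c \<longrightarrow> \<not> set c \<subseteq> set p)}"

lemma short_paths_eq: "short_paths w = insert [] (paths_to E1 s r w)"
proof -
  have "\<not> set c \<subseteq> set []" if "is_cycle E1 s r c" for c
    using that by (simp add: is_cycle_iff)
  then have "[] \<in> short_paths w" unfolding short_paths_def by simp
  moreover have "p \<in> short_paths w \<longleftrightarrow> p \<in> paths_to E1 s r w" if "p \<noteq> []" for p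
  proof -
    have "ends_at w p \<longleftrightarrow> epath E1 s r p \<and> r (last p) = w" using that epath_iff[of p w] by simp
    then show ?thesis unfolding short_paths_def paths_to_def mem_Collect_eq by (simp only: conj_assoc)
  qed
  moreover have "[] \<notin> paths_to E1 s r w" by (simp add: paths_to_def epath_def)
  ultimately have "p \<in> short_paths w \<longleftrightarrow> p \<in> insert [] (paths_to E1 s r w)" for p
    by (cases "p = []") simp_all
  then show ?thesis by blast
qed

lemma Nil_short: "[] \<in> short_paths w"
  by (simp add: short_paths_eq)

lemma card_short_paths:
  "finite (short_paths w) \<and> card (short_paths w) \<le> n \<longleftrightarrow>
   finite (paths_to E1 s r w) \<and> card (paths_to E1 s r w) + 1 \<le> n"
proof -
  have "[] \<notin> paths_to E1 s r w" by (simp add: paths_to_def epath_def)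
  then show ?thesis by (auto simp: short_paths_eq)
qed

lemma short_paths_ends: "p \<in> short_paths w \<Longrightarrow> ends_at w p"
  by (simp add: short_paths_def)

lemma short_paths_suffix: "p @ q \<in> short_paths w \<Longrightarrow> q \<in> short_paths w"
  unfolding short_paths_def by (auto simp: ends_at_append)

text \<open>A nonempty closed suffix at \<open>w\<close> would contain an entire cycle through
  \<open>w\<close>.\<close>

lemma short_paths_no_closed:
  assumes "p @ q \<in> short_paths w" "q \<noteq> []"
  shows "src w q \<noteq> w"
proof
  assume "src w q = w"
  moreover have "q \<in> short_paths w" using assms(1) by (rule short_paths_suffix)
  ultimately show False
    using closed_path_contains_cycle[of w q] assms(2) unfolding short_paths_def by blast
qed

text \<open>A vertex on a cycle without exits emits a single edge. So two paths with a common
  source, one of which stays in \<open>c\<close>, agree until one of them stops.\<close>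

lemma deterministic_prefix:
  assumes "\<not> has_exit E1 s c" "set q \<subseteq> set c" "ends_at w p" "ends_at w' q" "src w p = src w' q"
  shows "prefix p q \<or> prefix q p"
  using assms(2-)
proof (induction p arbitrary: q)
  case Nil then show ?case by simp
next
  case (Cons e p)
  show ?case
  proof (cases q)
    case (Cons f q')
    then have "e = f" using Cons.prems assms(1) by (auto simp: no_exit_iff)
    then show ?thesis using Cons.IH[of q'] Cons.prems Cons by auto
  qed simp
qed

text \<open>Every cycle through \<open>w\<close> has an edge leaving \<open>w\<close>, and the
  sources on \<open>c\<close> being distinct, \<open>tl c\<close> has none.\<close>

lemma tl_cycle_short:
  assumes "is_cycle E1 s r c" "s (hd c) = w"
  shows "tl c \<in> short_paths w"
proof -
  obtain a c' where c: "c = a # c'" using assms(1) unfolding is_cycle_iff by (cases c) blast+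
  have w: "w = s a" using assms(2) by (simp add: c)
  have "ends_at (s a) (a # c')" "distinct (map s (a # c'))"
    using assms(1) unfolding is_cycle_iff c by simp_all
  then have e: "ends_at w c'" "w \<notin> s ` set c'" by (simp_all add: w)
  then have "\<not> set d \<subseteq> set c'" if "w \<in> s ` set d" for d
    using that by blast
  then show ?thesis using e(1) unfolding short_paths_def c by simp
qed

text \<open>Extending a short path backwards leaves the set of short paths only by completing
  \<open>c\<close>. The new path contains a cycle through \<open>w\<close>, hence
  \<open>hd c\<close>, as \<open>w\<close> emits no other edge; this edge must be the new one, and
  determinism then identifies the path with \<open>c\<close>.\<close>

lemma short_paths_Cons:
  assumes c: "is_cycle E1 s r c" "s (hd c) = w" "\<not> has_exit E1 s c"
    and p: "p \<in> short_paths w" "ends_at w (e # p)" "e # p \<notin> short_paths w"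
  shows "e # p = c"
proof -
  have c0: "c \<noteq> []" "ends_at w c" "distinct (map s c)"
    using c by (auto simp: is_cycle_iff)
  obtain c' where c': "is_cycle E1 s r c'" "w \<in> s ` set c'" "set c' \<subseteq> set (e # p)"
    using p unfolding short_paths_def by blast
  then obtain f where f: "f \<in> set c'" "s f = w" by blast
  then have "f \<in> E1" using c' ends_at_E1[OF p(2)] by blast
  moreover have "s f = s (hd c)" using f(2) c(2) by simp
  ultimately have "f = hd c" using c(3) hd_in_set[OF c0(1)] unfolding no_exit_iff by blast
  then have "hd c \<in> set (e # p)" using f c' by blast
  from split_list[OF this] obtain xs ys where xy: "e # p = xs @ hd c # ys" by blast
  \<comment> \<open>If \<open>hd c\<close> were an edge of \<open>p\<close>, the part of
    \<open>p\<close> from there on would be a closed path at \<open>w\<close>.\<close>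
  have "xs = []"
  proof (rule ccontr)
    assume "xs \<noteq> []"
    then have "p = tl xs @ hd c # ys" using xy by (cases xs) auto
    then show False using short_paths_no_closed[of "tl xs" "hd c # ys" w] p(1) c(2) by auto
  qed
  then have e: "e = hd c" "src w (e # p) = w" using xy c(2) by auto
  have "src w c = w" using c0(1) c(2) unfolding src_def by (rule if_not_P[THEN trans])
  then have "prefix (e # p) c \<or> prefix c (e # p)"
    by (intro deterministic_prefix[OF c(3) subset_refl p(2) c0(2)] trans[OF e(2) sym])
  then show ?thesis
  proof
    assume "prefix (e # p) c"
    then obtain q where q: "c = (e # p) @ q" by (auto simp: prefix_def)
    show ?thesis
    proof (cases q)
      case (Cons f q')
      have "ends_at (src w q) (e # p)" using c0(2) unfolding q ends_at_append by simp
      then have "src w q = w" using ends_at_unique[OF _ p(2)] by blast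
      moreover have "s e = w" using e(2) by simp
      moreover have "distinct (map s ((e # p) @ f # q'))" using c0(3) unfolding q Cons .
      ultimately show ?thesis using Cons by simp
    qed (use q in simp)
  next
    assume "prefix c (e # p)"
    then obtain q where q: "e # p = c @ q" by (auto simp: prefix_def)
    show ?thesis
    proof (cases "q = []")
      case False
      have "ends_at (src w q) c" using p(2) unfolding q ends_at_append by simp
      then have "src w q = w" using ends_at_unique[OF _ c0(2) c0(1)] by blast
      moreover have "p = tl c @ q" using q c0(1) by (cases c) auto
      ultimately show ?thesis using short_paths_no_closed[of "tl c" q w] p(1) False by auto
    qed (use q in simp)
  qed
qed

text \<open>With no cycle through \<open>w\<close> every path to \<open>w\<close> is short. The
  suffixes of \<open>p\<close>, from \<open>[]\<close> to \<open>p\<close> itself, are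
  \<open>length p + 1\<close> different ones.\<close>

lemma acyclic_path_length:
  assumes "finite (short_paths w)" "card (short_paths w) \<le> n"
    and "\<And>c. is_cycle E1 s r c \<Longrightarrow> w \<notin> s ` set c" "ends_at w p"
  shows "length p < n"
proof -
  have "drop i p \<in> short_paths w" for i
    using assms(3,4) ends_at_append[of w "take i p" "drop i p"] by (auto simp: short_paths_def)
  then have "(\<lambda>i. drop i p) ` {..length p} \<subseteq> short_paths w" by blast
  moreover have "inj_on (\<lambda>i. drop i p) {..length p}"
    by (rule inj_on_inverseI[of _ "\<lambda>q. length p - length q"]) auto
  ultimately have "card {..length p} \<le> card (short_paths w)"
    using assms(1) card_inj_on_le by blast
  then show ?thesis using assms(2) by simp
qed

end

section \<open>Products of real paths and ghost paths\<close>

abbreviation pth :: "'e list \<Rightarrow> (('v,'e) gen list \<Rightarrow>\<^sub>0 'k::field)" where "pth p \<equiv> mon (map Ed p)"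
abbreviation gst :: "'e list \<Rightarrow> (('v,'e) gen list \<Rightarrow>\<^sub>0 'k::field)" where "gst p \<equiv> mon (map Gh (rev p))"

lemma pth_Cons: "pth (e # p) = ed e * pth p" by (simp add: mon_mult)
lemma pth_append: "pth (p @ q) = pth p * pth q" by (simp add: mon_mult)
lemma gst_Cons: "gst (e # p) = gst p * gh e" by (simp add: mon_mult)
lemma gst_append: "gst (p @ q) = gst q * gst p" by (simp add: mon_mult)
context leavitt_ideal
begin

lemma inv_v: "v \<notin> V0 \<Longrightarrow> vx v \<approx> 0" and inv_e: "e \<notin> E1 \<Longrightarrow> ed e \<approx> 0" and inv_g: "e \<notin> E1 \<Longrightarrow> gh e \<approx> 0"
  unfolding cong_0 by (intro invalid, simp add: validgen_def)+

text \<open>For an invalid letter both sides of a relation lie in \<open>Q\<close>; this removes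
  validity hypotheses from the relations. \<open>ge'\<close> keeps its hypothesis, since
  \<open>r e\<close> may be a valid vertex although \<open>e\<close> is no edge of the
  graph.\<close>

lemma mult_0_eq: "a \<approx> 0 \<Longrightarrow> b * a \<approx> a" "a \<approx> 0 \<Longrightarrow> a * b \<approx> a"
  using cong_trans[OF cong_mult_0r cong_sym] cong_trans[OF cong_mult_0l cong_sym] by blast+

lemma vv: "vx v * vx v \<approx> vx v" using vv' mult_0_eq inv_v by blast
lemma se: "vx (s e) * ed e \<approx> ed e" using se' mult_0_eq inv_e by blast
lemma er: "ed e * vx (r e) \<approx> ed e" using er' mult_0_eq inv_e by blast
lemma rg: "vx (r e) * gh e \<approx> gh e" using rg' mult_0_eq inv_g by blast
lemma gs: "gh e * vx (s e) \<approx> gh e" using gs' mult_0_eq inv_g by blast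
lemma vw: "v \<noteq> w \<Longrightarrow> vx v * vx w \<approx> 0"
  using vw' cong_mult_0l cong_mult_0r inv_v by blast
lemma gf: "e \<noteq> f \<Longrightarrow> gh e * ed f \<approx> 0"
  using gf' cong_mult_0l[OF inv_g] cong_mult_0r[OF inv_e] by blast

text \<open>Inserts a left local unit \<open>y\<close> of \<open>b\<close>, which \<open>a\<close>
  kills.\<close>

lemma cong_chain:
  "b \<approx> y * b \<Longrightarrow> a * y \<approx> 0 \<Longrightarrow> a * b \<approx> 0"
proof -
  assume "b \<approx> y * b" "a * y \<approx> 0"
  then have "a * b \<approx> a * (y * b)" by (intro cong_mult_l)
  also have "a * (y * b) = (a * y) * b" by (simp add: mult.assoc)
  also have "\<dots> \<approx> 0" using \<open>a * y \<approx> 0\<close> by (rule cong_mult_0l)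
  finally show ?thesis .
qed

lemma cong_chain_r:
  "a \<approx> a * y \<Longrightarrow> y * b \<approx> 0 \<Longrightarrow> a * b \<approx> 0"
proof -
  assume "a \<approx> a * y" "y * b \<approx> 0"
  then have "a * b \<approx> (a * y) * b" by (intro cong_mult_r)
  also have "(a * y) * b = a * (y * b)" by (simp add: mult.assoc)
  also have "\<dots> \<approx> 0" using \<open>y * b \<approx> 0\<close> by (rule cong_mult_0r)
  finally show ?thesis .
qed

lemma ve: "v \<noteq> s e \<Longrightarrow> vx v * ed e \<approx> 0"
  using cong_chain[OF cong_sym[OF se] vw] by blast
lemma ev: "v \<noteq> r e \<Longrightarrow> ed e * vx v \<approx> 0"
  using cong_chain_r[OF cong_sym[OF er] vw] by metis
lemma gv: "v \<noteq> s e \<Longrightarrow> gh e * vx v \<approx> 0"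
  using cong_chain_r[OF cong_sym[OF gs] vw] by metis

lemma src_pth: "vx (src w p) * (pth p * vx w) \<approx> pth p * vx w"
proof (cases p)
  case Nil then show ?thesis using vv by (simp add: mon_Nil)
next
  case (Cons e q)
  have "vx (s e) * (ed e * (pth q * vx w)) \<approx> ed e * (pth q * vx w)"
    using cong_mult_r[OF se[of e], of "pth q * vx w"] by (simp add: mult.assoc)
  then show ?thesis unfolding Cons by (simp only: pth_Cons src_simps mult.assoc)
qed

lemma gst_src: "(vx w * gst p) * vx (src w p) \<approx> vx w * gst p"
proof (cases p)
  case Nil then show ?thesis using vv by (simp add: mon_Nil)
next
  case (Cons e q)
  have "vx w * gst q * (gh e * vx (s e)) \<approx> vx w * gst q * gh e"
    by (rule cong_mult_l[OF gs])
  then show ?thesis unfolding Cons by (simp only: gst_Cons src_simps mult.assoc)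
qed

lemma gst_pth_self: "ends_at w p \<Longrightarrow> gst p * (pth p * vx w) \<approx> vx w"
proof (induction p)
  case Nil then show ?case by (simp add: mon_Nil)
next
  case (Cons e p)
  have "gst (e # p) * (pth (e # p) * vx w) = gst p * ((gh e * ed e) * (pth p * vx w))"
    by (simp only: gst_Cons pth_Cons mult.assoc)
  also have "\<dots> \<approx> gst p * (vx (src w p) * (pth p * vx w))"
    using Cons.prems ge'[of e] by (intro cong_mult_l cong_mult_r) auto
  also have "\<dots> \<approx> gst p * (pth p * vx w)" by (intro cong_mult_l src_pth)
  also have "\<dots> \<approx> vx w" using Cons by simp
  finally show ?case .
qed

text \<open>Common initial edges cancel until the two paths differ, where the product is 0.
  Incomparability ensures that neither path is exhausted before this happens.\<close>

lemma gst_pth_parallel: "\<not> prefix p q \<Longrightarrow> \<not> prefix q p \<Longrightarrow> gst p * pth q \<approx> 0"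
proof (induction p arbitrary: q)
  case Nil then show ?case by simp
next
  case (Cons e p)
  then obtain f q' where q: "q = f # q'" by (cases q) auto
  have eq: "gst (e # p) * pth q = gst p * ((gh e * ed f) * pth q')"
    by (simp only: q gst_Cons pth_Cons mult.assoc)
  show ?case
  proof (cases "e = f \<and> e \<in> E1")
    case False
    then have "gh e * ed f \<approx> 0" using gf cong_mult_0l[OF inv_g] by blast
    then show ?thesis unfolding eq by (rule cong_mult_0r[OF cong_mult_0l])
  next
    case True
    then have pq: "\<not> prefix p q'" "\<not> prefix q' p" using Cons.prems q by auto
    then obtain h q'' where q': "q' = h # q''" by (cases q') auto
    have "gst p * ((gh e * ed f) * pth q') \<approx> gst p * (vx (r e) * pth q')"
      using True ge' by (intro cong_mult_l cong_mult_r) auto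
    also have "\<dots> = gst p * ((vx (r e) * ed h) * pth q'')" by (simp only: q' pth_Cons mult.assoc)
    also have "\<dots> \<approx> 0"
    proof (cases "r e = s h")
      case True
      have "gst p * ((vx (r e) * ed h) * pth q'') \<approx> gst p * (ed h * pth q'')"
        unfolding True by (intro cong_mult_l cong_mult_r se)
      also have "\<dots> = gst p * pth q'" by (simp only: q' pth_Cons)
      also have "\<dots> \<approx> 0" using Cons.IH pq by blast
      finally show ?thesis .
    next
      case False
      then show ?thesis by (rule cong_mult_0r[OF cong_mult_0l[OF ve]])
    qed
    finally show ?thesis unfolding eq .
  qed
qed

text \<open>If one path is a prefix of the other, cancelling leaves a nonempty path ending at
  \<open>w\<close>, or its ghost. Its source is not \<open>w\<close>, because a short path has no
  closed suffix; so the vertex \<open>w\<close> facing this source kills the product.\<close>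

lemma short_paths_ortho:
  assumes "p \<in> short_paths w" "q \<in> short_paths w" "p \<noteq> q"
  shows "(vx w * gst p) * (pth q * vx w) \<approx> 0"
proof -
  consider (par) "\<not> prefix p q" "\<not> prefix q p" | (l) q' where "q = p @ q'" | (r) p' where "p = q @ p'"
    by (auto simp: prefix_def)
  then show ?thesis
  proof cases
    case par
    have "vx w * ((gst p * pth q) * vx w) \<approx> 0"
      by (rule cong_mult_0r[OF cong_mult_0l[OF gst_pth_parallel[OF par]]])
    then show ?thesis by (simp only: mult.assoc)
  next
    case l
    let ?u = "src w q'"
    have q': "q' \<noteq> []" using l assms(3) by auto
    have e: "ends_at ?u p" using short_paths_ends[OF assms(2)] unfolding l by (simp add: ends_at_append)
    have ne: "w \<noteq> ?u" using short_paths_no_closed[of p q' w] assms(2) l q' by auto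
    have "(vx w * gst p) * (pth q * vx w) = (vx w * gst p * pth p) * (pth q' * vx w)"
      unfolding l by (simp only: pth_append mult.assoc)
    also have "\<dots> \<approx> 0"
    proof (rule cong_chain[OF cong_sym[OF src_pth]])
      have "vx w * gst p * pth p * vx ?u = vx w * (gst p * (pth p * vx ?u))" by (simp only: mult.assoc)
      also have "\<dots> \<approx> vx w * vx ?u" by (intro cong_mult_l gst_pth_self e)
      also have "\<dots> \<approx> 0" by (rule vw[OF ne])
      finally show "vx w * gst p * pth p * vx ?u \<approx> 0" .
    qed
    finally show ?thesis .
  next
    case r
    let ?u = "src w p'"
    have p': "p' \<noteq> []" using r assms(3) by auto
    have ne: "?u \<noteq> w" using short_paths_no_closed[of q p' w] assms(1) r p' by auto
    have "(vx w * gst p) * (pth q * vx w) = (vx w * gst p') * (gst q * (pth q * vx w))"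
      unfolding r by (simp only: gst_append mult.assoc)
    also have "\<dots> \<approx> (vx w * gst p') * vx w"
      by (intro cong_mult_l gst_pth_self short_paths_ends assms(2))
    also have "\<dots> \<approx> 0"
      by (rule cong_chain_r[OF cong_sym[OF gst_src] vw[OF ne]])
    finally show ?thesis .
  qed
qed

lemma short_paths_delta:
  assumes "p \<in> short_paths w" "q \<in> short_paths w"
  shows "(vx w * gst p) * (pth q * vx w) \<approx> (if p = q then vx w else 0)"
proof (cases "p = q")
  case True
  have "(vx w * gst q) * (pth q * vx w) = vx w * (gst q * (pth q * vx w))" by (simp only: mult.assoc)
  also have "\<dots> \<approx> vx w * vx w" by (intro cong_mult_l gst_pth_self short_paths_ends assms(2))
  also have "\<dots> \<approx> vx w" by (rule vv)
  finally show ?thesis using True by simp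
qed (use short_paths_ortho assms in auto)

end

section \<open>Graded ideals\<close>

definition hc :: "int \<Rightarrow> (('v,'e) gen list \<Rightarrow>\<^sub>0 'k::field) \<Rightarrow> (('v,'e) gen list \<Rightarrow>\<^sub>0 'k)" where
  "hc d x = Abs_poly_mapping (hcomp d (lookup x))"

definition homog :: "int \<Rightarrow> (('v,'e) gen list \<Rightarrow>\<^sub>0 'k::field) \<Rightarrow> bool" where
  "homog d x \<longleftrightarrow> (\<forall>u\<in>keys x. gdeg u = d)"

lemma lookup_hc': "lookup (hc d x) = hcomp d (lookup x)"
proof -
  have "{w. hcomp d (lookup x) w \<noteq> 0} \<subseteq> keys x"
    by (auto simp: hcomp_def in_keys_iff split: if_splits)
  then show ?thesis unfolding hc_def by (intro lookup_Abs_poly_mapping) (rule finite_subset, auto)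
qed

lemma lookup_hc: "lookup (hc d x) w = (if gdeg w = d then lookup x w else 0)"
  by (simp add: lookup_hc' hcomp_def)

lemma hc_add: "hc d (x + y) = hc d x + hc d y"
  by (rule poly_mapping_eqI) (simp add: lookup_hc lookup_add)

lemma hc_0: "hc d 0 = 0"
  by (rule poly_mapping_eqI) (simp add: lookup_hc)

lemma hc_sum: "hc d (sum f A) = (\<Sum>i\<in>A. hc d (f i))"
  by (induction A rule: infinite_finite_induct) (simp_all add: hc_0 hc_add)

lemma homog_hc: "homog d (hc d x)"
  by (auto simp: homog_def in_keys_iff lookup_hc split: if_splits)

lemma hc_homog: "homog d x \<Longrightarrow> hc e x = (if e = d then x else 0)"
  by (rule poly_mapping_eqI) (auto simp: homog_def in_keys_iff lookup_hc)

lemma hc_decomp: "x = (\<Sum>d\<in>gdeg ` keys x. hc d x)"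
proof (rule poly_mapping_eqI)
  fix w
  have "(\<Sum>d\<in>gdeg ` keys x. if gdeg w = d then lookup x w else 0) = lookup x w"
    by (auto simp: in_keys_iff)
  then show "lookup x w = lookup (\<Sum>d\<in>gdeg ` keys x. hc d x) w"
    by (simp add: lookup_sum lookup_hc)
qed

lemma gdeg_append: "gdeg (u @ v) = gdeg u + gdeg v"
  by (simp add: gdeg_def)

lemma homog_single: "homog (gdeg u) (Poly_Mapping.single u c)"
  by (simp add: homog_def)

lemma homog_mult: "homog d x \<Longrightarrow> homog e y \<Longrightarrow> homog (d + e) (x * y)"
  using keys_mult[of x y] unfolding homog_def by (force simp: plus_list_def gdeg_append)

lemma homog_add: "homog d x \<Longrightarrow> homog d y \<Longrightarrow> homog d (x + y)"
  using keys_add[of x y] unfolding homog_def by blast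

lemma homog_0: "homog d 0" by (simp add: homog_def)

lemma homog_sum: "(\<And>i. i \<in> A \<Longrightarrow> homog d (f i)) \<Longrightarrow> homog d (sum f A)"
  by (induction A rule: infinite_finite_induct) (auto intro: homog_0 homog_add)

lemma homog_diff: "homog d x \<Longrightarrow> homog d y \<Longrightarrow> homog d (x - y)"
proof -
  assume *: "homog d x" "homog d y"
  have "w \<in> keys x \<or> w \<in> keys y" if "w \<in> keys (x - y)" for w
    using that by (auto simp: in_keys_iff lookup_minus)
  then show ?thesis using * unfolding homog_def by blast
qed

lemma homog_scal: "homog d x \<Longrightarrow> homog d (scal c * x)"
  using homog_mult[OF homog_single[of "[]" c], of d x] by (simp add: gdeg_def)

lemma hc_mult_l: "homog d a \<Longrightarrow> hc e (a * x) = a * hc (e - d) x"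
proof (induction x rule: poly_mapping_add_induct)
  case (single u c)
  then have "homog (d + gdeg u) (a * Poly_Mapping.single u c)" by (intro homog_mult homog_single)
  then show ?case by (auto simp: hc_homog hc_homog[OF homog_single])
qed (simp_all add: hc_0 hc_add distrib_left)

lemma hc_mult_r: "homog d a \<Longrightarrow> hc e (x * a) = hc (e - d) x * a"
proof (induction x rule: poly_mapping_add_induct)
  case (single u c)
  then have "homog (gdeg u + d) (Poly_Mapping.single u c * a)" by (intro homog_mult homog_single)
  then show ?case by (auto simp: hc_homog hc_homog[OF homog_single])
qed (simp_all add: hc_0 hc_add distrib_right)

lemma lift_graded:
  assumes "\<forall>p\<in>P. \<forall>d. hcomp d p \<in> P" "x \<in> lift_ideal V0 E1 P"
  shows "hc d x \<in> lift_ideal V0 E1 P"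
proof -
  have "vres V0 E1 (lookup (hc d x)) = hcomp d (vres V0 E1 (lookup x))"
    unfolding lookup_hc' by (rule ext) (simp add: vres_def hcomp_def)
  then show ?thesis using assms unfolding lift_ideal_def mem_Collect_eq by simp
qed

lemma FA_hc: "lookup x \<in> FA V0 E1 \<Longrightarrow> lookup (hc d x) \<in> FA V0 E1"
  by (auto simp: FA_iff in_keys_iff lookup_hc split: if_splits)

lemma vx_FA: "v \<in> V0 \<Longrightarrow> lookup (vx v) \<in> FA V0 E1"
  by (intro mon_FA) (auto simp: validgen_def)

lemma FA_power: "lookup x \<in> FA V0 E1 \<Longrightarrow> 1 \<le> k \<Longrightarrow> lookup (x ^ k) \<in> FA V0 E1"
proof (induction k)
  case (Suc k)
  then show ?case by (cases "k = 0") (auto intro: FA_mult)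
qed simp

lemma scal_mem_iff:
  assumes "two_sided Q" "c \<noteq> 0"
  shows "scal c * x \<in> Q \<longleftrightarrow> x \<in> Q"
proof
  interpret two_sided Q by fact
  { assume "scal c * x \<in> Q"
    then have "scal (inverse c) * (scal c * x) \<in> Q" by (rule mult_l)
    then show "x \<in> Q" unfolding mult.assoc[symmetric] scal_mult using assms(2) by (simp add: mon_Nil) }
  show "x \<in> Q \<Longrightarrow> scal c * x \<in> Q" by (rule mult_l)
qed

section \<open>Linear functionals on the free algebra\<close>

definition lin :: "('a \<Rightarrow> 'k) \<Rightarrow> ('a \<Rightarrow>\<^sub>0 'k::field) \<Rightarrow> 'k" where
  "lin \<phi> x = (\<Sum>w\<in>keys x. lookup x w * \<phi> w)"

lemma lin_superset: "finite A \<Longrightarrow> keys x \<subseteq> A \<Longrightarrow> lin \<phi> x = (\<Sum>w\<in>A. lookup x w * \<phi> w)"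
  unfolding lin_def by (rule sum.mono_neutral_left) (auto simp: in_keys_iff)

lemma lin_add: "lin \<phi> (x + y) = lin \<phi> x + lin \<phi> y"
  using lin_superset[of "keys x \<union> keys y" x \<phi>] lin_superset[of "keys x \<union> keys y" y \<phi>]
    lin_superset[of "keys x \<union> keys y" "x + y" \<phi>] keys_add[of x y]
  by (simp add: lookup_add distrib_right sum.distrib)

lemma lin_single: "lin \<phi> (Poly_Mapping.single u c) = c * \<phi> u"
  using lin_superset[of "{u}" "Poly_Mapping.single u c" \<phi>] by simp

lemma lin_0: "lin \<phi> 0 = 0" by (simp add: lin_def)

lemma lin_scal: "lin \<phi> (scal c * x) = c * lin \<phi> x"
proof (induction x rule: poly_mapping_add_induct)
  case (single u d)
  then show ?case by (simp add: mult_single lin_single plus_list_def)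
qed (simp_all add: lin_0 lin_add distrib_left)

lemma lin_diff: "lin \<phi> (x - y) = lin \<phi> x - lin \<phi> y"
proof -
  have "lin \<phi> (x - y) + lin \<phi> y = lin \<phi> x" by (simp add: lin_add[symmetric])
  then show ?thesis by (simp add: eq_diff_eq)
qed

lemma lin_sum: "lin \<phi> (sum f A) = (\<Sum>i\<in>A. lin \<phi> (f i))"
  by (induction A rule: infinite_finite_induct) (simp_all add: lin_0 lin_add)

lemma lin_sandwich: "lin \<phi> (mon u * x * mon u') = lin (\<lambda>w. \<phi> (u @ w @ u')) x"
  by (induction x rule: poly_mapping_add_induct)
     (simp_all add: lin_0 lin_add lin_single mult_single plus_list_def distrib_left distrib_right)

lemma lookup_0_fun: "lookup 0 = (\<lambda>w. 0)"
  by (rule ext) simp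

lemma hcomp_0: "hcomp d (\<lambda>w. 0) = (\<lambda>w. 0)"
  by (rule ext) (simp add: hcomp_def)

lemma lookup_inject: "lookup x = lookup y \<Longrightarrow> x = y"
  by (rule poly_mapping_eqI) simp

lemma fideal_lookup:
  assumes "\<And>x. x \<in> N \<Longrightarrow> lookup x \<in> FA V0 E1" "0 \<in> N" "\<And>x y. x \<in> N \<Longrightarrow> y \<in> N \<Longrightarrow> x + y \<in> N"
    "\<And>c x. x \<in> N \<Longrightarrow> scal c * x \<in> N"
    "\<And>x z. x \<in> N \<Longrightarrow> lookup z \<in> FA V0 E1 \<Longrightarrow> x * z \<in> N"
    "\<And>x z. x \<in> N \<Longrightarrow> lookup z \<in> FA V0 E1 \<Longrightarrow> z * x \<in> N"
  shows "fideal V0 E1 (lookup ` N)"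
  unfolding fideal_def
proof (intro conjI ballI allI)
  have "lookup 0 = (\<lambda>w. 0)" by auto
  then show "(\<lambda>w. 0) \<in> lookup ` N" using assms(2) by force
  fix p assume "p \<in> lookup ` N"
  then obtain x where x: "p = lookup x" "x \<in> N" by blast
  { fix q assume "q \<in> lookup ` N"
    then obtain y where y: "q = lookup y" "y \<in> N" by blast
    show "fadd p q \<in> lookup ` N" unfolding x y fadd_lookup by (intro imageI assms x y) }
  { fix c show "fsc c p \<in> lookup ` N" unfolding x fsc_lookup by (intro imageI assms x) }
  fix q :: "('a,'b) gen list \<Rightarrow> 'c" assume q: "q \<in> FA V0 E1"
  let ?z = "Abs_poly_mapping q"
  have z: "lookup ?z = q" using q by (rule FA_lookup)
  have "fmul p q = lookup (x * ?z)" "fmul q p = lookup (?z * x)"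
    unfolding fmul_lookup[symmetric] x(1) z by (rule refl)+
  moreover have "x * ?z \<in> N" "?z * x \<in> N"
    using assms(5,6)[OF x(2), of ?z] q unfolding z by blast+
  ultimately show "fmul p q \<in> lookup ` N" "fmul q p \<in> lookup ` N" by simp_all
qed (use assms(1) in auto)

section \<open>The relations and the ideal generated by them\<close>

context digraph
begin

lemma Rel_cases:
  fixes q :: "('v,'e) gen list \<Rightarrow> 'k::field"
  assumes "q \<in> Rel V0 E1 s r"
  obtains (vv) v where "v \<in> V0" "q = lookup (mon [Vx v, Vx v] - mon [Vx v])"
  | (vw) v w where "v \<in> V0" "w \<in> V0" "v \<noteq> w" "q = lookup (mon [Vx v, Vx w])"
  | (se) e where "e \<in> E1" "q = lookup (mon [Vx (s e), Ed e] - mon [Ed e])"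
  | (er) e where "e \<in> E1" "q = lookup (mon [Ed e, Vx (r e)] - mon [Ed e])"
  | (rg) e where "e \<in> E1" "q = lookup (mon [Vx (r e), Gh e] - mon [Gh e])"
  | (gs) e where "e \<in> E1" "q = lookup (mon [Gh e, Vx (s e)] - mon [Gh e])"
  | (ge) e where "e \<in> E1" "q = lookup (mon [Gh e, Ed e] - mon [Vx (r e)])"
  | (gf) e f where "e \<in> E1" "f \<in> E1" "e \<noteq> f" "q = lookup (mon [Gh e, Ed f])"
  | (ck) v where "v \<in> V0" "{e\<in>E1. s e = v} \<noteq> {}" "finite {e\<in>E1. s e = v}"
      "q = lookup (mon [Vx v] - (\<Sum>e\<in>{e\<in>E1. s e = v}. mon [Ed e, Gh e]))"
proof -
  have sm: "(\<lambda>w. \<Sum>e\<in>A. wd [Ed e, Gh e] w) = lookup (\<Sum>e\<in>A. mon [Ed e, Gh e])" for A :: "'e set"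
    by (rule ext) (simp add: lookup_sum wd_lookup)
  show ?thesis
    using assms unfolding Rel_def wd_lookup fsub_lookup sm[unfolded wd_lookup]
    apply (elim UnE)
    subgoal using vv by blast
    subgoal using vw by blast
    subgoal using se by blast
    subgoal using er by blast
    subgoal using rg by blast
    subgoal using gs by blast
    subgoal using ge by blast
    subgoal using gf by blast
    subgoal using ck by blast
    done
qed

lemma Rel_homog:
  assumes "q \<in> Rel V0 E1 s r"
  shows "\<exists>x d. q = lookup x \<and> homog d x"
  using assms
proof (cases rule: Rel_cases)
  case (vv v) have "homog 0 (mon [Vx v, Vx v] - mon [Vx v] :: ('v,'e) gen list \<Rightarrow>\<^sub>0 'a)"
    by (intro homog_diff) (simp_all add: homog_def gdeg_def)
  then show ?thesis using vv by blast
next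
  case (vw v w) then show ?thesis using homog_single by blast
next
  case (se e) have "homog 1 (mon [Vx (s e), Ed e] - mon [Ed e] :: ('v,'e) gen list \<Rightarrow>\<^sub>0 'a)"
    by (intro homog_diff) (simp_all add: homog_def gdeg_def)
  then show ?thesis using se by blast
next
  case (er e) have "homog 1 (mon [Ed e, Vx (r e)] - mon [Ed e] :: ('v,'e) gen list \<Rightarrow>\<^sub>0 'a)"
    by (intro homog_diff) (simp_all add: homog_def gdeg_def)
  then show ?thesis using er by blast
next
  case (rg e) have "homog (-1) (mon [Vx (r e), Gh e] - mon [Gh e] :: ('v,'e) gen list \<Rightarrow>\<^sub>0 'a)"
    by (intro homog_diff) (simp_all add: homog_def gdeg_def)
  then show ?thesis using rg by blast
next
  case (gs e) have "homog (-1) (mon [Gh e, Vx (s e)] - mon [Gh e] :: ('v,'e) gen list \<Rightarrow>\<^sub>0 'a)"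
    by (intro homog_diff) (simp_all add: homog_def gdeg_def)
  then show ?thesis using gs by blast
next
  case (ge e) have "homog 0 (mon [Gh e, Ed e] - mon [Vx (r e)] :: ('v,'e) gen list \<Rightarrow>\<^sub>0 'a)"
    by (intro homog_diff) (simp_all add: homog_def gdeg_def)
  then show ?thesis using ge by blast
next
  case (gf e f) then show ?thesis using homog_single by blast
next
  case (ck v)
  have "homog 0 (mon [Vx v] - (\<Sum>e\<in>{e\<in>E1. s e = v}. mon [Ed e, Gh e]) :: ('v,'e) gen list \<Rightarrow>\<^sub>0 'a)"
    by (intro homog_diff homog_sum) (simp_all add: homog_def gdeg_def)
  then show ?thesis using ck by blast
qed

lemma Rel_FA: "q \<in> Rel V0 E1 s r \<Longrightarrow> q \<in> FA V0 E1"
  by (erule Rel_cases)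
    (auto intro!: FA_minus FA_sum mon_FA simp: validgen_def src_V0 rng_V0)

lemma LJ_gen_form:
  assumes "q \<in> Rel V0 E1 s r" "\<forall>g\<in>set u. validgen V0 E1 g" "\<forall>g\<in>set u'. validgen V0 E1 g"
  shows "\<exists>x d. q = lookup x \<and> homog d x \<and> lookup x \<in> FA V0 E1 \<and>
    fmul (fmul (wd u) q) (wd u') = lookup (mon u * x * mon u')"
  using Rel_homog[OF assms(1)] Rel_FA[OF assms(1)] by (auto simp: wd_lookup fmul_lookup)

lemma FA_word_mult:
  assumes "lookup x \<in> FA V0 E1" "\<forall>g\<in>set u. validgen V0 E1 g" 
  shows "lookup (mon u * x) \<in> FA V0 E1" "lookup (x * mon u) \<in> FA V0 E1"
  using assms keys_mult[of "mon u" x] keys_mult[of x "mon u"] unfolding FA_iff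
  by (fastforce simp: plus_list_def)+

lemma LJ_FA: "p \<in> LJ V0 E1 s r \<Longrightarrow> p \<in> FA V0 E1"
proof (induction rule: LJ.induct)
  case zero show ?case using FA_0 by (simp add: FA_def)
next
  case (add p q)
  then show ?case using FA_add[of "Abs_poly_mapping p" V0 E1 "Abs_poly_mapping q"]
    by (simp add: fadd_lookup[symmetric] FA_lookup)
next
  case (scal p c)
  then show ?case using FA_scal[of "Abs_poly_mapping p" V0 E1 c]
    by (simp add: fsc_lookup[symmetric] FA_lookup)
next
  case (gen q u u')
  then show ?case using LJ_gen_form[OF gen] FA_word_mult by metis
qed

lemma LJ_lookup: "p \<in> LJ V0 E1 s r \<Longrightarrow> \<exists>x. p = lookup x"
  using LJ_FA FA_lookup by metis

lemma LJ_0: "lookup 0 \<in> LJ V0 E1 s r"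
  unfolding lookup_0_fun by (rule LJ.zero)

lemma LJ_add: "lookup x \<in> LJ V0 E1 s r \<Longrightarrow> lookup y \<in> LJ V0 E1 s r \<Longrightarrow> lookup (x + y) \<in> LJ V0 E1 s r"
  using LJ.add by (metis fadd_lookup)

lemma LJ_scal: "lookup x \<in> LJ V0 E1 s r \<Longrightarrow> lookup (scal c * x) \<in> LJ V0 E1 s r"
  using LJ.scal by (metis fsc_lookup)

lemma LJ_sum: "(\<And>i. i \<in> A \<Longrightarrow> lookup (f i) \<in> LJ V0 E1 s r) \<Longrightarrow> lookup (sum f A) \<in> LJ V0 E1 s r"
  by (induction A rule: infinite_finite_induct) (auto intro: LJ_add LJ_0)

text \<open>\<open>LJ\<close> is the linear span of the products \<open>u q u'\<close> with
  \<open>q\<close> a relation, so multiplication by a word merely lengthens \<open>u\<close> or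
  \<open>u'\<close>.\<close>

lemma LJ_word:
  "p \<in> LJ V0 E1 s r \<Longrightarrow> \<forall>g\<in>set u. validgen V0 E1 g \<Longrightarrow>
    p = lookup x \<Longrightarrow> lookup (mon u * x) \<in> LJ V0 E1 s r \<and> lookup (x * mon u) \<in> LJ V0 E1 s r"
proof (induction arbitrary: x rule: LJ.induct)
  case zero
  then have "x = 0" unfolding lookup_0_fun[symmetric] by (metis lookup_inject)
  then show ?case using LJ_0 by (metis mult_zero_left mult_zero_right)
next
  case (add p q)
  obtain y z where y: "p = lookup y" "q = lookup z" using LJ_lookup add.hyps by blast
  then have "x = y + z" using add.prems fadd_lookup lookup_inject by metis
  then show ?case using add.IH(1)[OF add.prems(1) y(1)] add.IH(2)[OF add.prems(1) y(2)]
    by (simp add: distrib_left distrib_right LJ_add)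
next
  case (scal p c)
  obtain y where y: "p = lookup y" using LJ_lookup scal.hyps by blast
  then have "x = scal c * y" using scal.prems fsc_lookup lookup_inject by metis
  then show ?case using scal.IH[OF scal.prems(1) y] LJ_scal
    by (simp only: scal_left_commute mult.assoc) blast
next
  case (gen q v v')
  obtain y d where y: "q = lookup y" "fmul (fmul (wd v) q) (wd v') = lookup (mon v * y * mon v')"
    using LJ_gen_form[OF gen.hyps] by blast
  then have x: "x = mon v * y * mon v'" using gen.prems lookup_inject by metis
  have "mon u * x = mon (u @ v) * y * mon v'" "x * mon u = mon v * y * mon (v' @ u)"
    unfolding x mon_mult[symmetric] by (simp_all only: mult.assoc)
  moreover have "\<forall>g\<in>set (u @ v). validgen V0 E1 g" "\<forall>g\<in>set (v' @ u). validgen V0 E1 g"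
    using gen.prems(1) gen.hyps by auto
  ultimately show ?case
    using LJ.gen[OF gen.hyps(1), of "u @ v" v'] LJ.gen[OF gen.hyps(1), of v "v' @ u"] gen.hyps
    by (simp add: y(1) wd_lookup fmul_lookup)
qed

lemma LJ_mult:
  assumes "lookup x \<in> LJ V0 E1 s r" "lookup z \<in> FA V0 E1"
  shows "lookup (z * x) \<in> LJ V0 E1 s r" "lookup (x * z) \<in> LJ V0 E1 s r"
proof -
  have z: "z = (\<Sum>k\<in>keys z. scal (lookup z k) * mon k)"
    using poly_mapping_expand[of z] by (simp add: scal_mon)
  have v: "\<forall>g\<in>set k. validgen V0 E1 g" if "k \<in> keys z" for k
    using assms(2) that by (simp add: FA_iff)
  have "lookup (\<Sum>k\<in>keys z. scal (lookup z k) * (mon k * x)) \<in> LJ V0 E1 s r"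
    using LJ_word[OF assms(1) v refl] by (intro LJ_sum LJ_scal) blast
  also have "(\<Sum>k\<in>keys z. scal (lookup z k) * (mon k * x)) = z * x"
    by (subst (3) z) (simp add: sum_distrib_right mult.assoc)
  finally show "lookup (z * x) \<in> LJ V0 E1 s r" .
  have "lookup (\<Sum>k\<in>keys z. scal (lookup z k) * (x * mon k)) \<in> LJ V0 E1 s r"
    using LJ_word[OF assms(1) v refl] by (intro LJ_sum LJ_scal) blast
  also have "(\<Sum>k\<in>keys z. scal (lookup z k) * (x * mon k)) = x * z"
    by (subst (3) z) (simp only: sum_distrib_left scal_left_commute)
  finally show "lookup (x * z) \<in> LJ V0 E1 s r" .
qed

lemma fideal_LJ: "fideal V0 E1 (LJ V0 E1 s r :: (('v,'e) gen list \<Rightarrow> 'k::field) set)"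
proof -
  have "fideal V0 E1 (lookup ` {x :: ('v,'e) gen list \<Rightarrow>\<^sub>0 'k. lookup x \<in> LJ V0 E1 s r})"
    by (rule fideal_lookup) (auto intro: LJ_FA LJ_0 LJ_add LJ_scal LJ_mult)
  moreover have "lookup ` {x. lookup x \<in> LJ V0 E1 s r} = (LJ V0 E1 s r :: (('v,'e) gen list \<Rightarrow> 'k) set)"
    using LJ_lookup by (force simp: image_iff)
  ultimately show ?thesis by simp
qed

text \<open>The relations are homogeneous, so a spanning product \<open>u q u'\<close> equals its
  component in one degree and has component 0 in all others.\<close>

lemma LJ_hc: "p \<in> LJ V0 E1 s r \<Longrightarrow> hcomp d p \<in> LJ V0 E1 s r"
proof (induction rule: LJ.induct)
  case zero
  show ?case unfolding hcomp_0 by (rule LJ.zero)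
next
  case (add p q)
  have "hcomp d (fadd p q) = fadd (hcomp d p) (hcomp d q)" by (auto simp: hcomp_def fadd_def)
  then show ?case using add LJ.add by simp
next
  case (scal p c)
  have "hcomp d (fsc c p) = fsc c (hcomp d p)" by (auto simp: hcomp_def fsc_def)
  then show ?case using scal LJ.scal by simp
next
  case (gen q u u')
  obtain x e where x: "homog e x" "fmul (fmul (wd u) q) (wd u') = lookup (mon u * x * mon u')"
    using LJ_gen_form[OF gen] by blast
  have "homog (gdeg u + e + gdeg u') (mon u * x * mon u')"
    by (intro homog_mult homog_single x)
  then have "hc d (mon u * x * mon u') = mon u * x * mon u' \<or> hc d (mon u * x * mon u') = 0"
    by (simp add: hc_homog)
  then show ?case using LJ.gen[OF gen] LJ_0 unfolding x(2) lookup_hc'[symmetric] by metis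
qed

end

section \<open>Existence of graded prime ideals\<close>

context digraph
begin

text \<open>The set of lists absorbs a nonempty set of edges as a factor:
  \<open>(e, l) \<mapsto> e # l\<close> and \<open>l \<mapsto> (e0, l)\<close> are injections in the
  two directions, and Schroeder-Bernstein yields a bijection.\<close>

lemma edge_coding_exists:
  "\<exists>g :: 'e \<times> 'e list \<Rightarrow> 'e list. inj_on g ({e\<in>E1. s e = v} \<times> UNIV) \<and>
    ({e\<in>E1. s e = v} \<noteq> {} \<and> finite {e\<in>E1. s e = v} \<longrightarrow> g ` ({e\<in>E1. s e = v} \<times> UNIV) = UNIV)"
proof (cases "{e\<in>E1. s e = v} = {}")
  case False
  then obtain e0 where e0: "e0 \<in> {e\<in>E1. s e = v}" by blast
  have "\<exists>h. bij_betw h ({e\<in>E1. s e = v} \<times> (UNIV :: 'e list set)) (UNIV :: 'e list set)"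
    by (rule Schroeder_Bernstein[where f = "\<lambda>(e, l). e # l" and g = "Pair e0"])
      (use e0 in \<open>auto simp: inj_on_def\<close>)
  then obtain h :: "'e \<times> 'e list \<Rightarrow> 'e list" where "bij_betw h ({e\<in>E1. s e = v} \<times> UNIV) UNIV" by blast
  then show ?thesis unfolding bij_betw_def by blast
next
  case True
  show ?thesis unfolding True by simp
qed

text \<open>The pairs \<open>(v, l)\<close> form the basis of a module on which no vertex acts as zero: the edges
  from \<open>v\<close> embed the parts over their ranges disjointly into the part over \<open>v\<close>, and exhaust it when
  \<open>v\<close> emits a nonempty finite set of edges.\<close>

definition edge_code :: "'v \<Rightarrow> 'e \<times> 'e list \<Rightarrow> 'e list" where
  "edge_code v = (SOME g. inj_on g ({e\<in>E1. s e = v} \<times> UNIV) \<and>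
    ({e\<in>E1. s e = v} \<noteq> {} \<and> finite {e\<in>E1. s e = v} \<longrightarrow> g ` ({e\<in>E1. s e = v} \<times> UNIV) = UNIV))"

lemma edge_code:
  "inj_on (edge_code v) ({e\<in>E1. s e = v} \<times> UNIV)"
  "{e\<in>E1. s e = v} \<noteq> {} \<Longrightarrow> finite {e\<in>E1. s e = v} \<Longrightarrow> edge_code v ` ({e\<in>E1. s e = v} \<times> UNIV) = UNIV"
  using someI_ex[OF edge_coding_exists[of v]] unfolding edge_code_def by blast+

text \<open>Each generator sends a basis vector to a basis vector or to 0, the latter written
  \<open>None\<close>; so the module is recorded by partial maps of the basis. \<open>Gh e\<close>
  is the partial inverse of \<open>Ed e\<close>.\<close>

fun gact :: "('v,'e) gen \<Rightarrow> 'v \<times> 'e list \<Rightarrow> ('v \<times> 'e list) option" where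
  "gact (Vx v) b = (if fst b = v then Some b else None)"
| "gact (Ed e) b = (if e \<in> E1 \<and> fst b = r e then Some (s e, edge_code (s e) (e, snd b)) else None)"
| "gact (Gh e) b = (if e \<in> E1 \<and> fst b = s e \<and> (\<exists>l. snd b = edge_code (s e) (e, l))
    then Some (r e, SOME l. snd b = edge_code (s e) (e, l)) else None)"

fun wact :: "('v,'e) gen list \<Rightarrow> 'v \<times> 'e list \<Rightarrow> ('v \<times> 'e list) option" where
  "wact [] b = Some b"
| "wact (g # u) b = Option.bind (wact u b) (gact g)"

lemma wact_append: "wact (u @ u') b = Option.bind (wact u' b) (wact u)"
  by (induction u) (auto split: bind_splits)

lemma edge_code_inject:
  "e \<in> E1 \<Longrightarrow> f \<in> E1 \<Longrightarrow> s e = v \<Longrightarrow> s f = v \<Longrightarrow> edge_code v (e, l) = edge_code v (f, l') \<longleftrightarrow> e = f \<and> l = l'"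
  using inj_on_eq_iff[OF edge_code(1)[of v], of "(e, l)" "(f, l')"] by auto

text \<open>The total coefficient of \<open>w b\<close> on the basis vectors in \<open>X\<close>.
  Allowing arbitrary sets \<open>X\<close> keeps this family of functionals stable under
  multiplication by words on both sides, as needed for vanishing on all of
  \<open>LJ\<close>.\<close>

definition wact_ind :: "'v \<times> 'e list \<Rightarrow> ('v \<times> 'e list) set \<Rightarrow> ('v,'e) gen list \<Rightarrow> 'k::field" where
  "wact_ind b X w = (if \<exists>c\<in>X. wact w b = Some c then 1 else 0)"

lemma Rel_wact_ind:
  assumes "q \<in> Rel V0 E1 s r"
  shows "\<exists>x. q = lookup x \<and> (\<forall>b X. lin (wact_ind b X) x = 0)"
  using assms
proof (cases rule: Rel_cases)
  case (vv v)
  have "lin (wact_ind b X) (mon [Vx v, Vx v] - mon [Vx v]) = (0 :: 'a)" for b X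
    by (simp add: lin_diff lin_single wact_ind_def)
  then show ?thesis using vv by blast
next
  case (vw v w)
  then have "lin (wact_ind b X) (mon [Vx v, Vx w]) = (0 :: 'a)" for b X
    by (simp add: lin_single wact_ind_def)
  then show ?thesis using vw by blast
next
  case (se e)
  have "lin (wact_ind b X) (mon [Vx (s e), Ed e] - mon [Ed e]) = (0 :: 'a)" for b X
    by (simp add: lin_diff lin_single wact_ind_def)
  then show ?thesis using se by blast
next
  case (er e)
  have "lin (wact_ind b X) (mon [Ed e, Vx (r e)] - mon [Ed e]) = (0 :: 'a)" for b X
    by (simp add: lin_diff lin_single wact_ind_def)
  then show ?thesis using er by blast
next
  case (rg e)
  have "wact [Vx (r e), Gh e] b = wact [Gh e] b" for b by simp
  then have "lin (wact_ind b X) (mon [Vx (r e), Gh e] - mon [Gh e]) = (0 :: 'a)" for b X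
    by (simp only: lin_diff lin_single wact_ind_def) simp
  then show ?thesis using rg by blast
next
  case (gs e)
  have "wact [Gh e, Vx (s e)] b = wact [Gh e] b" for b by (cases "fst b = s e") simp_all
  then have "lin (wact_ind b X) (mon [Gh e, Vx (s e)] - mon [Gh e]) = (0 :: 'a)" for b X
    by (simp only: lin_diff lin_single wact_ind_def) simp
  then show ?thesis using gs by blast
next
  case (ge e)
  have "wact [Gh e, Ed e] b = wact [Vx (r e)] b" for b
    using ge(1) edge_code_inject[of e e "s e"] by (cases b) auto
  then have "lin (wact_ind b X) (mon [Gh e, Ed e] - mon [Vx (r e)]) = (0 :: 'a)" for b X
    by (simp only: lin_diff lin_single wact_ind_def) simp
  then show ?thesis using ge by blast
next
  case (gf e f)
  have "wact [Gh e, Ed f] b = None" for b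
    using gf(1-3) edge_code_inject[of f e "s e"] by (cases b) auto
  then have "lin (wact_ind b X) (mon [Gh e, Ed f]) = (0 :: 'a)" for b X
    by (simp only: lin_diff lin_single wact_ind_def) simp
  then show ?thesis using gf by blast
next
  case (ck v)
  have "lin (wact_ind b X) (mon [Vx v] - (\<Sum>e\<in>{e\<in>E1. s e = v}. mon [Ed e, Gh e])) = (0 :: 'a)" for b X
  proof -
    have L: "lin (wact_ind b X) (mon [Vx v] - (\<Sum>e\<in>{e\<in>E1. s e = v}. mon [Ed e, Gh e])) =
      wact_ind b X [Vx v] - (\<Sum>e\<in>{e\<in>E1. s e = v}. wact_ind b X [Ed e, Gh e] :: 'a)"
      by (simp only: lin_diff lin_sum lin_single mult_1)
    show ?thesis
    proof (cases "fst b = v")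
      case False
      then have "wact [Ed e, Gh e] b = None" if "s e = v" for e using that by auto
      then have "(\<Sum>e\<in>{e\<in>E1. s e = v}. wact_ind b X [Ed e, Gh e]) = (0 :: 'a)"
        by (intro sum.neutral) (simp add: wact_ind_def del: wact.simps)
      moreover have "wact_ind b X [Vx v] = (0 :: 'a)" using False by (simp add: wact_ind_def)
      ultimately show ?thesis by (simp only: L diff_0_right)
    next
      case True
      \<comment> \<open>The codes of the edges from \<open>v\<close> partition the set of lists, so
        exactly one edge \<open>e0\<close> decodes \<open>snd b\<close>. Its summand fixes
        \<open>b\<close> and the others send \<open>b\<close> to 0.\<close>
      have "snd b \<in> edge_code v ` ({e\<in>E1. s e = v} \<times> UNIV)"
        unfolding edge_code(2)[OF ck(2,3)] by simp
      then obtain e0 l0 where e0: "e0 \<in> E1" "s e0 = v" "snd b = edge_code v (e0, l0)" by auto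
      have other: "wact [Ed e, Gh e] b = (if e = e0 then Some b else None)" if "e \<in> E1" "s e = v" for e
        using that e0 True by (cases b) (auto simp: edge_code_inject)
      have "(\<Sum>e\<in>{e\<in>E1. s e = v}. wact_ind b X [Ed e, Gh e]) = 
          (\<Sum>e\<in>{e\<in>E1. s e = v}. if e = e0 then (if b \<in> X then 1 else 0) else (0 :: 'a))"
        by (intro sum.cong refl) (auto simp: wact_ind_def other simp del: wact.simps)
      also have "\<dots> = (if b \<in> X then 1 else 0)" using e0 ck(3) by simp
      finally have "(\<Sum>e\<in>{e\<in>E1. s e = v}. wact_ind b X [Ed e, Gh e]) = (if b \<in> X then 1 else 0 :: 'a)" .
      moreover have "wact_ind b X [Vx v] = (if b \<in> X then 1 else 0 :: 'a)" using True by (simp add: wact_ind_def)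
      ultimately show ?thesis by (simp only: L diff_self)
    qed
  qed
  then show ?thesis using ck by blast
qed

lemma LJ_wact_ind:
  assumes "p \<in> LJ V0 E1 s r"
  shows "\<exists>x. p = lookup x \<and> (\<forall>b X. lin (wact_ind b X) x = 0)"
  using assms
proof induction
  case zero
  show ?case unfolding lookup_0_fun[symmetric] using lin_0 by blast
next
  case (add p q)
  then show ?case by (metis add.right_neutral fadd_lookup lin_add)
next
  case (scal p c)
  then show ?case by (metis mult_zero_right fsc_lookup lin_scal)
next
  case (gen q u u')
  obtain x where x: "q = lookup x" "\<forall>b X. lin (wact_ind b X) x = 0" using Rel_wact_ind[OF gen(1)] by blast
  have "lin (wact_ind b X) (mon u * x * mon u') = 0" for b X
  proof (cases "wact u' b")
    case None
    then show ?thesis unfolding lin_sandwich by (simp add: wact_ind_def wact_append lin_def)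
  next
    case (Some b')
    \<comment> \<open>The right word moves the starting vector to \<open>b'\<close>, and the left
      word replaces \<open>X\<close> by its preimage.\<close>
    have "(\<exists>c\<in>X. wact (u @ w @ u') b = Some c) \<longleftrightarrow>
        (\<exists>c\<in>{c. \<exists>c'\<in>X. wact u c = Some c'}. wact w b' = Some c)" for w
      unfolding wact_append Some by (cases "wact w b'") auto
    then have "(\<lambda>w. wact_ind b X (u @ w @ u') :: 'a) = wact_ind b' {c. \<exists>c'\<in>X. wact u c = Some c'}"
      unfolding wact_ind_def by (simp only:)
    then show ?thesis unfolding lin_sandwich by (simp only: x(2)[rule_format])
  qed
  then show ?case unfolding x(1) wd_lookup fmul_lookup by blast
qed

text \<open>\<open>v\<close> fixes the basis vector \<open>(v, [])\<close>, on which every element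
  of \<open>J\<close> acts as 0.\<close>

lemma vx_not_LJ: "lookup (vx v :: ('v,'e) gen list \<Rightarrow>\<^sub>0 'k::field) \<notin> LJ V0 E1 s r"
proof
  assume "lookup (vx v :: ('v,'e) gen list \<Rightarrow>\<^sub>0 'k) \<in> LJ V0 E1 s r"
  from LJ_wact_ind[OF this] obtain x where
    x: "lookup (vx v) = lookup x" "\<forall>b X. lin (wact_ind b X) x = (0::'k)" by blast
  have "vx v = x" using x(1) by (rule lookup_inject)
  then have "lin (wact_ind (v, []) UNIV) (vx v :: ('v,'e) gen list \<Rightarrow>\<^sub>0 'k) = 0" using x(2) by simp
  then show False by (simp add: lin_single wact_ind_def)
qed

end

definition gideal :: "'v set \<Rightarrow> 'e set \<Rightarrow> (('v,'e) gen list \<Rightarrow>\<^sub>0 'k::field) set \<Rightarrow> bool" where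
  "gideal V0 E1 N \<longleftrightarrow> (\<forall>x\<in>N. lookup x \<in> FA V0 E1) \<and> 0 \<in> N \<and> (\<forall>x\<in>N. \<forall>y\<in>N. x + y \<in> N) \<and>
    (\<forall>c. \<forall>x\<in>N. scal c * x \<in> N) \<and> (\<forall>x\<in>N. \<forall>z. lookup z \<in> FA V0 E1 \<longrightarrow> x * z \<in> N \<and> z * x \<in> N) \<and>
    (\<forall>x\<in>N. \<forall>d. hc d x \<in> N)"

lemma gideal_lookup:
  assumes "gideal V0 E1 N"
  shows "fideal V0 E1 (lookup ` N)" "\<forall>p\<in>lookup ` N. \<forall>d. hcomp d p \<in> lookup ` N"
proof -
  note N = assms[unfolded gideal_def]
  show "fideal V0 E1 (lookup ` N)"
    by (rule fideal_lookup) (simp_all add: N)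
  show "\<forall>p\<in>lookup ` N. \<forall>d. hcomp d p \<in> lookup ` N"
    using N by (simp add: lookup_hc'[symmetric])
qed

text \<open>For homogeneous \<open>b\<close> the residuals of a graded ideal are again graded ideals; they replace
  products of ideals in the proof that an ideal maximal without \<open>v\<close> is prime.\<close>

lemma residual_l:
  assumes Q: "two_sided Q" "\<And>x d. x \<in> Q \<Longrightarrow> hc d x \<in> Q" and b: "homog d0 b"
  shows "gideal V0 E1 {x. lookup x \<in> FA V0 E1 \<and> (\<forall>z. lookup z \<in> FA V0 E1 \<longrightarrow> x * z * b \<in> Q)}"
proof -
  interpret two_sided Q by fact
  have sc: "scal c * x * z * b = scal c * (x * z * b)" for c x z by (simp only: mult.assoc)
  have "hc d x * z * b \<in> Q"
    if x: "\<forall>z. lookup z \<in> FA V0 E1 \<longrightarrow> x * z * b \<in> Q" and z: "lookup z \<in> FA V0 E1" for d x z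
  proof -
    have "hc d x * hc e z * b \<in> Q" for e
    proof -
      have "hc (d + e + d0) (x * hc e z * b) \<in> Q" using x FA_hc[OF z] Q(2) by blast
      then show ?thesis by (simp add: hc_mult_r[OF b] hc_mult_r[OF homog_hc])
    qed
    then have "(\<Sum>e\<in>gdeg ` keys z. hc d x * hc e z * b) \<in> Q" by (intro sum_mem)
    then show ?thesis by (simp add: sum_distrib_left[symmetric] sum_distrib_right[symmetric] hc_decomp[symmetric])
  qed
  moreover have "x * y * z * b \<in> Q" "y * x * z * b \<in> Q"
    if x: "\<forall>z. lookup z \<in> FA V0 E1 \<longrightarrow> x * z * b \<in> Q"
      and "lookup y \<in> FA V0 E1" "lookup z \<in> FA V0 E1" for x y z
    using x[rule_format, of "y * z"] x[rule_format, of z] FA_mult[of y V0 E1 z] mult_l[of "x * z * b" y] that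
    by (simp_all only: mult.assoc)
  ultimately show ?thesis
    unfolding gideal_def
    by (simp add: sc distrib_right zero add mult_l FA_0 FA_add FA_scal FA_mult FA_hc)
qed

lemma residual_r:
  assumes Q: "two_sided Q" "\<And>x d. x \<in> Q \<Longrightarrow> hc d x \<in> Q" and b: "homog d0 b"
  shows "gideal V0 E1 {x. lookup x \<in> FA V0 E1 \<and> (\<forall>z. lookup z \<in> FA V0 E1 \<longrightarrow> b * z * x \<in> Q)}"
proof -
  interpret two_sided Q by fact
  have sc: "b * z * (scal c * x) = scal c * (b * z * x)" for c x z by (rule scal_left_commute)
  have "b * z * hc d x \<in> Q"
    if x: "\<forall>z. lookup z \<in> FA V0 E1 \<longrightarrow> b * z * x \<in> Q" and z: "lookup z \<in> FA V0 E1" for d x z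
  proof -
    have "b * hc e z * hc d x \<in> Q" for e
    proof -
      have "hc (d0 + e + d) (b * hc e z * x) \<in> Q" using x FA_hc[OF z] Q(2) by blast
      then show ?thesis by (simp add: hc_mult_l[OF homog_mult[OF b homog_hc]])
    qed
    then have "(\<Sum>e\<in>gdeg ` keys z. b * hc e z * hc d x) \<in> Q" by (intro sum_mem)
    then show ?thesis by (simp add: sum_distrib_left[symmetric] sum_distrib_right[symmetric] hc_decomp[symmetric])
  qed
  moreover have "b * z * (x * y) \<in> Q" "b * z * (y * x) \<in> Q"
    if x: "\<forall>z. lookup z \<in> FA V0 E1 \<longrightarrow> b * z * x \<in> Q"
      and "lookup y \<in> FA V0 E1" "lookup z \<in> FA V0 E1" for x y z
    using x[rule_format, of "z * y"] x[rule_format, of z] FA_mult[of z V0 E1 y] mult_r[of "b * z * x" y] that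
    by (simp_all only: mult.assoc)
  ultimately show ?thesis
    unfolding gideal_def
    by (simp add: sc distrib_left zero add mult_l FA_0 FA_add FA_scal FA_mult FA_hc)
qed

context digraph
begin

text \<open>Zorn's lemma gives a graded ideal maximal among those avoiding \<open>v\<close>.
  Maximality compares graded ideals only and first yields primeness for homogeneous elements;
  components of top degree carry it over to arbitrary ideals.\<close>

lemma graded_prime_avoiding:
  assumes v: "v \<in> V0"
  shows "\<exists>P. graded_prime V0 E1 s r (P :: (('v,'e) gen list \<Rightarrow> 'k::field) set) \<and> lookup (vx v) \<notin> P"
proof -
  let ?S = "{P :: (('v,'e) gen list \<Rightarrow> 'k) set. LJ V0 E1 s r \<subseteq> P \<and> fideal V0 E1 P \<and>
     (\<forall>p\<in>P. \<forall>d. hcomp d p \<in> P) \<and> lookup (vx v) \<notin> P}"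
  have "\<exists>M\<in>?S. \<forall>X\<in>?S. M \<subseteq> X \<longrightarrow> X = M"
  proof (rule subset_Zorn_nonempty)
    show "?S \<noteq> {}" using fideal_LJ LJ_hc vx_not_LJ by blast
    fix C assume C: "C \<noteq> {}" "subset.chain ?S C"
    then have sub: "C \<subseteq> ?S" by (simp add: subset.chain_def)
    have tot: "A \<subseteq> B \<or> B \<subseteq> A" if "A \<in> C" "B \<in> C" for A B
      using C(2) that by (auto simp: subset.chain_def)
    have "fideal V0 E1 (\<Union>C)"
      unfolding fideal_def
    proof (intro conjI ballI allI)
      show "\<Union>C \<subseteq> FA V0 E1" using sub by (auto simp: fideal_def)
      show "(\<lambda>w. 0) \<in> \<Union>C" using C(1) sub by (auto simp: fideal_def)
      fix p assume "p \<in> \<Union>C"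
      then obtain A where A: "A \<in> C" "p \<in> A" by blast
      then have fA: "fideal V0 E1 A" using sub by blast
      { fix q assume "q \<in> \<Union>C"
        then obtain B where B: "B \<in> C" "q \<in> B" by blast
        then have fB: "fideal V0 E1 B" using sub by blast
        show "fadd p q \<in> \<Union>C"
        proof (cases "A \<subseteq> B")
          case True
          then have "fadd p q \<in> B" using A(2) B(2) fB by (auto simp: fideal_def)
          then show ?thesis using B(1) by blast
        next
          case False
          then have "fadd p q \<in> A" using tot[OF A(1) B(1)] A(2) B(2) fA by (auto simp: fideal_def)
          then show ?thesis using A(1) by blast
        qed }
      { fix c show "fsc c p \<in> \<Union>C" using A fA unfolding fideal_def by blast }
      fix q :: "('v,'e) gen list \<Rightarrow> 'k" assume "q \<in> FA V0 E1"
      then show "fmul p q \<in> \<Union>C" "fmul q p \<in> \<Union>C" using A fA unfolding fideal_def by blast+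
    qed
    moreover have "LJ V0 E1 s r \<subseteq> \<Union>C" using C(1) sub by blast
    moreover have "\<forall>p\<in>\<Union>C. \<forall>d. hcomp d p \<in> \<Union>C" using sub by blast
    moreover have "lookup (vx v) \<notin> \<Union>C" using sub by blast
    ultimately show "\<Union>C \<in> ?S" unfolding mem_Collect_eq by (intro conjI)
  qed
  then obtain P where PS: "P \<in> ?S" and max: "\<forall>X\<in>?S. P \<subseteq> X \<longrightarrow> X = P" by (rule bexE)
  from PS have P: "LJ V0 E1 s r \<subseteq> P" "fideal V0 E1 P" "\<forall>p\<in>P. \<forall>d. hcomp d p \<in> P" "lookup (vx v) \<notin> P"
    by simp_all
  define Q where "Q = lift_ideal V0 E1 P"
  interpret two_sided Q unfolding Q_def using P(2) by (rule lift_two_sided)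
  interpret leavitt_ideal Q V0 E1 s r
    unfolding Q_def using lift_leavitt_ideal[OF P(2,1)] src_V0 rng_V0 by (simp add: graph_def)
  have Qgr: "x \<in> Q \<Longrightarrow> hc d x \<in> Q" for x d unfolding Q_def by (rule lift_graded[OF P(3)])
  have QP: "lookup x \<in> FA V0 E1 \<Longrightarrow> x \<in> Q \<longleftrightarrow> lookup x \<in> P" for x unfolding Q_def by (rule lift_mem)
  have vFA: "lookup (vx v :: ('v,'e) gen list \<Rightarrow>\<^sub>0 'k) \<in> FA V0 E1" using v by (rule vx_FA)
  \<comment> \<open>Maximality in usable form: a graded ideal that properly enlarges
    \<open>Q\<close> within \<open>FA\<close> contains \<open>v\<close>.\<close>
  have big: "vx v \<in> N" if N: "gideal V0 E1 N" "\<And>x. x \<in> Q \<Longrightarrow> lookup x \<in> FA V0 E1 \<Longrightarrow> x \<in> N"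
    and a: "a \<in> N" "a \<notin> Q" for N a
  proof (rule ccontr)
    assume "vx v \<notin> N"
    then have "lookup (vx v) \<notin> lookup ` N" using lookup_inject by blast
    moreover have PN: "P \<subseteq> lookup ` N"
    proof
      fix p assume p: "p \<in> P"
      then have "p \<in> FA V0 E1" using P(2) by (auto simp: fideal_def)
      then have e: "lookup (Abs_poly_mapping p) = p" by (rule FA_lookup)
      then have "Abs_poly_mapping p \<in> N" using p \<open>p \<in> FA V0 E1\<close> by (intro N) (simp_all add: QP)
      then show "p \<in> lookup ` N" using e by force
    qed
    ultimately have "lookup ` N = P" using gideal_lookup[OF N(1)] P(1) by (intro max[rule_format]) auto
    moreover have "lookup a \<in> FA V0 E1" using N(1) a(1) by (simp add: gideal_def)
    ultimately show False using a QP by blast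
  qed
  \<comment> \<open>Two exchanges: the residual of \<open>b\<close> contains \<open>a\<close>, hence
    \<open>v\<close>; then the residual of \<open>v\<close> contains \<open>b\<close>, hence
    \<open>v\<close>. So \<open>v v v\<close>, which is congruent to \<open>v\<close>, lies in
    \<open>Q\<close>.\<close>
  have hprime: False if H: "(homog i a \<and> lookup a \<in> FA V0 E1 \<and> a \<notin> Q) \<and> (homog j b \<and> lookup b \<in> FA V0 E1 \<and> b \<notin> Q)
    \<and> (\<forall>z. lookup z \<in> FA V0 E1 \<longrightarrow> a * z * b \<in> Q)" for a b i j
  proof -
    have a: "homog i a" "lookup a \<in> FA V0 E1" "a \<notin> Q" and b: "homog j b" "lookup b \<in> FA V0 E1" "b \<notin> Q"
      and ab: "\<And>z. lookup z \<in> FA V0 E1 \<Longrightarrow> a * z * b \<in> Q" using H by blast+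
    let ?N1 = "{x. lookup x \<in> FA V0 E1 \<and> (\<forall>z. lookup z \<in> FA V0 E1 \<longrightarrow> x * z * b \<in> Q)}"
    let ?N2 = "{x. lookup x \<in> FA V0 E1 \<and> (\<forall>z. lookup z \<in> FA V0 E1 \<longrightarrow> vx v * z * x \<in> Q)}"
    have "vx v \<in> ?N1"
    proof (rule big)
      show "gideal V0 E1 ?N1" by (rule residual_l[OF two_sided_axioms Qgr b(1)])
      show "a \<in> ?N1" using a ab by simp
    qed (use a in \<open>simp_all add: mult_r\<close>)
    then have "vx v * z * b \<in> Q" if "lookup z \<in> FA V0 E1" for z using that by simp
    then have bN: "b \<in> ?N2" using b(2) by simp
    have "vx v \<in> ?N2"
    proof (rule big)
      show "gideal V0 E1 ?N2" by (rule residual_r[OF two_sided_axioms Qgr homog_single])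
    qed (use b(3) bN in \<open>simp_all add: mult_l\<close>)
    then have "vx v * vx v * vx v \<in> Q" using vFA by blast
    moreover have "cong (vx v * vx v * vx v) (vx v)" using cong_trans[OF cong_mult_r[OF vv] vv] .
    ultimately show False using cong_mem QP[OF vFA] P(4) by blast
  qed
  \<comment> \<open>The largest degree in which the component of \<open>x\<close> lies outside
    \<open>Q\<close>.\<close>
  have comp: "\<exists>i. hc i x \<notin> Q \<and> (\<forall>d>i. hc d x \<in> Q)" if "x \<notin> Q" for x
  proof -
    let ?D = "{d\<in>gdeg ` keys x. hc d x \<notin> Q}"
    have "?D \<noteq> {}" using that sum_mem[of "gdeg ` keys x" "\<lambda>d. hc d x"] hc_decomp[of x] by force
    moreover have fin: "finite ?D" by simp
    ultimately have "Max ?D \<in> ?D" by (rule Max_in[rotated])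
    moreover have "hc d x \<in> Q" if "d > Max ?D" for d
    proof (cases "d \<in> gdeg ` keys x")
      case True
      show ?thesis
      proof (rule ccontr)
        assume "hc d x \<notin> Q"
        then have "d \<le> Max ?D" using True by (intro Max_ge fin) simp
        then show False using that by simp
      qed
    next
      case False
      then have "hc d x = 0" by (intro poly_mapping_eqI) (auto simp: lookup_hc in_keys_iff)
      then show ?thesis by (simp add: zero)
    qed
    ultimately show ?thesis by blast
  qed
  have prime: "A \<subseteq> P \<or> B \<subseteq> P" if A: "fideal V0 E1 A" and B: "fideal V0 E1 B" and AB: "\<forall>a\<in>A. \<forall>b\<in>B. fmul a b \<in> P" for A B
  proof (rule ccontr)
    assume "\<not> (A \<subseteq> P \<or> B \<subseteq> P)"
    then obtain p q where p: "p \<in> A" "p \<notin> P" and q: "q \<in> B" "q \<notin> P" by blast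
    define a where "a = Abs_poly_mapping p"
    define b where "b = Abs_poly_mapping q"
    have pq: "p \<in> FA V0 E1" "q \<in> FA V0 E1" using A B p q by (auto simp: fideal_def)
    then have la: "lookup a = p" "lookup b = q" unfolding a_def b_def by (auto intro: FA_lookup)
    have aQ: "a \<notin> Q" "b \<notin> Q" using QP p q pq la by metis+
    have azb: "a * z * b \<in> Q" if "lookup z \<in> FA V0 E1" for z
    proof -
      have "fmul p (lookup z) \<in> A" using A p that by (auto simp: fideal_def)
      then have "fmul (fmul p (lookup z)) q \<in> P" using AB q by blast
      then have "lookup (a * z * b) \<in> P" by (simp only: la[symmetric] fmul_lookup)
      then show ?thesis using QP P(2) by (auto simp: fideal_def)
    qed
    obtain i where i: "hc i a \<notin> Q" "\<And>d. d > i \<Longrightarrow> hc d a \<in> Q" using comp[OF aQ(1)] by blast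
    obtain j where j: "hc j b \<notin> Q" "\<And>d. d > j \<Longrightarrow> hc d b \<in> Q" using comp[OF aQ(2)] by blast
    have hz: "hc i a * hc e z * hc j b \<in> Q" if z: "lookup z \<in> FA V0 E1" for z e
    proof -
      let ?z = "hc e z"
      have "hc (i + e + j) (a * ?z * b) \<in> Q" using azb FA_hc[OF z] Qgr by blast
      moreover have "hc (i + e + j) (a * ?z * b) = (\<Sum>d\<in>gdeg ` keys a. hc d a * ?z * hc (i + j - d) b)"
      proof -
        have "a * ?z * b = (\<Sum>d\<in>gdeg ` keys a. hc d a * ?z * b)"
          by (simp add: sum_distrib_right[symmetric] hc_decomp[symmetric])
        moreover have "hc (i + e + j) (hc d a * ?z * b) = hc d a * ?z * hc (i + j - d) b" for d
          unfolding hc_mult_l[OF homog_mult[OF homog_hc homog_hc]] by (simp add: algebra_simps)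
        ultimately show ?thesis by (simp add: hc_sum)
      qed
      ultimately have S: "(\<Sum>d\<in>gdeg ` keys a. hc d a * ?z * hc (i + j - d) b) \<in> Q" by simp
      \<comment> \<open>The degrees of the two outer factors add up to \<open>i + j\<close>. If
        \<open>d\<close> is not \<open>i\<close>, one of them exceeds its top degree
        \<open>i\<close> or \<open>j\<close>, so that factor is in \<open>Q\<close>.\<close>
      have U: "(\<Sum>d\<in>gdeg ` keys a - {i}. hc d a * ?z * hc (i + j - d) b) \<in> Q"
      proof (rule sum_mem)
        fix d assume "d \<in> gdeg ` keys a - {i}"
        then consider "d > i" | "i + j - d > j" by fastforce
        then show "hc d a * ?z * hc (i + j - d) b \<in> Q"
        proof cases
          case 1 then show ?thesis using i(2) mult_r by blast
        next
          case 2 then show ?thesis using j(2) mult_l by blast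
        qed
      qed
      have "i \<in> gdeg ` keys a"
      proof (rule ccontr)
        assume "i \<notin> gdeg ` keys a"
        then have "hc i a = 0" by (intro poly_mapping_eqI) (auto simp: lookup_hc in_keys_iff)
        then show False using i(1) zero by simp
      qed
      then have eq: "(\<Sum>d\<in>gdeg ` keys a. hc d a * ?z * hc (i + j - d) b) =
        hc i a * ?z * hc j b + (\<Sum>d\<in>gdeg ` keys a - {i}. hc d a * ?z * hc (i + j - d) b)"
        by (subst sum.remove[of _ i]) simp_all
      show ?thesis using diff_mem[OF S U] unfolding eq add_diff_cancel_right' .
    qed
    have hab: "hc i a * z * hc j b \<in> Q" if z: "lookup z \<in> FA V0 E1" for z
    proof -
      have "(\<Sum>e\<in>gdeg ` keys z. hc i a * hc e z * hc j b) \<in> Q" using hz[OF z] by (rule sum_mem)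
      then show ?thesis by (simp add: sum_distrib_left[symmetric] sum_distrib_right[symmetric] hc_decomp[symmetric])
    qed
    have fab: "lookup a \<in> FA V0 E1" "lookup b \<in> FA V0 E1" using pq la by simp_all
    have "\<forall>z. lookup z \<in> FA V0 E1 \<longrightarrow> hc i a * z * hc j b \<in> Q" using hab by blast
    with FA_hc[OF fab(1), of i] FA_hc[OF fab(2), of j] i(1) j(1) homog_hc[of i a] homog_hc[of j b]
    show False by (intro hprime[of i "hc i a" j "hc j b"] conjI)
  qed
  have ne: "P \<noteq> FA V0 E1" using vFA P(4) by blast
  have all: "\<forall>A B. fideal V0 E1 A \<and> fideal V0 E1 B \<and> (\<forall>a\<in>A. \<forall>b\<in>B. fmul a b \<in> P) \<longrightarrow> A \<subseteq> P \<or> B \<subseteq> P"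
    by (intro allI impI, elim conjE) (rule prime)
  have "graded_prime V0 E1 s r P"
    unfolding graded_prime_def by (rule conjI[OF P(1) conjI[OF P(2) conjI[OF P(3) conjI[OF ne all]]]])
  with P(4) show ?thesis by blast
qed

end

section \<open>Reduction of homogeneous elements\<close>

abbreviation gw :: "'e list \<Rightarrow> (('v,'e) gen list \<Rightarrow>\<^sub>0 'k::field)" where "gw p \<equiv> mon (map Gh p)"

lemma gw_snoc: "gw (p @ [f]) = gw p * gh f" by (simp add: mon_mult)
lemma gw_Cons: "gw (f # p) = gh f * gw p" by (simp add: mon_mult)

text \<open>The ghost part \<open>q\<close> is listed in the order of the word: \<open>(p, w, q)\<close> stands for \<open>p w (rev q)\<^sup>*\<close>.\<close>

fun nf :: "'e list \<times> 'v \<times> 'e list \<Rightarrow> (('v,'e) gen list \<Rightarrow>\<^sub>0 'k::field)" where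
  "nf (p, w, q) = pth p * vx w * gw q"

fun ghost :: "'e list \<times> 'v \<times> 'e list \<Rightarrow> 'e list" where "ghost (p, w, q) = q"
fun ndeg :: "'e list \<times> 'v \<times> 'e list \<Rightarrow> int" where "ndeg (p, w, q) = int (length p) - int (length q)"

context leavitt_ideal
begin

text \<open>Rewriting with the monomial relations keeps a word a single monomial or makes it 0; the
  sum in \<open>ck2\<close> is reserved for the reduction of combinations. The predicate
  \<open>R\<close> carries along degree and ghost length.\<close>

definition is_nf :: "(('v,'e) gen list \<Rightarrow>\<^sub>0 'k) \<Rightarrow> ('e list \<times> 'v \<times> 'e list \<Rightarrow> bool) \<Rightarrow> bool" where
  "is_nf x R \<longleftrightarrow> x \<approx> 0 \<or> (\<exists>t. R t \<and> x \<approx> nf t)"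

lemma is_nfI: "x \<approx> nf t \<Longrightarrow> R t \<Longrightarrow> is_nf x R" unfolding is_nf_def by blast
lemma is_nf0: "x \<approx> 0 \<Longrightarrow> is_nf x R" unfolding is_nf_def by blast
lemma is_nf_cong: "x \<approx> y \<Longrightarrow> is_nf y R \<Longrightarrow> is_nf x R"
  unfolding is_nf_def using cong_trans by blast

lemma vx_nf: "is_nf (vx v * nf (p, w, q)) (\<lambda>t. t = (p, w, q))"
proof (cases p)
  case Nil
  have eq: "vx v * nf (p, w, q) = (vx v * vx w) * gw q" by (simp add: Nil mon_Nil mult.assoc)
  show ?thesis
  proof (cases "v = w")
    case True
    have "(vx v * vx w) * gw q \<approx> vx w * gw q" unfolding True by (rule cong_mult_r[OF vv])
    then show ?thesis unfolding eq by (intro is_nfI[of _ "(p, w, q)"]) (simp_all add: Nil mon_Nil)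
  next
    case False
    then show ?thesis unfolding eq by (intro is_nf0 cong_mult_0l vw)
  qed
next
  case (Cons e p')
  have eq: "vx v * nf (p, w, q) = (vx v * ed e) * (pth p' * vx w * gw q)"
    by (simp only: Cons nf.simps pth_Cons mult.assoc)
  show ?thesis
  proof (cases "v = s e")
    case True
    have "(vx v * ed e) * (pth p' * vx w * gw q) \<approx> ed e * (pth p' * vx w * gw q)"
      unfolding True by (rule cong_mult_r[OF se])
    then show ?thesis unfolding eq
      by (intro is_nfI[of _ "(p, w, q)"]) (simp_all only: Cons nf.simps pth_Cons mult.assoc)
  next
    case False
    then show ?thesis unfolding eq by (intro is_nf0 cong_mult_0l ve)
  qed
qed

lemma gen_nf: "is_nf (mon [g] * nf t) (\<lambda>t'. ndeg t' = gdeg1 g + ndeg t)"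
proof -
  obtain p w q where t: "t = (p, w, q)" by (cases t)
  show ?thesis
  proof (cases g)
    case (Vx v)
    then show ?thesis using vx_nf[of v p w q] unfolding t is_nf_def by auto
  next
    case (Ed e)
    then show ?thesis unfolding t
      by (intro is_nfI[of _ "(e # p, w, q)"]) (simp_all add: mult.assoc[symmetric] mon_mult)
  next
    case (Gh e)
    show ?thesis
    proof (cases p)
      case Nil
      have eq: "mon [g] * nf t = (gh e * vx w) * gw q" by (simp add: t Gh Nil mon_Nil mult.assoc)
      show ?thesis
      proof (cases "w = s e")
        case True
        have "(gh e * vx w) * gw q \<approx> (vx (r e) * gh e) * gw q"
          unfolding True by (rule cong_mult_r[OF cong_trans[OF gs cong_sym[OF rg]]])
        also have "\<dots> = nf ([], r e, e # q)" by (simp add: mult.assoc gw_Cons mon_Nil mon_mult)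
        finally show ?thesis unfolding eq
          by (rule is_nfI) (simp add: t Gh Nil)
      next
        case False
        then show ?thesis unfolding eq by (intro is_nf0 cong_mult_0l gv)
      qed
    next
      case (Cons f p')
      have eq: "mon [g] * nf t = (gh e * ed f) * nf (p', w, q)"
        by (simp only: t Gh Cons nf.simps pth_Cons mult.assoc)
      show ?thesis
      proof (cases "e = f \<and> e \<in> E1")
        case True
        then have "gh e * ed f \<approx> vx (r e)" using ge'[of e] by auto
        then have "(gh e * ed f) * nf (p', w, q) \<approx> vx (r e) * nf (p', w, q)" by (rule cong_mult_r)
        then have "mon [g] * nf t \<approx> vx (r e) * nf (p', w, q)" unfolding eq .
        moreover have "is_nf (vx (r e) * nf (p', w, q)) (\<lambda>t'. ndeg t' = gdeg1 g + ndeg t)"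
          using vx_nf[of "r e" p' w q] unfolding is_nf_def by (auto simp: t Gh Cons)
        ultimately show ?thesis by (rule is_nf_cong)
      next
        case False
        then have "gh e * ed f \<approx> 0" using gf cong_mult_0l[OF inv_g] by blast
        then show ?thesis unfolding eq by (rule is_nf0[OF cong_mult_0l])
      qed
    qed
  qed
qed

lemma word_nf: "u \<noteq> [] \<Longrightarrow> is_nf (mon u) (\<lambda>t. ndeg t = gdeg u)"
proof (induction u)
  case (Cons g u)
  show ?case
  proof (cases "u = []")
    case True
    show ?thesis
    proof (cases g)
      case (Vx v)
      show ?thesis by (rule is_nfI[of _ "([], v, [])"]) (simp_all add: Vx True mon_Nil gdeg_def)
    next
      case (Ed e)
      have "ed e \<approx> nf ([e], r e, [])" using cong_sym[OF er] by (simp add: mon_Nil)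
      then show ?thesis unfolding Ed True by (rule is_nfI) (simp add: gdeg_def)
    next
      case (Gh e)
      have "gh e \<approx> nf ([], r e, [e])" using cong_sym[OF rg] by (simp add: mon_Nil)
      then show ?thesis unfolding Gh True by (rule is_nfI) (simp add: gdeg_def)
    qed
  next
    case False
    then have "is_nf (mon u) (\<lambda>t. ndeg t = gdeg u)" by (rule Cons.IH)
    then consider "mon u \<approx> 0" | t where "ndeg t = gdeg u" "mon u \<approx> nf t" unfolding is_nf_def by blast
    then show ?thesis
    proof cases
      case 1
      then have "mon [g] * mon u \<approx> 0" by (rule cong_mult_0r)
      then show ?thesis by (intro is_nf0) (simp add: mon_mult)
    next
      case 2
      have "mon [g] * mon u \<approx> mon [g] * nf t" by (rule cong_mult_l[OF 2(2)])
      then have "mon (g # u) \<approx> mon [g] * nf t" by (simp add: mon_mult)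
      then show ?thesis
        by (rule is_nf_cong) (use gen_nf[of g t] 2(1) in \<open>simp add: gdeg_def\<close>)
    qed
  qed
qed simp

text \<open>Summing over a set of triples merges terms with the same normal form, so that the
  remaining terms are pairwise different, as \<open>real_combination\<close> requires.\<close>

lemma collect:
  assumes "finite A" "\<And>i. i \<in> A \<Longrightarrow> is_nf (f i) R"
  shows "\<exists>B c'. finite B \<and> (\<forall>t\<in>B. R t) \<and> (\<Sum>i\<in>A. scal (c i) * f i) \<approx> (\<Sum>t\<in>B. scal (c' t) * nf t)"
proof -
  let ?A = "{i\<in>A. \<not> f i \<approx> 0}"
  have "\<forall>i\<in>?A. \<exists>t. R t \<and> f i \<approx> nf t" using assms(2) unfolding is_nf_def by blast
  from bchoice[OF this] obtain \<tau> where "\<forall>i\<in>?A. R (\<tau> i) \<and> f i \<approx> nf (\<tau> i)" ..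
  then have \<tau>: "\<And>i. i \<in> ?A \<Longrightarrow> R (\<tau> i) \<and> f i \<approx> nf (\<tau> i)" by (rule bspec)
  let ?c = "\<lambda>t. \<Sum>i\<in>{i\<in>?A. \<tau> i = t}. c i"
  have "(\<Sum>i\<in>A. scal (c i) * f i) = (\<Sum>i\<in>?A. scal (c i) * f i) + (\<Sum>i\<in>A - ?A. scal (c i) * f i)"
    using assms(1) by (subst sum.subset_diff[of ?A A]) (auto simp: add.commute)
  also have "\<dots> \<approx> (\<Sum>i\<in>?A. scal (c i) * nf (\<tau> i)) + 0"
    using \<tau> by (intro cong_add cong_sum cong_sum_0 cong_mult_l cong_mult_0r) auto
  also have "\<dots> = (\<Sum>t\<in>\<tau> ` ?A. \<Sum>i\<in>{i\<in>?A. \<tau> i = t}. scal (c i) * nf (\<tau> i))"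
    using assms(1) by (subst sum.image_gen[of ?A _ \<tau>]) auto
  also have "\<dots> = (\<Sum>t\<in>\<tau> ` ?A. scal (?c t) * nf t)"
  proof (rule sum.cong[OF refl])
    fix t
    have "(\<Sum>i\<in>{i\<in>?A. \<tau> i = t}. scal (c i) * nf (\<tau> i)) = (\<Sum>i\<in>{i\<in>?A. \<tau> i = t}. scal (c i)) * nf t"
      unfolding sum_distrib_right by (rule sum.cong) auto
    also have "(\<Sum>i\<in>{i\<in>?A. \<tau> i = t}. scal (c i)) = scal (?c t)"
      by (rule poly_mapping_eqI) (simp add: lookup_sum lookup_single when_def)
    finally show "(\<Sum>i\<in>{i\<in>?A. \<tau> i = t}. scal (c i) * nf (\<tau> i)) = scal (?c t) * nf t" .
  qed
  finally have "(\<Sum>i\<in>A. scal (c i) * f i) \<approx> (\<Sum>t\<in>\<tau> ` ?A. scal (?c t) * nf t)" .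
  moreover have "finite (\<tau> ` ?A)" "\<forall>t\<in>\<tau> ` ?A. R t" using assms(1) \<tau> by auto
  ultimately show ?thesis by (intro exI[of _ "\<tau> ` ?A"] exI[of _ ?c] conjI)
qed

fun tend :: "'e list \<times> 'v \<times> 'e list \<Rightarrow> 'v" where
  "tend (p, w, q) = (if q = [] then w else s (last q))"

lemma nf_vx: "nf t * vx v \<approx> (if v = tend t then nf t else 0)"
proof -
  obtain p w q where t: "t = (p, w, q)" by (cases t)
  show ?thesis
  proof (cases q rule: rev_cases)
    case Nil
    have "pth p * (vx w * vx v) \<approx> (if v = w then pth p * vx w else 0)"
      using cong_mult_l[OF vv[of w], of "pth p"] cong_mult_0r[OF vw[of w v], of "pth p"] by (cases "v = w") simp_all
    then show ?thesis by (cases "v = w") (simp_all add: t Nil mon_Nil mult.assoc)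
  next
    case (snoc q' f)
    have "(pth p * vx w * gw q') * (gh f * vx v) \<approx> (if v = s f then (pth p * vx w * gw q') * gh f else 0)"
      using cong_mult_l[OF gs[of f], of "pth p * vx w * gw q'"] cong_mult_0r[OF gv[of v f], of "pth p * vx w * gw q'"]
      by (cases "v = s f") simp_all
    then show ?thesis by (simp only: t snoc nf.simps tend.simps gw_snoc mult.assoc last_snoc snoc_eq_iff_butlast if_False) simp
  qed
qed

text \<open>An edge on the right cancels the last ghost edge or kills the monomial. Without ghost
  edges it lengthens the real path instead, or gives 0, and the truncated \<open>- 1\<close> covers
  this case.\<close>

lemma nf_ed:
  "is_nf (nf t * ed e) (\<lambda>t'. ndeg t' = ndeg t + 1 \<and> length (ghost t') \<le> length (ghost t) - 1)"
proof -
  obtain p w q where t: "t = (p, w, q)" by (cases t)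
  show ?thesis
  proof (cases q rule: rev_cases)
    case Nil
    have eq: "nf t * ed e = pth p * (vx w * ed e)" by (simp add: t Nil mon_Nil mult.assoc)
    show ?thesis
    proof (cases "w = s e")
      case True
      have "pth p * (vx w * ed e) \<approx> pth p * (ed e * vx (r e))"
        unfolding True by (rule cong_mult_l[OF cong_trans[OF se cong_sym[OF er]]])
      also have "\<dots> = nf (p @ [e], r e, [])" by (simp add: mon_Nil pth_append mult.assoc mon_mult)
      finally show ?thesis unfolding eq by (rule is_nfI) (simp add: t Nil)
    next
      case False
      then show ?thesis unfolding eq by (intro is_nf0 cong_mult_0r ve)
    qed
  next
    case (snoc q' f)
    have eq: "nf t * ed e = nf (p, w, q') * (gh f * ed e)"
      by (simp only: t snoc nf.simps gw_snoc mult.assoc)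
    show ?thesis
    proof (cases "f = e \<and> e \<in> E1")
      case True
      then have "nf t * ed e \<approx> nf (p, w, q') * vx (r e)"
        unfolding eq using ge'[of e] by (intro cong_mult_l) auto
      also have "\<dots> \<approx> (if r e = tend (p, w, q') then nf (p, w, q') else 0)" by (rule nf_vx)
      finally have "nf t * ed e \<approx> (if r e = tend (p, w, q') then nf (p, w, q') else 0)" .
      then show ?thesis
        by (cases "r e = tend (p, w, q')") (auto intro: is_nf0 is_nfI[of _ "(p, w, q')"] simp: t snoc)
    next
      case False
      then have "gh f * ed e \<approx> 0" using gf cong_mult_0r[OF inv_e] by blast
      then show ?thesis unfolding eq by (rule is_nf0[OF cong_mult_0r])
    qed
  qed
qed

lemma pth_vx_zero: "\<not> ends_at w p \<Longrightarrow> pth p * vx w \<approx> 0"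
proof (induction p)
  case (Cons e p)
  have eq: "pth (e # p) * vx w = ed e * (pth p * vx w)" by (simp only: pth_Cons mult.assoc)
  consider "e \<notin> E1" | "r e \<noteq> src w p" | "\<not> ends_at w p" using Cons.prems by auto
  then show ?case
  proof cases
    case 1 then show ?thesis unfolding eq by (intro cong_mult_0l inv_e)
  next
    case 2
    then have "ed e * vx (src w p) \<approx> 0" by (intro ev) simp
    then show ?thesis unfolding eq by (rule cong_chain[OF cong_sym[OF src_pth]])
  next
    case 3 then show ?thesis unfolding eq by (intro cong_mult_0r Cons.IH)
  qed
qed simp

text \<open>The scalar is invertible, so a two-sided ideal that contains \<open>Q\<close> and a
  reducible \<open>x\<close> contains a vertex.\<close>

definition reducible :: "(('v,'e) gen list \<Rightarrow>\<^sub>0 'k) \<Rightarrow> bool" where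
  "reducible x \<longleftrightarrow> (\<exists>a b k v. k \<noteq> 0 \<and> v \<in> V0 \<and> a * x * b \<approx> scal k * vx v)"

lemma reducible_mult: "reducible (a * x * b) \<Longrightarrow> reducible x"
proof -
  assume "reducible (a * x * b)"
  then obtain a' b' k v where *: "k \<noteq> 0" "v \<in> V0" "a' * (a * x * b) * b' \<approx> scal k * vx v"
    unfolding reducible_def by blast
  then have "(a' * a) * x * (b * b') \<approx> scal k * vx v" by (simp only: mult.assoc)
  then show ?thesis using * unfolding reducible_def by blast
qed

lemma reducible_cong: "x \<approx> y \<Longrightarrow> reducible y \<Longrightarrow> reducible x"
  unfolding reducible_def using cong_trans[OF cong_mult_r[OF cong_mult_l]] by blast

text \<open>Without ghosts, equal degree means equal length of the paths. Different paths of equal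
  length are incomparable, so the ghost of one path, together with its end vertex, isolates one
  coefficient.\<close>

lemma real_combination:
  assumes "finite A" "\<And>t. t \<in> A \<Longrightarrow> ghost t = [] \<and> ndeg t = d" "(\<Sum>t\<in>A. scal (c t) * nf t) \<notin> Q"
  shows "\<exists>a k w. k \<noteq> 0 \<and> w \<in> V0 \<and> w \<in> tend ` A \<and> a * (\<Sum>t\<in>A. scal (c t) * nf t) * vx w \<approx> scal k * vx w"
proof -
  obtain t where t: "t \<in> A" "scal (c t) * nf t \<notin> Q"
    using assms(3) sum_mem[of A "\<lambda>t. scal (c t) * nf t"] by blast
  obtain p w where tp: "t = (p, w, [])" using assms(2)[OF t(1)] by (cases t) auto
  have nz: "c t \<noteq> 0" using t(2) zero by (cases "c t = 0") auto
  have nf: "nf t = pth p * vx w" by (simp add: tp mon_Nil)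
  have "\<not> pth p * vx w \<approx> 0" using t(2) cong_mult_0r[of "nf t"] unfolding nf cong_0 by blast
  then have e: "ends_at w p" and w: "w \<in> V0"
    using pth_vx_zero cong_mult_0r[OF inv_v] by blast+
  have other: "gst p * (scal (c t') * nf t') * vx w \<approx> (if t' = t then scal (c t) * vx w else 0)" if t'A: "t' \<in> A" for t'
  proof -
    obtain p' w' where tp': "t' = (p', w', [])" using assms(2)[OF t'A] by (cases t') auto
    have len: "length p' = length p" using assms(2)[OF t'A] assms(2)[OF t(1)] by (simp add: tp tp')
    have "gst p * (scal (c t') * nf t') * vx w = scal (c t') * (gst p * pth p' * (vx w' * vx w))"
      by (simp add: tp' mon_Nil scal_left_commute mult.assoc)
    also have "\<dots> \<approx> (if t' = t then scal (c t) * vx w else 0)"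
    proof (cases "p' = p")
      case False
      then have "\<not> prefix p p'" "\<not> prefix p' p" using len by (auto simp: prefix_def)
      then have "gst p * pth p' \<approx> 0" by (rule gst_pth_parallel)
      then have "scal (c t') * (gst p * pth p' * (vx w' * vx w)) \<approx> 0"
        by (intro cong_mult_0r[OF cong_mult_0l])
      then show ?thesis using False by (simp add: tp tp')
    next
      case p: True
      show ?thesis
      proof (cases "w' = w")
        case True
        have "scal (c t') * (gst p * pth p' * (vx w' * vx w)) \<approx> scal (c t') * (gst p * pth p * vx w)"
          unfolding p True by (intro cong_mult_l vv)
        also have "\<dots> = scal (c t') * (gst p * (pth p * vx w))" by (simp only: mult.assoc)
        also have "\<dots> \<approx> scal (c t') * vx w" by (intro cong_mult_l gst_pth_self e)
        finally show ?thesis using p True by (simp add: tp tp')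
      next
        case False
        then have "scal (c t') * (gst p * pth p' * (vx w' * vx w)) \<approx> 0"
          by (intro cong_mult_0r vw)
        then show ?thesis using False by (simp add: tp tp')
      qed
    qed
    finally show ?thesis .
  qed
  have "gst p * (\<Sum>t\<in>A. scal (c t) * nf t) * vx w = (\<Sum>t'\<in>A. gst p * (scal (c t') * nf t') * vx w)"
    by (simp only: sum_distrib_left sum_distrib_right)
  also have "\<dots> \<approx> (\<Sum>t'\<in>A. if t' = t then scal (c t) * vx w else 0)" by (rule cong_sum[OF other])
  also have "\<dots> = scal (c t) * vx w" using assms(1) t(1) by simp
  finally have "gst p * (\<Sum>t\<in>A. scal (c t) * nf t) * vx w \<approx> scal (c t) * vx w" .
  moreover have "w \<in> tend ` A" using t(1) tp by force
  ultimately show ?thesis using nz w by blast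
qed

text \<open>Induction on the ghost length, which a right multiplication by an edge lowers. The
  difficulty is that every edge might send the element into \<open>Q\<close>. At a vertex emitting a
  nonempty finite set of edges \<open>ck2\<close> excludes this; at a sink or an infinite emitter
  the terms without ghosts are treated separately.\<close>

lemma nf_combination_reducible:
  assumes "finite A" "\<And>t. t \<in> A \<Longrightarrow> length (ghost t) \<le> n \<and> ndeg t = d" "(\<Sum>t\<in>A. scal (c t) * nf t) \<notin> Q"
  shows "reducible (\<Sum>t\<in>A. scal (c t) * nf t)"
  using assms
proof (induction n arbitrary: A c d)
  case 0
  then have "\<exists>a k w. k \<noteq> 0 \<and> w \<in> V0 \<and> w \<in> tend ` A \<and> a * (\<Sum>t\<in>A. scal (c t) * nf t) * vx w \<approx> scal k * vx w"
    by (intro real_combination) auto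
  then show ?case unfolding reducible_def by blast
next
  case (Suc n)
  let ?x = "\<Sum>t\<in>A. scal (c t) * nf t"
  define Av where "Av v = {t\<in>A. tend t = v}" for v
  let ?y = "\<lambda>v. \<Sum>t\<in>Av v. scal (c t) * nf t"
  have finAv: "finite (Av v)" for v using Suc.prems(1) by (simp add: Av_def)
  have xv: "?x * vx v \<approx> ?y v" for v
  proof -
    have "?x * vx v = (\<Sum>t\<in>A. scal (c t) * (nf t * vx v))" by (simp only: sum_distrib_right mult.assoc)
    also have "\<dots> \<approx> (\<Sum>t\<in>A. scal (c t) * (if v = tend t then nf t else 0))"
      by (intro cong_sum cong_mult_l nf_vx)
    also have "\<dots> = (\<Sum>t\<in>A. if tend t = v then scal (c t) * nf t else 0)"
      by (rule sum.cong) auto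
    also have "\<dots> = ?y v" unfolding Av_def using Suc.prems(1) by (intro sum.inter_filter[symmetric])
    finally show ?thesis .
  qed
  have "?x = (\<Sum>v\<in>tend ` A. ?y v)" unfolding Av_def using Suc.prems(1) by (rule sum.image_gen)
  then have "(\<Sum>v\<in>tend ` A. ?y v) \<notin> Q" using Suc.prems(3) by simp
  then have "\<exists>v. ?y v \<notin> Q" using sum_mem[of "tend ` A" ?y] by blast
  then obtain v where v: "?y v \<notin> Q" ..
  let ?z = "?y v"
  have zv: "?z * vx v \<approx> ?z"
  proof -
    have "?z * vx v = (\<Sum>t\<in>Av v. scal (c t) * (nf t * vx v))" by (simp only: sum_distrib_right mult.assoc)
    also have "\<dots> \<approx> ?z"
    proof (intro cong_sum cong_mult_l)
      fix t assume "t \<in> Av v"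
      then show "nf t * vx v \<approx> nf t" using nf_vx[of t v] by (simp add: Av_def)
    qed
    finally show ?thesis .
  qed
  have vV: "v \<in> V0"
  proof (rule ccontr)
    assume "v \<notin> V0"
    then have "?z * vx v \<approx> 0" by (intro cong_mult_0r inv_v)
    then show False using v cong_mem[OF zv] by (simp only: cong_0)
  qed
  \<comment> \<open>It is enough to find one edge that keeps \<open>?z\<close> outside
    \<open>Q\<close>: the ghost length then drops, at the price of raising the degree by 1.\<close>
  have IH: "reducible ?z" if e: "?z * ed e \<notin> Q" for e
  proof -
    have "\<exists>B c'. finite B \<and> (\<forall>t\<in>B. ndeg t = d + 1 \<and> length (ghost t) \<le> n) \<and>
        (\<Sum>t\<in>Av v. scal (c t) * (nf t * ed e)) \<approx> (\<Sum>t\<in>B. scal (c' t) * nf t)"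
    proof (rule collect[OF finAv])
      fix t assume "t \<in> Av v"
      then have "ndeg t = d" "length (ghost t) \<le> Suc n" using Suc.prems(2) by (auto simp: Av_def)
      then show "is_nf (nf t * ed e) (\<lambda>t. ndeg t = d + 1 \<and> length (ghost t) \<le> n)"
        using nf_ed[of t e] unfolding is_nf_def by fastforce
    qed
    then obtain B c' where B: "finite B" "\<forall>t\<in>B. ndeg t = d + 1 \<and> length (ghost t) \<le> n"
      "(\<Sum>t\<in>Av v. scal (c t) * (nf t * ed e)) \<approx> (\<Sum>t\<in>B. scal (c' t) * nf t)" by blast
    have eq: "(\<Sum>t\<in>Av v. scal (c t) * (nf t * ed e)) = ?z * ed e" by (simp only: sum_distrib_right mult.assoc)
    have "(\<Sum>t\<in>B. scal (c' t) * nf t) \<notin> Q" using e cong_mem[OF B(3)] unfolding eq by blast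
    then have "reducible (\<Sum>t\<in>B. scal (c' t) * nf t)" using B(1,2) by (intro Suc.IH[of B "d + 1"]) auto
    then have "reducible (1 * ?z * ed e)" using reducible_cong[OF B(3)] unfolding eq by simp
    then show ?thesis by (rule reducible_mult)
  qed
  have "reducible ?z"
  proof (cases "{e\<in>E1. s e = v} \<noteq> {} \<and> finite {e\<in>E1. s e = v}")
    case True
    have "?z \<approx> ?z * vx v" by (rule cong_sym[OF zv])
    also have "\<dots> \<approx> ?z * (\<Sum>e\<in>{e\<in>E1. s e = v}. ed e * gh e)"
      using True vV by (intro cong_mult_l ck2) auto
    also have "\<dots> = (\<Sum>e\<in>{e\<in>E1. s e = v}. (?z * ed e) * gh e)" by (simp only: sum_distrib_left mult.assoc)
    finally have "(\<Sum>e\<in>{e\<in>E1. s e = v}. (?z * ed e) * gh e) \<notin> Q" using v cong_mem by blast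
    then obtain e where "(?z * ed e) * gh e \<notin> Q" using sum_mem[of "{e\<in>E1. s e = v}" "\<lambda>e. (?z * ed e) * gh e"] by blast
    then show ?thesis using IH mult_r by blast
  next
    case False
    define A0 where "A0 = {t\<in>Av v. ghost t = []}"
    define A1 where "A1 = {t\<in>Av v. ghost t \<noteq> []}"
    let ?zr = "\<Sum>t\<in>A0. scal (c t) * nf t"
    let ?zg = "\<Sum>t\<in>A1. scal (c t) * nf t"
    have fin: "finite A0" "finite A1" using finAv by (auto simp: A0_def A1_def)
    have Av: "Av v = A0 \<union> A1" and dis: "A0 \<inter> A1 = {}" by (auto simp: A0_def A1_def)
    have split: "?z = ?zr + ?zg" unfolding Av by (rule sum.union_disjoint[OF fin dis])
    \<comment> \<open>The last ghost edges of the terms with ghosts. The sum of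
      \<open>ed e * gh e\<close> over the finite set \<open>F\<close> acts on these terms as the
      identity from the right and so takes the place of \<open>ck2\<close> when the ghost-free part
      is in \<open>Q\<close>.\<close>
    define F where "F = (\<lambda>t. last (ghost t)) ` A1"
    have finF: "finite F" using fin by (simp add: F_def)
    have nfl: "\<exists>x :: ('v,'e) gen list \<Rightarrow>\<^sub>0 'k. nf t = x * gh (last (ghost t)) \<and> s (last (ghost t)) = v" if tA: "t \<in> A1" for t
    proof -
      obtain p w q where t: "t = (p, w, q)" by (cases t)
      then have "q \<noteq> []" using tA by (simp add: A1_def)
      then obtain q' f where q: "q = q' @ [f]" by (cases q rule: rev_cases) auto
      have "(nf t :: ('v,'e) gen list \<Rightarrow>\<^sub>0 'k) = (pth p * vx w * gw q') * gh f" by (simp only: t q nf.simps gw_snoc mult.assoc)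
      moreover have "s f = v" using tA by (simp add: A1_def Av_def t q)
      ultimately show ?thesis by (intro exI[of _ "pth p * vx w * gw q'"]) (simp add: t q)
    qed
    show ?thesis
    proof (cases "?zr \<in> Q")
      case True
      have ghe: "gh f * (ed e * gh e) \<approx> (if e = f then gh f else 0)" for e f
      proof (cases "e = f \<and> e \<in> E1")
        case True
        then have ef: "f = e" "e \<in> E1" by blast+
        have "gh f * (ed e * gh e) = (gh e * ed e) * gh e" by (simp only: mult.assoc ef)
        also have "\<dots> \<approx> vx (r e) * gh e" by (intro cong_mult_r ge' ef)
        also have "\<dots> \<approx> gh e" by (rule rg)
        finally show ?thesis using True by simp
      next
        case False
        show ?thesis
        proof (cases "e = f")
          case True
          then have "gh e \<approx> 0" using False inv_g by blast
          then show ?thesis using True cong_trans[OF cong_mult_0l cong_sym] by auto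
        next
          case ne: False
          have "(gh f * ed e) * gh e \<approx> 0" using ne by (intro cong_mult_0l gf) simp
          then show ?thesis using ne by (simp only: mult.assoc if_False)
        qed
      qed
      have "(\<Sum>e\<in>F. ?zg * (ed e * gh e)) = (\<Sum>e\<in>F. \<Sum>t\<in>A1. scal (c t) * (nf t * (ed e * gh e)))"
        by (simp only: sum_distrib_right mult.assoc)
      also have "\<dots> = (\<Sum>t\<in>A1. \<Sum>e\<in>F. scal (c t) * (nf t * (ed e * gh e)))" by (rule sum.swap)
      also have "\<dots> \<approx> ?zg"
      proof (rule cong_sum)
        fix t assume t: "t \<in> A1"
        obtain x :: "('v,'e) gen list \<Rightarrow>\<^sub>0 'k" where x: "nf t = x * gh (last (ghost t))" using nfl[OF t] by blast
        have "(\<Sum>e\<in>F. scal (c t) * (nf t * (ed e * gh e))) =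
          scal (c t) * (x * (\<Sum>e\<in>F. gh (last (ghost t)) * (ed e * gh e)))"
          unfolding x by (simp only: sum_distrib_left mult.assoc)
        also have "\<dots> \<approx> scal (c t) * (x * (\<Sum>e\<in>F. if e = last (ghost t) then gh (last (ghost t)) else 0))"
          by (intro cong_mult_l cong_sum ghe)
        also have "\<dots> = scal (c t) * nf t" using finF t by (simp add: x F_def)
        finally show "(\<Sum>e\<in>F. scal (c t) * (nf t * (ed e * gh e))) \<approx> scal (c t) * nf t" .
      qed
      finally have S: "(\<Sum>e\<in>F. ?zg * (ed e * gh e)) \<approx> ?zg" .
      have "?zg \<notin> Q" using v True add unfolding split by blast
      then have "(\<Sum>e\<in>F. ?zg * (ed e * gh e)) \<notin> Q" using cong_mem[OF S] by blast
      then obtain e where "?zg * (ed e * gh e) \<notin> Q" using sum_mem[of F "\<lambda>e. ?zg * (ed e * gh e)"] by blast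
      then have e: "?zg * ed e \<notin> Q" using mult_r[of "?zg * ed e" "gh e"] by (auto simp: mult.assoc)
      have "?z * ed e \<notin> Q"
      proof
        assume *: "?z * ed e \<in> Q"
        have "?zr * ed e \<in> Q" using True by (rule mult_r)
        with * have "?z * ed e - ?zr * ed e \<in> Q" by (rule diff_mem)
        moreover have "?z * ed e - ?zr * ed e = ?zg * ed e" unfolding split by (simp add: algebra_simps)
        ultimately show False using e by (simp only:)
      qed
      then show ?thesis by (rule IH)
    next
      case z0: False
      have "\<exists>a k w. k \<noteq> 0 \<and> w \<in> V0 \<and> w \<in> tend ` A0 \<and> a * ?zr * vx w \<approx> scal k * vx w"
        by (rule real_combination[OF fin(1) _ z0]) (use Suc.prems(2) in \<open>auto simp: A0_def Av_def\<close>)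
      then obtain a k w where w: "w \<in> tend ` A0" and akw: "k \<noteq> 0" "a * ?zr * vx w \<approx> scal k * vx w" by blast
      have "w = v" using w by (auto simp: A0_def Av_def)
      then have ak: "a * ?zr * vx v \<approx> scal k * vx v" using akw(2) by simp
      show ?thesis
      proof (cases "{e\<in>E1. s e = v} = {}")
        case True
        \<comment> \<open>At a sink the ghost edges ending at \<open>v\<close> are not edges of the
          graph, so only the ghost-free part remains.\<close>
        have "?zg \<in> Q"
        proof (rule sum_mem)
          fix t assume "t \<in> A1"
          then obtain x :: "('v,'e) gen list \<Rightarrow>\<^sub>0 'k" where x: "nf t = x * gh (last (ghost t))" "s (last (ghost t)) = v" using nfl by blast
          then have "last (ghost t) \<notin> E1" using True by blast
          then have "x * gh (last (ghost t)) \<approx> 0" by (intro cong_mult_0r inv_g)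
          then show "scal (c t) * nf t \<in> Q" unfolding x(1)[symmetric] cong_0 by (rule mult_l)
        qed
        then have "a * ?z * vx v \<approx> a * ?zr * vx v"
          unfolding split by (intro cong_mult_l cong_mult_r) (simp add: cong_def)
        also note ak
        finally show ?thesis unfolding reducible_def using akw(1) vV by blast
      next
        case ne: False
        then have "infinite {e\<in>E1. s e = v}" using False by blast
        \<comment> \<open>An infinite emitter has an edge outside the finite set \<open>F\<close>.
          It annihilates all terms with ghosts and turns the reduction of the rest to
          \<open>v\<close> into one to \<open>r e\<close>.\<close>
        then obtain e where e: "e \<in> E1" "s e = v" "e \<notin> F"
          using finF finite_subset[of "{e\<in>E1. s e = v}" F] by blast
        have "?zg * ed e \<in> Q"
        proof -
          have eq: "?zg * ed e = (\<Sum>t\<in>A1. scal (c t) * (nf t * ed e))" by (simp only: sum_distrib_right mult.assoc)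
          have nq: "nf t * ed e \<in> Q" if t: "t \<in> A1" for t
          proof -
            obtain x :: "('v,'e) gen list \<Rightarrow>\<^sub>0 'k" where x: "nf t = x * gh (last (ghost t))" using nfl[OF t] by blast
            have "last (ghost t) \<noteq> e" using e(3) t by (auto simp: F_def)
            then have "x * (gh (last (ghost t)) * ed e) \<approx> 0" by (intro cong_mult_0r gf)
            then show ?thesis unfolding x cong_0 by (simp only: mult.assoc)
          qed
          show ?thesis unfolding eq by (rule sum_mem[OF mult_l[OF nq]])
        qed
        then have ze: "?z * ed e \<approx> ?zr * ed e"
          unfolding split by (simp add: cong_def distrib_right)
        have "(gh e * a) * ?z * ed e = (gh e * a) * (?z * ed e)" by (simp only: mult.assoc)
        also have "\<dots> \<approx> (gh e * a) * (?zr * ed e)" by (rule cong_mult_l[OF ze])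
        also have "\<dots> \<approx> (gh e * a) * (?zr * (vx v * ed e))"
          unfolding e(2)[symmetric] by (intro cong_mult_l cong_sym[OF se])
        also have "\<dots> = gh e * ((a * ?zr * vx v) * ed e)" by (simp only: mult.assoc)
        also have "\<dots> \<approx> gh e * ((scal k * vx v) * ed e)" by (intro cong_mult_l cong_mult_r ak)
        also have "\<dots> = scal k * (gh e * (vx (s e) * ed e))" by (simp only: mult.assoc scal_left_commute e(2))
        also have "\<dots> \<approx> scal k * (gh e * ed e)" by (intro cong_mult_l se)
        also have "\<dots> \<approx> scal k * vx (r e)" by (intro cong_mult_l ge' e(1))
        finally show ?thesis unfolding reducible_def using akw(1) rng_V0[OF e(1)] by blast
      qed
    qed
  qed
  then have "reducible (1 * ?x * vx v)" using reducible_cong[OF xv] by simp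
  then show ?case by (rule reducible_mult)
qed

text \<open>Homogeneity makes the real paths in the last stage equally long. For one vertex
  \<open>v\<close> with a single loop \<open>c\<close> and \<open>Q\<close> given by
  \<open>J\<close>, the element \<open>v + c\<close> generates a proper ideal and is not
  reducible.\<close>

theorem homogeneous_reducible:
  assumes "homog d x" "lookup x \<in> FA V0 E1" "x \<notin> Q"
  shows "reducible x"
proof -
  have "\<exists>B c'. finite B \<and> (\<forall>t\<in>B. ndeg t = d) \<and>
      (\<Sum>u\<in>keys x. scal (lookup x u) * mon u) \<approx> (\<Sum>t\<in>B. scal (c' t) * nf t)"
  proof (rule collect)
    fix u assume u: "u \<in> keys x"
    then have "u \<noteq> []" "gdeg u = d" using assms by (auto simp: FA_iff homog_def)
    then show "is_nf (mon u) (\<lambda>t. ndeg t = d)" using word_nf[of u] by simp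
  qed simp
  then obtain B c' where B: "finite B" "\<forall>t\<in>B. ndeg t = d"
    "(\<Sum>u\<in>keys x. scal (lookup x u) * mon u) \<approx> (\<Sum>t\<in>B. scal (c' t) * nf t)" by blast
  have eq: "(\<Sum>u\<in>keys x. scal (lookup x u) * mon u) = x"
    using poly_mapping_expand[of x] by (simp add: scal_mon)
  have "(\<Sum>t\<in>B. scal (c' t) * nf t) \<notin> Q" using cong_mem[OF B(3)] assms(3) unfolding eq by blast
  moreover have "length (ghost t) \<le> Max ((\<lambda>t. length (ghost t)) ` B)" if "t \<in> B" for t
    using B(1) that by (intro Max_ge) auto
  ultimately have "reducible (\<Sum>t\<in>B. scal (c' t) * nf t)"
    using B(1,2) by (intro nf_combination_reducible[where n = "Max ((\<lambda>t. length (ghost t)) ` B)" and d = d]) auto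
  then show ?thesis using reducible_cong[OF B(3)] unfolding eq by blast
qed

end

section \<open>Graded prime quotients as matrix rings\<close>

text \<open>Evaluation of a Laurent polynomial with \<open>z k\<close> in the place of
  \<open>x^k\<close>.\<close>

definition linz :: "(int \<Rightarrow> ('a list \<Rightarrow>\<^sub>0 'k::field)) \<Rightarrow> (int \<Rightarrow>\<^sub>0 'k) \<Rightarrow> ('a list \<Rightarrow>\<^sub>0 'k)" where
  "linz z f = (\<Sum>k\<in>keys f. scal (lookup f k) * z k)"

lemma linz_superset: "finite A \<Longrightarrow> keys f \<subseteq> A \<Longrightarrow> linz z f = (\<Sum>k\<in>A. scal (lookup f k) * z k)"
  unfolding linz_def by (rule sum.mono_neutral_left) (auto simp: in_keys_iff)

lemma linz_0: "linz z 0 = 0" by (simp add: linz_def)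

lemma linz_add: "linz z (f + g) = linz z f + linz z g"
  using linz_superset[of "keys f \<union> keys g" f z] linz_superset[of "keys f \<union> keys g" g z]
    linz_superset[of "keys f \<union> keys g" "f + g" z] keys_add[of f g]
  by (simp add: lookup_add single_add distrib_right sum.distrib)

lemma linz_sum: "linz z (sum f A) = (\<Sum>i\<in>A. linz z (f i))"
  by (induction A rule: infinite_finite_induct) (simp_all add: linz_0 linz_add)

lemma linz_single: "linz z (Poly_Mapping.single k c) = scal c * z k"
  using linz_superset[of "{k}" "Poly_Mapping.single k c" z] by simp

lemma linz_1: "linz z 1 = z 0"
  using linz_single[of z 0 1] by (simp add: mon_Nil)

lemma linz_scal: "linz z (Poly_Mapping.single 0 c * f) = scal c * linz z f"
proof (induction f rule: poly_mapping_add_induct)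
  case (single u d)
  have "scal (c * d) * z u = scal c * (scal d * z u)" by (simp only: scal_mult[symmetric] mult.assoc)
  then show ?case by (simp add: mult_single linz_single)
qed (simp_all add: linz_0 linz_add distrib_left)

lemma linz_mult: "linz z (f * g) = (\<Sum>k\<in>keys f. \<Sum>l\<in>keys g. scal (lookup f k * lookup g l) * z (k + l))"
proof -
  have "f * g = (\<Sum>k\<in>keys f. Poly_Mapping.single k (lookup f k)) * (\<Sum>l\<in>keys g. Poly_Mapping.single l (lookup g l))"
    using poly_mapping_expand[of f] poly_mapping_expand[of g] by simp
  also have "\<dots> = (\<Sum>k\<in>keys f. \<Sum>l\<in>keys g. Poly_Mapping.single (k + l) (lookup f k * lookup g l))"
    by (simp add: sum_product mult_single)
  finally have eq: "f * g = \<dots>" .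
  show ?thesis unfolding eq by (simp add: linz_sum linz_single)
qed

lemma lmul_lookup: "lmul (lookup f) (lookup g) = lookup (f * g)"
  by (rule ext) (simp add: lmul_def lookup_times_int in_keys_iff[symmetric])

lemma madd_lookup: "madd (\<lambda>i j. lookup (F i j)) (\<lambda>i j. lookup (G i j)) = (\<lambda>i j. lookup (F i j + G i j))"
  by (intro ext) (simp add: madd_def lookup_add)

lemma mmul_lookup: "mmul t (\<lambda>i j. lookup (F i j)) (\<lambda>i j. lookup (G i j)) = (\<lambda>i j. lookup (\<Sum>l<t. F i l * G l j))"
  by (intro ext) (simp add: mmul_def lmul_lookup lookup_sum)

lemma msc_lookup: "msc c (\<lambda>i j. lookup (F i j)) = (\<lambda>i j. lookup (Poly_Mapping.single 0 c * F i j))"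
  by (intro ext) (simp add: msc_def lookup_times_int)

definition matv :: "nat \<Rightarrow> bool \<Rightarrow> (nat \<Rightarrow> nat \<Rightarrow> int \<Rightarrow>\<^sub>0 'k::field) \<Rightarrow> bool" where
  "matv t b F \<longleftrightarrow> (\<forall>i j. t \<le> i \<or> t \<le> j \<longrightarrow> F i j = 0) \<and> (\<not> b \<longrightarrow> (\<forall>i j. keys (F i j) \<subseteq> {0}))"

lemma MatSet_lookup: "matv t b F \<Longrightarrow> (\<lambda>i j. lookup (F i j)) \<in> MatSet t b"
  unfolding matv_def MatSet_def by (auto simp: lookup_0_fun in_keys_iff subset_iff)

lemma MatSet_matv:
  assumes "M \<in> MatSet t b"
  shows "\<exists>F. matv t b F \<and> M = (\<lambda>i j. lookup (F i j))"
proof -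
  let ?F = "\<lambda>i j. Abs_poly_mapping (M i j)"
  have M: "lookup (?F i j) = M i j" for i j using assms by (simp add: MatSet_def)
  have "matv t b ?F"
    unfolding matv_def
  proof (intro conjI allI impI)
    fix i j assume "t \<le> i \<or> t \<le> j"
    then have "M i j = (\<lambda>k. 0)" using assms by (auto simp: MatSet_def)
    then show "?F i j = 0" by simp
  next
    fix i j assume "\<not> b"
    then show "keys (?F i j) \<subseteq> {0}" using assms by (auto simp: in_keys_iff M MatSet_def)
  qed
  then show ?thesis using M by (intro exI[of _ ?F]) simp
qed

lemma scal_mult_scal: "(scal c * x) * (scal d * y) = scal (c * d) * (x * y)"
  unfolding scal_mult[symmetric] mult.assoc scal_left_commute[of x d y] ..

text \<open>The data common to both corners: the \<open>a i\<close> and \<open>b i\<close> are dual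
  bases, \<open>z k\<close> is the power \<open>x^k\<close> in the corner with unit
  \<open>w\<close>, and \<open>B\<close> tells whether exponents other than 0 occur. By
  \<open>act\<close> each letter sends a basis element to 0 or to a basis element times a
  power.\<close>

locale corner_rep = leavitt_ideal Q V0 E1 s r
  for Q :: "(('v,'e) gen list \<Rightarrow>\<^sub>0 'k::field) set" and V0 :: "'v set" and E1 :: "'e set" and s r :: "'e \<Rightarrow> 'v" +
  fixes w :: 'v and t :: nat and a b :: "nat \<Rightarrow> ('v,'e) gen list \<Rightarrow>\<^sub>0 'k" and d :: "nat \<Rightarrow> int" and m :: int
    and z :: "int \<Rightarrow> ('v,'e) gen list \<Rightarrow>\<^sub>0 'k" and B :: bool
  assumes graded: "x \<in> Q \<Longrightarrow> hc k x \<in> Q"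
    and w: "w \<in> V0" "vx w \<notin> Q" and m: "0 < m"
    and delta: "i < t \<Longrightarrow> j < t \<Longrightarrow> b i * a j \<approx> (if i = j then vx w else 0)"
    and a_w: "i < t \<Longrightarrow> a i * vx w \<approx> a i"
    and z0: "z 0 = vx w"
    and zz: "B \<or> k = 0 \<and> l = 0 \<Longrightarrow> z k * z l \<approx> z (k + l)"
    and ha: "homog (d i) (a i)" and hb: "homog (- d i) (b i)" and hz: "B \<or> k = 0 \<Longrightarrow> homog (m * k) (z k)"
    and fa: "lookup (a i) \<in> FA V0 E1" and fb: "lookup (b i) \<in> FA V0 E1" and fz: "lookup (z k) \<in> FA V0 E1"
    and act: "j < t \<Longrightarrow> mon [g] * a j \<approx> 0 \<or> (\<exists>i<t. \<exists>k. (B \<or> k = 0) \<and> mon [g] * a j \<approx> a i * z k)"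
    and unit: "\<exists>i<t. a i = vx w"
begin

definition okf :: "(int \<Rightarrow>\<^sub>0 'k) \<Rightarrow> bool" where "okf f \<longleftrightarrow> (\<not> B \<longrightarrow> keys f \<subseteq> {0})"

lemma okf_keys: "okf f \<Longrightarrow> k \<in> keys f \<Longrightarrow> B \<or> k = 0"
  unfolding okf_def by blast

lemma linz_mult_cong:
  assumes "okf f" "okf g"
  shows "linz z f * linz z g \<approx> linz z (f * g)"
proof -
  have "linz z f * linz z g = (\<Sum>k\<in>keys f. \<Sum>l\<in>keys g. scal (lookup f k * lookup g l) * (z k * z l))"
    unfolding linz_def sum_product
    by (intro sum.cong refl scal_mult_scal)
  also have "\<dots> \<approx> linz z (f * g)"
    unfolding linz_mult
  proof (intro cong_sum cong_mult_l)
    fix k l assume "k \<in> keys f" "l \<in> keys g"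
    then have "B \<or> k = 0 \<and> l = 0" using okf_keys[OF assms(1)] okf_keys[OF assms(2)] by blast
    then show "z k * z l \<approx> z (k + l)" by (rule zz)
  qed
  finally show ?thesis .
qed

lemma w_linz: "okf f \<Longrightarrow> vx w * linz z f \<approx> linz z f"
  using linz_mult_cong[of "Poly_Mapping.single 0 1" f] by (simp add: okf_def linz_single linz_1 z0 mon_Nil)

lemma hc_linz:
  assumes "okf f" "k \<in> keys f"
  shows "hc (m * k) (linz z f) = scal (lookup f k) * z k"
proof -
  have comp: "hc (m * k) (scal (lookup f l) * z l) = (if k = l then scal (lookup f l) * z l else 0)"
    if "l \<in> keys f" for l
  proof -
    have "homog (m * l) (scal (lookup f l) * z l)"
      using okf_keys[OF assms(1) that] by (intro homog_scal hz)
    then show ?thesis using m by (simp add: hc_homog)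
  qed
  have "hc (m * k) (linz z f) = (\<Sum>l\<in>keys f. if k = l then scal (lookup f l) * z l else 0)"
    unfolding linz_def hc_sum by (rule sum.cong[OF refl comp])
  also have "\<dots> = scal (lookup f k) * z k" using assms(2) by simp
  finally show ?thesis .
qed

text \<open>As \<open>m\<close> is positive, the powers \<open>z k\<close> lie in different degrees.
  Since \<open>Q\<close> is graded, each term of an element of \<open>Q\<close> is in
  \<open>Q\<close>, and \<open>z (- k)\<close> carries it to a multiple of \<open>w\<close>.\<close>

lemma linz_inj:
  assumes "okf f" "linz z f \<in> Q"
  shows "f = 0"
proof (rule poly_mapping_eqI)
  fix k
  show "lookup f k = lookup 0 k"
  proof (cases "k \<in> keys f")
    case True
    have "scal (lookup f k) * z k \<in> Q" using graded[OF assms(2), of "m * k"] hc_linz[OF assms(1) True] by simp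
    then have "(scal (lookup f k) * z k) * z (- k) \<in> Q" by (rule mult_r)
    moreover have "(scal (lookup f k) * z k) * z (- k) \<approx> scal (lookup f k) * vx w"
    proof -
      have "z k * z (- k) \<approx> z (k + - k)" using okf_keys[OF assms(1) True] by (intro zz) auto
      then have "scal (lookup f k) * (z k * z (- k)) \<approx> scal (lookup f k) * vx w"
        by (intro cong_mult_l) (simp add: z0)
      then show ?thesis by (simp only: mult.assoc)
    qed
    ultimately have "scal (lookup f k) * vx w \<in> Q" using cong_mem by blast
    then have "lookup f k = 0" using scal_mem_iff[OF two_sided_axioms] w(2) by blast
    then show ?thesis by simp
  qed (simp add: in_keys_iff)
qed

text \<open>\<open>F\<close> is the matrix of left multiplication by \<open>p\<close> on
  \<open>Lw\<close>, taken modulo \<open>Q\<close> as a right module over the corner with basis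
  \<open>a j\<close>.\<close>

definition rep :: "(('v,'e) gen list \<Rightarrow>\<^sub>0 'k) \<Rightarrow> (nat \<Rightarrow> nat \<Rightarrow> int \<Rightarrow>\<^sub>0 'k) \<Rightarrow> bool" where
  "rep p F \<longleftrightarrow> (\<forall>j<t. p * a j \<approx> (\<Sum>i<t. a i * linz z (F i j)))"

lemma matv_okf: "matv t B F \<Longrightarrow> okf (F i j)" by (simp add: matv_def okf_def)

lemma okf_mult: "okf f \<Longrightarrow> okf g \<Longrightarrow> okf (f * g)"
  using keys_mult[of f g] unfolding okf_def by fastforce

lemma okf_sum: "(\<And>i. i \<in> A \<Longrightarrow> okf (f i)) \<Longrightarrow> okf (sum f A)"
  using Poly_Mapping.keys_sum[of f A] unfolding okf_def by blast

lemma coefficient: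
  assumes "i < t" "\<And>i. okf (h i)"
  shows "b i * (\<Sum>l<t. a l * linz z (h l)) \<approx> linz z (h i)"
proof -
  have "b i * (\<Sum>l<t. a l * linz z (h l)) = (\<Sum>l<t. (b i * a l) * linz z (h l))"
    by (simp only: sum_distrib_left mult.assoc)
  also have "\<dots> \<approx> (\<Sum>l<t. (if i = l then vx w else 0) * linz z (h l))"
    using assms(1) by (intro cong_sum cong_mult_r delta) auto
  also have "\<dots> = (\<Sum>l<t. if i = l then vx w * linz z (h l) else 0)" by (rule sum.cong) auto
  also have "\<dots> = vx w * linz z (h i)" using assms(1) by simp
  also have "\<dots> \<approx> linz z (h i)" using assms(2) by (rule w_linz)
  finally show ?thesis .
qed

lemma rep_coefficient: "rep p F \<Longrightarrow> matv t B F \<Longrightarrow> i < t \<Longrightarrow> j < t \<Longrightarrow> b i * (p * a j) \<approx> linz z (F i j)"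
  unfolding rep_def
  by (rule cong_trans[OF cong_mult_l coefficient]) (auto intro: matv_okf)

lemma okf_diff: "okf f \<Longrightarrow> okf g \<Longrightarrow> okf (f - g)"
proof -
  assume *: "okf f" "okf g"
  have "w \<in> keys f \<or> w \<in> keys g" if "w \<in> keys (f - g)" for w
    using that by (auto simp: in_keys_iff lookup_minus)
  then show ?thesis using * unfolding okf_def by blast
qed

lemma linz_diff: "linz z (f - g) = linz z f - linz z g"
  using linz_add[of z "f - g" g] by (simp add: eq_diff_eq)

lemma rep_unique:
  assumes "rep p F" "matv t B F" "rep p G" "matv t B G"
  shows "F = G"
proof (intro ext)
  fix i j
  show "F i j = G i j"
  proof (cases "i < t \<and> j < t")
    case True
    then have "linz z (F i j) \<approx> linz z (G i j)"
      using rep_coefficient[OF assms(1,2), of i j] rep_coefficient[OF assms(3,4), of i j] cong_sym cong_trans by blast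
    then have "linz z (F i j - G i j) \<in> Q" by (simp add: cong_def linz_diff)
    then have "F i j - G i j = 0" using assms(2,4) by (intro linz_inj okf_diff matv_okf)
    then show ?thesis by simp
  next
    case False
    then show ?thesis using assms(2,4) by (auto simp: matv_def)
  qed
qed

lemma rep_add: "rep p F \<Longrightarrow> rep q G \<Longrightarrow> rep (p + q) (\<lambda>i j. F i j + G i j)"
  unfolding rep_def by (simp add: distrib_right linz_add distrib_left sum.distrib cong_add)

lemma rep_scal: "rep p F \<Longrightarrow> rep (scal c * p) (\<lambda>i j. Poly_Mapping.single 0 c * F i j)"
  unfolding rep_def linz_scal
proof (intro allI impI)
  fix j assume *: "\<forall>j<t. p * a j \<approx> (\<Sum>i<t. a i * linz z (F i j))" "j < t"
  have "scal c * (p * a j) \<approx> scal c * (\<Sum>i<t. a i * linz z (F i j))" using * by (intro cong_mult_l) simp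
  also have "\<dots> = (\<Sum>i<t. a i * (scal c * linz z (F i j)))" by (simp only: sum_distrib_left scal_left_commute)
  finally show "scal c * p * a j \<approx> (\<Sum>i<t. a i * (scal c * linz z (F i j)))" by (simp only: mult.assoc)
qed

lemma rep_mult:
  assumes "rep p F" "matv t B F" "rep q G" "matv t B G"
  shows "rep (p * q) (\<lambda>i j. \<Sum>l<t. F i l * G l j)"
  unfolding rep_def
proof (intro allI impI)
  fix j assume j: "j < t"
  have "p * q * a j = p * (q * a j)" by (simp only: mult.assoc)
  also have "\<dots> \<approx> p * (\<Sum>l<t. a l * linz z (G l j))"
    using assms(3) j unfolding rep_def by (intro cong_mult_l) simp
  also have "\<dots> = (\<Sum>l<t. (p * a l) * linz z (G l j))" by (simp only: sum_distrib_left mult.assoc)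
  also have "\<dots> \<approx> (\<Sum>l<t. (\<Sum>i<t. a i * linz z (F i l)) * linz z (G l j))"
    using assms(1) unfolding rep_def by (intro cong_sum cong_mult_r) simp
  also have "\<dots> = (\<Sum>l<t. \<Sum>i<t. a i * (linz z (F i l) * linz z (G l j)))"
    by (simp only: sum_distrib_right mult.assoc)
  also have "\<dots> = (\<Sum>i<t. \<Sum>l<t. a i * (linz z (F i l) * linz z (G l j)))" by (rule sum.swap)
  also have "\<dots> \<approx> (\<Sum>i<t. \<Sum>l<t. a i * linz z (F i l * G l j))"
    using assms(2,4) by (intro cong_sum cong_mult_l linz_mult_cong matv_okf)
  also have "\<dots> = (\<Sum>i<t. a i * linz z (\<Sum>l<t. F i l * G l j))"
    by (simp only: linz_sum sum_distrib_left)
  finally show "p * q * a j \<approx> (\<Sum>i<t. a i * linz z (\<Sum>l<t. F i l * G l j))" .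
qed

lemma matv_add: "matv t B F \<Longrightarrow> matv t B G \<Longrightarrow> matv t B (\<lambda>i j. F i j + G i j)"
  unfolding matv_def using keys_add by fastforce

lemma matv_mult:
  fixes F G :: "nat \<Rightarrow> nat \<Rightarrow> int \<Rightarrow>\<^sub>0 'k"
  shows "matv t B F \<Longrightarrow> matv t B G \<Longrightarrow> matv t B (\<lambda>i j. \<Sum>l<t. F i l * G l j)"
proof -
  assume *: "matv t B F" "matv t B G"
  have "okf (\<Sum>l<t. F i l * G l j)" for i j
    using * by (intro okf_sum okf_mult matv_okf)
  then show ?thesis using * by (auto simp: matv_def okf_def)
qed

lemma matv_scal:
  fixes F :: "nat \<Rightarrow> nat \<Rightarrow> int \<Rightarrow>\<^sub>0 'k"
  shows "matv t B F \<Longrightarrow> matv t B (\<lambda>i j. Poly_Mapping.single 0 c * F i j)"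
proof -
  assume *: "matv t B F"
  have "okf (Poly_Mapping.single 0 c * F i j)" for i j
    by (rule okf_mult[OF _ matv_okf[OF *]]) (auto simp: okf_def)
  then show ?thesis using * by (auto simp: matv_def okf_def)
qed

lemma rep_gen: "\<exists>F. matv t B F \<and> rep (mon [g]) F"
proof -
  have "\<forall>j\<in>{j. j < t}. \<exists>h. (\<forall>i. t \<le> i \<longrightarrow> h i = 0) \<and> (\<forall>i. okf (h i)) \<and> mon [g] * a j \<approx> (\<Sum>i<t. a i * linz z (h i))"
  proof
    fix j assume "j \<in> {j. j < t}"
    then have j: "j < t" by simp
    consider "mon [g] * a j \<approx> 0" | i k where "i < t" "B \<or> k = 0" "mon [g] * a j \<approx> a i * z k"
      using act[OF j, of g] by blast
    then show "\<exists>h. (\<forall>i. t \<le> i \<longrightarrow> h i = 0) \<and> (\<forall>i. okf (h i)) \<and> mon [g] * a j \<approx> (\<Sum>i<t. a i * linz z (h i))"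
    proof cases
      case 1
      then show ?thesis by (intro exI[of _ "\<lambda>i. 0"]) (simp add: linz_0 okf_def)
    next
      case 2
      let ?h = "\<lambda>l. if l = i then Poly_Mapping.single k 1 else 0"
      have "(\<Sum>l<t. a l * linz z (?h l)) = (\<Sum>l<t. if l = i then a i * z k else 0)"
        by (rule sum.cong) (auto simp: linz_0 linz_single mon_Nil)
      also have "\<dots> = a i * z k" using 2(1) by simp
      finally have "mon [g] * a j \<approx> (\<Sum>l<t. a l * linz z (?h l))" using 2(3) by (simp only:)
      moreover have "\<forall>l. t \<le> l \<longrightarrow> ?h l = 0" "\<forall>l. okf (?h l)" using 2(1,2) by (auto simp: okf_def)
      ultimately show ?thesis by (intro exI[of _ ?h] conjI)
    qed
  qed
  from bchoice[OF this] obtain h where h: "\<forall>j\<in>{j. j < t}. (\<forall>i. t \<le> i \<longrightarrow> h j i = 0) \<and> (\<forall>i. okf (h j i)) \<and>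
      mon [g] * a j \<approx> (\<Sum>i<t. a i * linz z (h j i))" ..
  let ?F = "\<lambda>i j. if j < t then h j i else 0"
  have "matv t B ?F" using h by (auto simp: matv_def okf_def)
  moreover have "rep (mon [g]) ?F" using h by (simp add: rep_def)
  ultimately show ?thesis by blast
qed

lemma rep_exists: "\<exists>F. matv t B F \<and> rep p F"
proof (induction p rule: poly_mapping_add_induct)
  case zero
  have "rep 0 (\<lambda>i j. 0)" by (simp add: rep_def linz_0)
  then show ?case by (intro exI[of _ "\<lambda>i j. 0"]) (simp add: matv_def)
next
  case (add x y)
  then show ?case using rep_add matv_add by blast
next
  case (single u c)
  have "\<exists>F. matv t B F \<and> rep (mon u) F"
  proof (induction u)
    case Nil
    let ?F = "\<lambda>i j. if i = j \<and> j < t then Poly_Mapping.single 0 1 else (0 :: int \<Rightarrow>\<^sub>0 'k)"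
    have "a j \<approx> (\<Sum>i<t. a i * linz z (?F i j))" if j: "j < t" for j
    proof -
      have "(\<Sum>i<t. a i * linz z (?F i j)) = (\<Sum>i<t. if i = j then a i * vx w else 0)"
        using j by (intro sum.cong) (auto simp: linz_0 linz_single linz_1 mon_Nil z0)
      also have "\<dots> = a j * vx w" using j by simp
      finally show ?thesis using cong_sym[OF a_w[OF j]] by (simp only:)
    qed
    then have "rep (mon []) ?F" by (simp add: rep_def mon_Nil)
    moreover have "matv t B ?F" by (auto simp: matv_def)
    ultimately show ?case by blast
  next
    case (Cons g u)
    obtain F where F: "matv t B F" "rep (mon u) F" using Cons by blast
    obtain G where G: "matv t B G" "rep (mon [g]) G" using rep_gen by blast
    have eq: "mon (g # u) = mon [g] * mon u" by (simp add: mon_mult)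
    show ?case unfolding eq using rep_mult[OF G(2,1) F(2,1)] matv_mult[OF G(1) F(1)] by blast
  qed
  then obtain F where F: "matv t B F" "rep (mon u) F" by blast
  have "rep (Poly_Mapping.single u c) (\<lambda>i j. Poly_Mapping.single 0 c * F i j)"
    using rep_scal[OF F(2), of c] by (simp add: scal_mon)
  then show ?case using matv_scal[OF F(1)] by blast
qed

definition \<Phi> :: "(('v,'e) gen list \<Rightarrow>\<^sub>0 'k) \<Rightarrow> nat \<Rightarrow> nat \<Rightarrow> int \<Rightarrow>\<^sub>0 'k" where
  "\<Phi> p = (SOME F. matv t B F \<and> rep p F)"

lemma \<Phi>: "matv t B (\<Phi> p)" "rep p (\<Phi> p)"
  using someI_ex[OF rep_exists[of p]] unfolding \<Phi>_def by blast+

lemma \<Phi>_eqI: "rep p F \<Longrightarrow> matv t B F \<Longrightarrow> \<Phi> p = F"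
  using rep_unique \<Phi> by blast

lemma \<Phi>_zero_iff: "\<Phi> p = (\<lambda>i j. 0) \<longleftrightarrow> (\<forall>j<t. p * a j \<in> Q)"
proof
  assume "\<Phi> p = (\<lambda>i j. 0)"
  then show "\<forall>j<t. p * a j \<in> Q" using \<Phi>(2)[of p] by (simp add: rep_def linz_0 cong_0)
next
  assume "\<forall>j<t. p * a j \<in> Q"
  then have "rep p (\<lambda>i j. 0)" by (simp add: rep_def linz_0 cong_0)
  then show "\<Phi> p = (\<lambda>i j. 0)" by (rule \<Phi>_eqI) (simp add: matv_def)
qed

lemma \<Phi>_surj:
  assumes "matv t B F"
  shows "\<exists>p. lookup p \<in> FA V0 E1 \<and> \<Phi> p = F"
proof -
  \<comment> \<open>By duality of the \<open>a i\<close> and \<open>b j\<close>, the summand at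
    \<open>(i, j)\<close> acts as the matrix with the single entry \<open>F i j\<close>.\<close>
  let ?p = "\<Sum>i<t. \<Sum>j<t. a i * linz z (F i j) * b j"
  have "lookup (linz z f) \<in> FA V0 E1" for f
    unfolding linz_def by (intro FA_sum FA_scal fz)
  then have "lookup ?p \<in> FA V0 E1" by (intro FA_sum FA_mult fa fb)
  moreover have "rep ?p F"
    unfolding rep_def
  proof (intro allI impI)
    fix l assume l: "l < t"
    have "?p * a l = (\<Sum>i<t. \<Sum>j<t. a i * linz z (F i j) * (b j * a l))"
      by (simp only: sum_distrib_right mult.assoc)
    also have "\<dots> \<approx> (\<Sum>i<t. \<Sum>j<t. a i * linz z (F i j) * (if j = l then vx w else 0))"
      using l by (intro cong_sum cong_mult_l delta) auto
    also have "\<dots> = (\<Sum>i<t. \<Sum>j<t. if j = l then a i * (linz z (F i j) * vx w) else 0)"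
      by (intro sum.cong) (auto simp: mult.assoc)
    also have "\<dots> = (\<Sum>i<t. a i * (linz z (F i l) * vx w))" using l by simp
    also have "\<dots> \<approx> (\<Sum>i<t. a i * linz z (F i l))"
    proof (intro cong_sum cong_mult_l)
      fix i
      show "linz z (F i l) * vx w \<approx> linz z (F i l)"
        using linz_mult_cong[OF matv_okf[OF assms], of "Poly_Mapping.single 0 1" i l]
        by (simp add: okf_def linz_single linz_1 z0 mon_Nil)
    qed
    finally show "?p * a l \<approx> (\<Sum>i<t. a i * linz z (F i l))" .
  qed
  ultimately show ?thesis using \<Phi>_eqI[OF _ assms] by blast
qed

text \<open>The entry at \<open>(i, j)\<close> is congruent to \<open>b i * p * a j\<close>, of
  degree \<open>D + d j - d i\<close>. As \<open>Q\<close> is graded, the components of the entry in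
  other degrees lie in \<open>Q\<close> and vanish by \<open>linz_inj\<close>.\<close>

lemma \<Phi>_graded:
  assumes p: "homog D p" and k: "lookup (\<Phi> p i j) k \<noteq> 0"
  shows "k * m + d i - d j = D"
proof (rule ccontr)
  assume ne: "k * m + d i - d j \<noteq> D"
  have ij: "i < t" "j < t"
  proof -
    have "\<Phi> p i j \<noteq> 0" using k by auto
    then show "i < t" "j < t" using \<Phi>(1)[of p] unfolding matv_def by (meson not_less)+
  qed
  have "linz z (\<Phi> p i j) - hc (- d i + (D + d j)) (linz z (\<Phi> p i j)) \<in> Q"
  proof -
    have c: "b i * (p * a j) - linz z (\<Phi> p i j) \<in> Q"
      using rep_coefficient[OF \<Phi>(2,1) ij] by (simp add: cong_def)
    have h: "hc (- d i + (D + d j)) (b i * (p * a j)) = b i * (p * a j)"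
      unfolding hc_homog[OF homog_mult[OF hb homog_mult[OF p ha]]] by simp
    have "hc (- d i + (D + d j)) (b i * (p * a j) - linz z (\<Phi> p i j)) =
      b i * (p * a j) - hc (- d i + (D + d j)) (linz z (\<Phi> p i j))" (is "hc ?e _ = _")
      using hc_add[of ?e "b i * (p * a j) - linz z (\<Phi> p i j)" "linz z (\<Phi> p i j)"] h by (simp add: eq_diff_eq)
    then have "b i * (p * a j) - hc ?e (linz z (\<Phi> p i j)) \<in> Q" using graded[OF c, of ?e] by simp
    from diff_mem[OF this c] show ?thesis by simp
  qed
  then have "hc (m * k) (linz z (\<Phi> p i j) - hc (- d i + (D + d j)) (linz z (\<Phi> p i j))) \<in> Q" (is "hc _ (_ - hc ?e _) \<in> _")
    by (rule graded)
  moreover have "hc (m * k) (linz z (\<Phi> p i j) - hc ?e (linz z (\<Phi> p i j))) = hc (m * k) (linz z (\<Phi> p i j))"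
    using ne by (intro poly_mapping_eqI) (auto simp: lookup_hc lookup_minus algebra_simps)
  ultimately have mem: "hc (m * k) (linz z (\<Phi> p i j)) \<in> Q" by simp
  let ?f = "\<Phi> p i j"
  have ok: "okf ?f" using \<Phi>(1) by (rule matv_okf)
  have "hc (m * k) (linz z ?f) = linz z (Poly_Mapping.single k (lookup ?f k))"
    using k by (simp add: hc_linz[OF ok] linz_single in_keys_iff)
  then have "linz z (Poly_Mapping.single k (lookup ?f k)) \<in> Q" using mem by simp
  moreover have "okf (Poly_Mapping.single k (lookup ?f k))"
    using okf_keys[OF ok, of k] k by (auto simp: okf_def in_keys_iff)
  ultimately have "Poly_Mapping.single k (lookup ?f k) = 0" using linz_inj by blast
  then show False using k by (metis lookup_single_eq lookup_zero)
qed

lemma quot_iso: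
  assumes Q: "Q = lift_ideal V0 E1 P" and P: "graded_prime V0 E1 s r P"
  shows "quot_iso V0 E1 P t B"
proof -
  have fP: "fideal V0 E1 P" using P by (simp add: graded_prime_def)
  have QP: "lookup x \<in> FA V0 E1 \<Longrightarrow> x \<in> Q \<longleftrightarrow> lookup x \<in> P" for x unfolding Q by (rule lift_mem)
  let ?\<phi> = "\<lambda>p i j. lookup (\<Phi> (Abs_poly_mapping p) i j)"
  have \<phi>: "?\<phi> (lookup x) = (\<lambda>i j. lookup (\<Phi> x i j))" for x by (simp add: lookup_inverse)
  have FA: "\<exists>x. p = lookup x \<and> lookup x \<in> FA V0 E1" if "p \<in> FA V0 E1" for p :: "('v,'e) gen list \<Rightarrow> 'k"
    using FA_lookup[OF that] that by metis
  have "ghom V0 E1 t m d ?\<phi>"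
    unfolding ghom_def
  proof (intro conjI ballI allI impI)
    fix p :: "('v,'e) gen list \<Rightarrow> 'k" assume "p \<in> FA V0 E1"
    then obtain x where x: "p = lookup x" using FA by blast
    { fix q :: "('v,'e) gen list \<Rightarrow> 'k" assume "q \<in> FA V0 E1"
      then obtain y where y: "q = lookup y" using FA by blast
      have "\<Phi> (x + y) = (\<lambda>i j. \<Phi> x i j + \<Phi> y i j)"
        by (rule \<Phi>_eqI[OF rep_add[OF \<Phi>(2) \<Phi>(2)] matv_add[OF \<Phi>(1) \<Phi>(1)]])
      then show "?\<phi> (fadd p q) = madd (?\<phi> p) (?\<phi> q)"
        unfolding x y fadd_lookup \<phi> madd_lookup by simp
      have "\<Phi> (x * y) = (\<lambda>i j. \<Sum>l<t. \<Phi> x i l * \<Phi> y l j)"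
        by (rule \<Phi>_eqI[OF rep_mult[OF \<Phi>(2) \<Phi>(1) \<Phi>(2) \<Phi>(1)] matv_mult[OF \<Phi>(1) \<Phi>(1)]])
      then show "?\<phi> (fmul p q) = mmul t (?\<phi> p) (?\<phi> q)"
        unfolding x y fmul_lookup \<phi> mmul_lookup by simp }
    { fix c
      have "\<Phi> (scal c * x) = (\<lambda>i j. Poly_Mapping.single 0 c * \<Phi> x i j)"
        by (rule \<Phi>_eqI[OF rep_scal[OF \<Phi>(2)] matv_scal[OF \<Phi>(1)]])
      then show "?\<phi> (fsc c p) = msc c (?\<phi> p)"
        unfolding x fsc_lookup \<phi> msc_lookup by simp }
    fix D assume "\<forall>w. p w \<noteq> 0 \<longrightarrow> gdeg w = D"
    then have "homog D x" by (simp add: x homog_def in_keys_iff)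
    then show "?\<phi> p \<in> MatComp m d D"
      unfolding x \<phi> MatComp_def using \<Phi>_graded by blast
  qed
  moreover have "?\<phi> ` FA V0 E1 = MatSet t B"
  proof (intro equalityI subsetI)
    fix M :: "nat \<Rightarrow> nat \<Rightarrow> int \<Rightarrow> 'k"
    { assume "M \<in> ?\<phi> ` FA V0 E1"
      then show "M \<in> MatSet t B" using MatSet_lookup[OF \<Phi>(1)] by blast }
    assume "M \<in> MatSet t B"
    then obtain F where F: "matv t B F" "M = (\<lambda>i j. lookup (F i j))" using MatSet_matv by blast
    then obtain x where x: "lookup x \<in> FA V0 E1" "\<Phi> x = F" using \<Phi>_surj by blast
    have "?\<phi> (lookup x) = M" unfolding \<phi> x(2) F(2) by (rule refl)
    then show "M \<in> ?\<phi> ` FA V0 E1" using x(1) by blast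
  qed
  moreover have "{p \<in> FA V0 E1. ?\<phi> p = (\<lambda>i j k. 0)} = P"
  proof -
    have zero_iff: "?\<phi> (lookup x) = (\<lambda>i j k. 0) \<longleftrightarrow> (\<forall>j<t. x * a j \<in> Q)" for x
    proof -
      have "?\<phi> (lookup x) = (\<lambda>i j k. 0) \<longleftrightarrow> \<Phi> x = (\<lambda>i j. 0)"
        unfolding \<phi> fun_eq_iff poly_mapping_eq_iff by simp
      then show ?thesis unfolding \<Phi>_zero_iff .
    qed
    \<comment> \<open>\<open>A\<close> annihilates \<open>Lw\<close> modulo \<open>Q\<close>, and
      \<open>B'\<close> is what \<open>A\<close> annihilates. Their product lies in \<open>P\<close>
      and \<open>B'\<close> contains \<open>w\<close>, so primeness puts \<open>A\<close> into
      \<open>P\<close>.\<close>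
    define A where "A = {x. lookup x \<in> FA V0 E1 \<and> (\<forall>u. x * u * vx w \<in> Q)}"
    define B' where "B' = {y. lookup y \<in> FA V0 E1 \<and> (\<forall>x\<in>A. \<forall>u. x * u * y \<in> Q)}"
    have fA: "fideal V0 E1 (lookup ` A)"
    proof (rule fideal_lookup)
      fix x z :: "('v,'e) gen list \<Rightarrow>\<^sub>0 'k" assume x: "x \<in> A" and z: "lookup z \<in> FA V0 E1"
      have "x * (z * u) * vx w \<in> Q" "z * (x * u * vx w) \<in> Q" for u
        using x mult_l unfolding A_def by blast+
      then have "x * z * u * vx w \<in> Q" "z * x * u * vx w \<in> Q" for u
        by (simp_all only: mult.assoc)
      then show "x * z \<in> A" "z * x \<in> A" using x z by (auto simp: A_def FA_mult)
    next
      fix x and c :: 'k assume x: "x \<in> A"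
      have "scal c * x * u * vx w \<in> Q" for u
        using x mult_l[of "x * u * vx w" "scal c"] unfolding A_def by (auto simp: mult.assoc)
      then show "scal c * x \<in> A" using x by (auto simp: A_def FA_scal)
    qed (auto simp: A_def FA_0 FA_add zero add distrib_right)
    have fB: "fideal V0 E1 (lookup ` B')"
    proof (rule fideal_lookup)
      fix y z :: "('v,'e) gen list \<Rightarrow>\<^sub>0 'k" assume y: "y \<in> B'" and z: "lookup z \<in> FA V0 E1"
      have "x * u * (y * z) \<in> Q" "x * u * (z * y) \<in> Q" if "x \<in> A" for x u
      proof -
        have "x * u * y * z \<in> Q" "x * (u * z) * y \<in> Q" using y that mult_r unfolding B'_def by blast+
        then show "x * u * (y * z) \<in> Q" "x * u * (z * y) \<in> Q" by (simp_all only: mult.assoc)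
      qed
      then show "y * z \<in> B'" "z * y \<in> B'" using y z by (auto simp: B'_def FA_mult)
    next
      fix y and c :: 'k assume y: "y \<in> B'"
      then show "scal c * y \<in> B'" by (auto simp: B'_def FA_scal scal_left_commute mult_l)
    qed (auto simp: B'_def FA_0 FA_add zero add distrib_left)
    have wFA: "lookup (vx w :: ('v,'e) gen list \<Rightarrow>\<^sub>0 'k) \<in> FA V0 E1"
      using w(1) by (rule vx_FA)
    have "fmul p q \<in> P" if pq: "p \<in> lookup ` A" "q \<in> lookup ` B'" for p q
    proof -
      obtain x y where xy: "p = lookup x" "x \<in> A" "q = lookup y" "y \<in> B'" using pq by blast
      have "x * 1 * y \<in> Q" using xy unfolding B'_def by blast
      then have "x * y \<in> Q" by simp
      moreover have "lookup (x * y) \<in> FA V0 E1" using xy by (auto simp: A_def B'_def intro: FA_mult)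
      ultimately show ?thesis using QP unfolding xy fmul_lookup by blast
    qed
    then have "lookup ` A \<subseteq> P \<or> lookup ` B' \<subseteq> P"
      using P fA fB unfolding graded_prime_def by blast
    moreover have "\<not> lookup ` B' \<subseteq> P"
    proof
      assume "lookup ` B' \<subseteq> P"
      moreover have "vx w \<in> B'" using wFA by (auto simp: B'_def A_def)
      ultimately show False using QP[OF wFA] w(2) by blast
    qed
    ultimately have AP: "lookup ` A \<subseteq> P" by blast
    show ?thesis
    proof (intro equalityI subsetI)
      fix p assume "p \<in> {p \<in> FA V0 E1. ?\<phi> p = (\<lambda>i j k. 0)}"
      then obtain x where x: "p = lookup x" "lookup x \<in> FA V0 E1" "\<forall>j<t. x * a j \<in> Q"
        using FA zero_iff by blast
      obtain i0 where i0: "i0 < t" "a i0 = vx w" using unit by blast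
      \<comment> \<open>\<open>w\<close> is one of the basis elements, so \<open>u w\<close> is a
        combination of the \<open>a i\<close> over the corner, and \<open>x\<close> kills all of
        these.\<close>
      have "x * u * vx w \<in> Q" for u
      proof -
        have "u * a i0 \<approx> (\<Sum>i<t. a i * linz z (\<Phi> u i i0))" using \<Phi>(2)[of u] i0(1) by (simp add: rep_def)
        then have "x * (u * vx w) \<approx> x * (\<Sum>i<t. a i * linz z (\<Phi> u i i0))"
          unfolding i0(2) by (rule cong_mult_l)
        moreover have "x * (\<Sum>i<t. a i * linz z (\<Phi> u i i0)) \<in> Q"
        proof -
          have "x * (\<Sum>i<t. a i * linz z (\<Phi> u i i0)) = (\<Sum>i<t. (x * a i) * linz z (\<Phi> u i i0))"
            by (simp only: sum_distrib_left mult.assoc)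
          also have "\<dots> \<in> Q" by (rule sum_mem[OF mult_r]) (use x(3) in simp)
          finally show ?thesis .
        qed
        ultimately show ?thesis using cong_mem by (simp only: mult.assoc)
      qed
      then have "x \<in> A" using x(2) by (simp add: A_def)
      then show "p \<in> P" using AP x(1) by blast
    next
      fix p assume p: "p \<in> P"
      then have "p \<in> FA V0 E1" using fP by (auto simp: fideal_def)
      then obtain x where x: "p = lookup x" "lookup x \<in> FA V0 E1" using FA by blast
      then have "x \<in> Q" using QP p by blast
      then have "\<forall>j<t. x * a j \<in> Q" using mult_r by blast
      then show "p \<in> {p \<in> FA V0 E1. ?\<phi> p = (\<lambda>i j k. 0)}" using x zero_iff by blast
    qed
  qed
  ultimately show ?thesis
    unfolding quot_iso_def using m by blast
qed

end

section \<open>The two kinds of corners\<close>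

lemma homog_power: "homog d x \<Longrightarrow> homog (d * int n) (x ^ n)"
proof (induction n)
  case 0
  show ?case by (simp add: homog_def gdeg_def zero_list_def)
next
  case (Suc n)
  then have "homog (d + d * int n) (x * x ^ n)" by (intro homog_mult)
  then show ?case by (simp add: algebra_simps)
qed

context two_sided
begin

text \<open>\<open>C\<close> and \<open>D\<close> are mutually inverse in the corner with unit
  \<open>W\<close>. The factor \<open>W\<close> in \<open>z\<close> turns the power with exponent 0,
  which is 1 in the ambient ring, into the unit of the corner.\<close>

lemma laurent_powers:
  assumes W: "W * W \<approx> W" and C: "W * C \<approx> C" "C * W \<approx> C" and D: "W * D \<approx> D" "D * W \<approx> D"
    and CD: "C * D \<approx> W" "D * C \<approx> W" and z: "\<And>k. z k = W * (if 0 \<le> k then C ^ nat k else D ^ nat (- k))"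
  shows "z k * z l \<approx> z (k + l)"
proof -
  have pow: "W * X ^ n * W \<approx> W * X ^ n" if X: "W * X \<approx> X" "X * W \<approx> X" for X and n :: nat
  proof (cases n)
    case 0 then show ?thesis using W by simp
  next
    case (Suc j)
    have "W * X ^ n * W = (W * X ^ j) * (X * W)" by (simp only: Suc power_Suc2 mult.assoc)
    also have "\<dots> \<approx> (W * X ^ j) * X" by (intro cong_mult_l X)
    also have "\<dots> = W * X ^ n" by (simp only: Suc power_Suc2 mult.assoc)
    finally show ?thesis .
  qed
  have zW: "z k * W \<approx> z k" for k unfolding z using pow[OF C] pow[OF D] by auto
  have down: "W * Y ^ Suc j * X \<approx> W * Y ^ j" if "Y * X \<approx> W" "W * Y \<approx> Y" "Y * W \<approx> Y" for X Y j
  proof -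
    have "W * Y ^ Suc j * X = W * Y ^ j * (Y * X)" by (simp only: power_Suc2 mult.assoc)
    also have "\<dots> \<approx> W * Y ^ j * W" by (intro cong_mult_l that)
    also have "\<dots> \<approx> W * Y ^ j" by (rule pow[OF that(2,3)])
    finally show ?thesis .
  qed
  have up: "W * X ^ j * X = W * X ^ Suc j" for X and j :: nat by (simp only: power_Suc2 mult.assoc)
  have zC: "z k * C \<approx> z (k + 1)" for k
  proof (cases "0 \<le> k")
    case True
    then have "nat (k + 1) = Suc (nat k)" by simp
    then have "z (k + 1) = W * C ^ Suc (nat k)" using True unfolding z by simp
    moreover have "z k * C = W * C ^ Suc (nat k)" unfolding up[symmetric] using True by (simp add: z)
    ultimately show ?thesis by simp
  next
    case False
    define j where "j = nat (- (k + 1))"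
    have j: "nat (- k) = Suc j" "nat (- (k + 1)) = j" using False unfolding j_def by arith+
    \<comment> \<open>For \<open>k = -1\<close> the value \<open>z 0\<close> comes from the other
      branch of the definition; both give \<open>W\<close>, since then \<open>j = 0\<close>.\<close>
    have "z (k + 1) = W * D ^ j" using False j(2) by (cases "k + 1 = 0") (auto simp: z)
    moreover have "z k = W * D ^ Suc j" using False j(1) by (simp add: z)
    ultimately show ?thesis using down[OF CD(2) D] by simp
  qed
  have zD: "z k * D \<approx> z (k - 1)" for k
  proof (cases "0 < k")
    case True
    define j where "j = nat (k - 1)"
    have j: "nat k = Suc j" "nat (k - 1) = j" using True unfolding j_def by arith+
    have "z (k - 1) = W * C ^ j" using True j(2) by (simp add: z)
    moreover have "z k = W * C ^ Suc j" using True j(1) by (simp add: z)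
    ultimately show ?thesis using down[OF CD(1) C] by simp
  next
    case False
    then have n: "nat (- (k - 1)) = Suc (nat (- k))" by simp
    have "z (k - 1) = W * D ^ Suc (nat (- k))" using False unfolding z n by simp
    moreover have "z k = W * D ^ nat (- k)" using False by (cases "k = 0") (auto simp: z)
    ultimately show ?thesis by (simp only: up cong_refl)
  qed
  have zCn: "z k * (W * C ^ n) \<approx> z (k + int n)" for n
  proof (induction n)
    case 0 then show ?case using zW by simp
  next
    case (Suc n)
    have "z k * (W * C ^ Suc n) = z k * (W * C ^ n) * C" by (simp only: power_Suc2 mult.assoc)
    also have "\<dots> \<approx> z (k + int n) * C" by (intro cong_mult_r Suc)
    also have "\<dots> \<approx> z (k + int n + 1)" by (rule zC)
    finally show ?case by (simp add: algebra_simps)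
  qed
  have zDn: "z k * (W * D ^ n) \<approx> z (k - int n)" for n
  proof (induction n)
    case 0 then show ?case using zW by simp
  next
    case (Suc n)
    have "z k * (W * D ^ Suc n) = z k * (W * D ^ n) * D" by (simp only: power_Suc2 mult.assoc)
    also have "\<dots> \<approx> z (k - int n) * D" by (intro cong_mult_r Suc)
    also have "\<dots> \<approx> z (k - int n - 1)" by (rule zD)
    finally show ?case by (simp add: algebra_simps)
  qed
  show ?thesis
    using zCn[of "nat l"] zDn[of "nat (- l)"] by (cases "0 \<le> l") (simp_all add: z[of l])
qed

end

context leavitt_ideal
begin

text \<open>Each edge of \<open>p\<close> is the only edge leaving its source, so \<open>ck2\<close>
  there has the single term \<open>ed e * gh e\<close>, and the product telescopes.\<close>

lemma pth_gst:
  assumes "ends_at w p" "\<And>e f. e \<in> E1 \<Longrightarrow> f \<in> set p \<Longrightarrow> s e = s f \<Longrightarrow> e = f"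
  shows "pth p * (vx w * gst p) \<approx> vx (src w p)"
  using assms
proof (induction p)
  case Nil then show ?case by (simp add: mon_Nil)
next
  case (Cons e p)
  have e: "e \<in> E1" "r e = src w p" "ends_at w p" using Cons.prems(1) by auto
  have S: "{f\<in>E1. s f = s e} = {e}" using Cons.prems(2)[of _ e] e(1) by auto
  have "pth (e # p) * (vx w * gst (e # p)) = ed e * (pth p * (vx w * gst p)) * gh e"
    by (simp only: pth_Cons gst_Cons mult.assoc)
  also have "\<dots> \<approx> ed e * vx (src w p) * gh e"
  proof (intro cong_mult_l cong_mult_r Cons.IH e)
    fix e' f assume "e' \<in> E1" "f \<in> set p" "s e' = s f"
    then show "e' = f" using Cons.prems(2)[of e' f] by simp
  qed
  also have "\<dots> \<approx> ed e * gh e" unfolding e(2)[symmetric] by (intro cong_mult_r er)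
  also have "\<dots> \<approx> vx (s e)"
    using ck2[OF src_V0[OF e(1)]] unfolding S by (intro cong_sym[of "vx (s e)"]) simp
  finally show ?case by simp
qed

text \<open>The part of the action on the basis elements \<open>p w\<close> that is the same for
  both kinds of corners.\<close>

lemma gen_act_common:
  assumes "p \<in> short_paths w"
  shows "(\<exists>v. g = Vx v) \<Longrightarrow> mon [g] * (pth p * vx w) \<approx> 0 \<or> mon [g] * (pth p * vx w) \<approx> pth p * vx w"
    and "\<not> ends_at w (e # p) \<Longrightarrow> ed e * (pth p * vx w) \<approx> 0"
    and "p = f # q \<Longrightarrow> gh e * (pth p * vx w) \<approx> 0 \<or> gh e * (pth p * vx w) \<approx> pth q * vx w"
proof -
  have vp: "vx v * (pth q * vx w) \<approx> 0 \<or> vx v * (pth q * vx w) \<approx> pth q * vx w" for v q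
  proof (cases "v = src w q")
    case True then show ?thesis using src_pth by blast
  next
    case False
    then have "vx v * (pth q * vx w) \<approx> 0" by (intro cong_chain[OF cong_sym[OF src_pth]] vw)
    then show ?thesis by blast
  qed
  { assume "\<exists>v. g = Vx v"
    then show "mon [g] * (pth p * vx w) \<approx> 0 \<or> mon [g] * (pth p * vx w) \<approx> pth p * vx w" using vp by blast }
  { assume "\<not> ends_at w (e # p)"
    then have "pth (e # p) * vx w \<approx> 0" by (rule pth_vx_zero)
    then show "ed e * (pth p * vx w) \<approx> 0" by (simp only: pth_Cons mult.assoc) }
  { assume p: "p = f # q"
    have eq: "gh e * (pth p * vx w) = (gh e * ed f) * (pth q * vx w)" by (simp only: p pth_Cons mult.assoc)
    show "gh e * (pth p * vx w) \<approx> 0 \<or> gh e * (pth p * vx w) \<approx> pth q * vx w"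
    proof (cases "e = f \<and> e \<in> E1")
      case True
      then have "gh e * ed f \<approx> vx (r e)" using ge'[of e] by auto
      then have "gh e * (pth p * vx w) \<approx> vx (r e) * (pth q * vx w)" unfolding eq by (rule cong_mult_r)
      then show ?thesis using vp[of "r e" q] cong_trans by blast
    next
      case False
      then have "gh e * ed f \<approx> 0" using gf cong_mult_0l[OF inv_g] by blast
      then show ?thesis unfolding eq by (intro disjI1) (rule cong_mult_0l)
    qed }
qed

lemma mon_valid_FA: "w \<in> V0 \<Longrightarrow> set p \<subseteq> E1 \<Longrightarrow> lookup (pth p * vx w) \<in> FA V0 E1"
  "w \<in> V0 \<Longrightarrow> set p \<subseteq> E1 \<Longrightarrow> lookup (vx w * gst p) \<in> FA V0 E1"
  by (auto simp: mon_mult validgen_def subset_iff intro!: mon_FA)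

lemma homog_pth: "homog (int (length p)) (pth p * vx w)"
  and homog_gst: "homog (- int (length p)) (vx w * gst p)"
proof -
  have "gdeg (map Ed p @ [Vx w]) = int (length p)" "gdeg (Vx w # map Gh (rev p)) = - int (length p)"
    by (induction p) (simp_all add: gdeg_def)
  then show "homog (int (length p)) (pth p * vx w)" "homog (- int (length p)) (vx w * gst p)"
    using homog_single[of "map Ed p @ [Vx w]" 1] homog_single[of "Vx w # map Gh (rev p)" 1]
    by (simp_all add: mon_mult)
qed

text \<open>The two kinds of corners \<open>w L w\<close>: \<open>K\<close> for a vertex all of whose edges lead into the ideal,
  and \<open>K[x, x\<inverse>]\<close> with \<open>x = c\<close> for a vertex on a cycle \<open>c\<close> without exits.\<close>

lemma corner_rep_intro:
  assumes graded: "\<And>x k. x \<in> Q \<Longrightarrow> hc k x \<in> Q" and w: "w \<in> V0" "vx w \<notin> Q"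
    and fin: "finite (short_paths w)"
    and m: "0 < m" and z0: "z 0 = vx w" and zz: "\<And>k l. B \<or> k = 0 \<and> l = 0 \<Longrightarrow> z k * z l \<approx> z (k + l)"
    and hz: "\<And>k. B \<or> k = 0 \<Longrightarrow> homog (m * k) (z k)" and fz: "\<And>k. lookup (z k) \<in> FA V0 E1"
    and ed: "\<And>p e. p \<in> short_paths w \<Longrightarrow> ends_at w (e # p) \<Longrightarrow> e # p \<notin> short_paths w \<Longrightarrow>
      \<exists>q\<in>short_paths w. \<exists>k. (B \<or> k = 0) \<and> ed e * (pth p * vx w) \<approx> pth q * vx w * z k"
    and gh: "\<And>e. gh e * vx w \<approx> 0 \<or> (\<exists>q\<in>short_paths w. \<exists>k. (B \<or> k = 0) \<and> gh e * vx w \<approx> pth q * vx w * z k)"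
  shows "\<exists>a b d. corner_rep Q V0 E1 s r w (card (short_paths w)) a b d m z B"
proof -
  let ?t = "card (short_paths w)"
  obtain h where h: "bij_betw h {0..<?t} (short_paths w)" using ex_bij_betw_nat_finite[OF fin] by blast
  have hT: "h i \<in> short_paths w" if "i < ?t" for i using h that by (auto simp: bij_betw_def)
  have hinv: "\<exists>i<?t. h i = p" if "p \<in> short_paths w" for p
    using h that unfolding bij_betw_def by force
  \<comment> \<open>\<open>corner_rep\<close> requires homogeneity and membership in
    \<open>FA\<close> for all indices; the trivial path serves beyond the range.\<close>
  define h' where "h' i = (if i < ?t then h i else [])" for i
  have h'T: "h' i \<in> short_paths w" for i using hT by (simp add: h'_def Nil_short)
  let ?a = "\<lambda>i. pth (h' i) * vx w" and ?b = "\<lambda>i. vx w * gst (h' i)" and ?d = "\<lambda>i. int (length (h' i))"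
  have E: "set (h' i) \<subseteq> E1" for i using ends_at_E1[OF short_paths_ends[OF h'T]] .
  have lift: "\<exists>i<?t. \<exists>k. (B \<or> k = 0) \<and> x \<approx> ?a i * z k"
    if ex: "\<exists>q\<in>short_paths w. \<exists>k. (B \<or> k = 0) \<and> x \<approx> pth q * vx w * z k" for x
  proof -
    obtain q k where q: "q \<in> short_paths w" "B \<or> k = 0" "x \<approx> pth q * vx w * z k" using ex by blast
    obtain i where "i < ?t" "h i = q" using hinv[OF q(1)] by blast
    then show ?thesis using q(2,3) by (intro exI[of _ i]) (auto simp: h'_def)
  qed
  have self: "\<exists>q\<in>short_paths w. \<exists>k. (B \<or> k = 0) \<and> x \<approx> pth q * vx w * z k"
    if "x \<approx> pth q * vx w" "q \<in> short_paths w" for x q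
  proof -
    have "pth q * vx w \<approx> pth q * vx w * z 0" unfolding z0 mult.assoc by (intro cong_mult_l cong_sym[OF vv])
    then have "x \<approx> pth q * vx w * z 0" using that(1) cong_trans by blast
    then show ?thesis using that(2) by blast
  qed
  have act: "mon [g] * ?a j \<approx> 0 \<or> (\<exists>i<?t. \<exists>k. (B \<or> k = 0) \<and> mon [g] * ?a j \<approx> ?a i * z k)" for g j
  proof -
    let ?p = "h' j"
    note T = h'T[of j]
    have "mon [g] * (pth ?p * vx w) \<approx> 0 \<or>
      (\<exists>q\<in>short_paths w. \<exists>k. (B \<or> k = 0) \<and> mon [g] * (pth ?p * vx w) \<approx> pth q * vx w * z k)"
    proof (cases g)
      case (Vx v)
      then show ?thesis using gen_act_common(1)[OF T, of g] self[OF _ T] by blast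
    next
      case (Ed e)
      show ?thesis
      proof (cases "ends_at w (e # ?p)")
        case False
        then show ?thesis unfolding Ed using gen_act_common(2)[OF T] by blast
      next
        case True
        show ?thesis
        proof (cases "e # ?p \<in> short_paths w")
          case in_T: True
          have "ed e * (pth ?p * vx w) = pth (e # ?p) * vx w" by (simp only: pth_Cons mult.assoc)
          then have "ed e * (pth ?p * vx w) \<approx> pth (e # ?p) * vx w" by (rule cong_refl')
          then show ?thesis unfolding Ed using self[OF _ in_T] by blast
        next
          case False
          then show ?thesis unfolding Ed using ed[OF T True] by blast
        qed
      qed
    next
      case (Gh e)
      show ?thesis
      proof (cases ?p)
        case Nil
        then show ?thesis unfolding Gh Nil using gh[of e] by (simp add: mon_Nil)
      next
        case (Cons f q)
        have "q \<in> short_paths w" using short_paths_suffix[of "[f]" q w] T Cons by simp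
        then show ?thesis unfolding Gh using gen_act_common(3)[OF T Cons, of e] self[of _ q] by blast
      qed
    qed
    then show ?thesis using lift by blast
  qed
  have "corner_rep Q V0 E1 s r w ?t ?a ?b ?d m z B"
  proof
    fix i j
    show "i < ?t \<Longrightarrow> j < ?t \<Longrightarrow> ?b i * ?a j \<approx> (if i = j then vx w else 0)"
    proof -
      assume ij: "i < ?t" "j < ?t"
      have "h' i = h' j \<longleftrightarrow> i = j"
        using ij bij_betw_imp_inj_on[OF h] by (auto simp: h'_def inj_on_def)
      then show ?thesis using short_paths_delta[OF h'T h'T, of i j] by simp
    qed
    show "?a i * vx w \<approx> ?a i" unfolding mult.assoc by (intro cong_mult_l vv)
    show "homog (?d i) (?a i)" by (rule homog_pth)
    show "homog (- ?d i) (?b i)" by (rule homog_gst)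
    show "lookup (?a i) \<in> FA V0 E1" by (rule mon_valid_FA(1)[OF w(1) E])
    show "lookup (?b i) \<in> FA V0 E1" by (rule mon_valid_FA(2)[OF w(1) E])
    show "\<exists>i<?t. ?a i = vx w"
    proof -
      obtain i where "i < ?t" "h i = []" using hinv[OF Nil_short] by blast
      then show ?thesis by (intro exI[of _ i]) (simp add: h'_def mon_Nil)
    qed
  qed (use graded w m z0 zz hz fz act in simp_all)
  then show ?thesis by blast
qed

text \<open>With no cycle at \<open>w\<close> a short path extended backwards stays short, and ghost
  edges vanish on \<open>w\<close> because their ranges lie in \<open>Q\<close>. Only the exponent 0
  occurs, so \<open>m = 1\<close> and the constant family \<open>z\<close> are arbitrary
  choices.\<close>

lemma corner_rep_singular:
  assumes graded: "\<And>x k. x \<in> Q \<Longrightarrow> hc k x \<in> Q" and w: "w \<in> V0" "vx w \<notin> Q"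
    and fin: "finite (short_paths w)"
    and acyc: "\<And>c. is_cycle E1 s r c \<Longrightarrow> w \<notin> s ` set c"
    and out: "\<And>e. e \<in> E1 \<Longrightarrow> s e = w \<Longrightarrow> vx (r e) \<in> Q"
  shows "\<exists>a b d. corner_rep Q V0 E1 s r w (card (short_paths w)) a b d 1 (\<lambda>k. vx w) False"
proof (rule corner_rep_intro[OF graded w fin])
  show "homog (1 * k) (vx w)" if "False \<or> k = 0" for k
    using that by (simp add: homog_def gdeg_def)
  show "lookup (vx w :: ('v,'e) gen list \<Rightarrow>\<^sub>0 'k) \<in> FA V0 E1" using w(1) by (rule vx_FA)
  show "\<exists>q\<in>short_paths w. \<exists>k. (False \<or> k = 0) \<and> ed e * (pth p * vx w) \<approx> pth q * vx w * vx w"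
    if "p \<in> short_paths w" "ends_at w (e # p)" "e # p \<notin> short_paths w" for p e
  proof -
    have "e # p \<in> short_paths w" using that(2) acyc unfolding short_paths_def by blast
    then show ?thesis using that(3) by blast
  qed
  show "gh e * vx w \<approx> 0 \<or> (\<exists>q\<in>short_paths w. \<exists>k. (False \<or> k = 0) \<and> gh e * vx w \<approx> pth q * vx w * vx w)" for e
  proof (rule disjI1, cases "e \<in> E1 \<and> s e = w")
    case True
    then have "vx (r e) \<approx> 0" using out by (simp add: cong_0)
    then have "vx (r e) * gh e \<approx> 0" by (rule cong_mult_0l)
    then have "gh e \<approx> 0" using rg cong_sym cong_trans by blast
    then show "gh e * vx w \<approx> 0" by (rule cong_mult_0l)
  next
    case False
    then show "gh e * vx w \<approx> 0" using gv[of w e] cong_mult_0l[OF inv_g[of e]] by blast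
  qed
qed (auto intro: vv)

text \<open>Valid for every cycle. The product \<open>C * D\<close> in the other order is congruent
  to \<open>w\<close> when there is no exit; for cycles with an exit its defect yields matrix
  units.\<close>

lemma cycle_corner:
  assumes "is_cycle E1 s r c" "s (hd c) = w"
  defines "C \<equiv> pth c * vx w" and "D \<equiv> vx w * gst c"
  shows "vx w * C \<approx> C" "C * vx w \<approx> C" "vx w * D \<approx> D" "D * vx w \<approx> D" "D * C \<approx> vx w"
proof -
  have ends: "ends_at w c" and "c \<noteq> []" using assms(1,2) by (simp_all add: is_cycle_iff)
  then have srcc: "src w c = w" using assms(2) by (simp add: src_def)
  show "vx w * C \<approx> C" "C * vx w \<approx> C"
    using src_pth[of w c] cong_mult_l[OF vv, of "pth c" w] by (simp_all add: C_def srcc mult.assoc)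
  show "vx w * D \<approx> D" "D * vx w \<approx> D"
    using gst_src[of w c] cong_mult_r[OF vv, of w "gst c"] by (simp_all add: D_def srcc mult.assoc)
  have "D * C = vx w * (gst c * (pth c * vx w))" by (simp only: C_def D_def mult.assoc)
  also have "\<dots> \<approx> vx w * vx w" by (intro cong_mult_l gst_pth_self ends)
  finally show "D * C \<approx> vx w" using vv cong_trans by blast
qed

text \<open>Without exits \<open>c\<close> is invertible in the corner, its inverse being its ghost,
  so \<open>z\<close> runs over all integers and \<open>m\<close> is the length of \<open>c\<close>.
  The exponents \<open>1\<close> and \<open>-1\<close> appear where a letter passes the beginning of
  the cycle.\<close>

lemma corner_rep_cycle:
  assumes graded: "\<And>x k. x \<in> Q \<Longrightarrow> hc k x \<in> Q" and w: "w \<in> V0" "vx w \<notin> Q"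
    and fin: "finite (short_paths w)"
    and c: "is_cycle E1 s r c" "s (hd c) = w" "\<not> has_exit E1 s c"
  shows "\<exists>a b d m z. corner_rep Q V0 E1 s r w (card (short_paths w)) a b d m z True"
proof -
  let ?C = "pth c * vx w" and ?D = "vx w * gst c"
  define z :: "int \<Rightarrow> ('v,'e) gen list \<Rightarrow>\<^sub>0 'k" where "z k = vx w * (if 0 \<le> k then ?C ^ nat k else ?D ^ nat (- k))" for k :: int
  obtain e0 c' where c0: "c = e0 # c'" using c(1) by (cases c) (auto simp: is_cycle_iff)
  have ends: "ends_at w c" using c(1,2) by (simp add: is_cycle_iff)
  have srcc: "src w c = w" using c(2) by (simp add: c0)
  have c'T: "c' \<in> short_paths w" using tl_cycle_short[OF c(1,2)] by (simp add: c0)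
  have W: "vx w * vx w \<approx> vx w" by (rule vv)
  note CD = cycle_corner[OF c(1,2)]
  note C = CD(1,2) and D = CD(3,4) and DC = CD(5)
  have pg: "pth c * (vx w * gst c) \<approx> vx w"
    using pth_gst[OF ends] c(3) unfolding no_exit_iff srcc by blast
  have CD': "?C * ?D \<approx> vx w"
  proof -
    have "?C * ?D = pth c * ((vx w * vx w) * gst c)" by (simp only: mult.assoc)
    also have "\<dots> \<approx> pth c * (vx w * gst c)" by (intro cong_mult_l cong_mult_r vv)
    finally show ?thesis using pg cong_trans by blast
  qed
  have zz: "z k * z l \<approx> z (k + l)" for k l
    by (rule laurent_powers[OF W C D CD' DC z_def])
  have cE: "set c \<subseteq> E1" using ends by (rule ends_at_E1)
  have hw: "homog 0 (vx w :: ('v,'e) gen list \<Rightarrow>\<^sub>0 'k)" by (simp add: homog_def gdeg_def)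
  have m: "0 < int (length c)" by (simp add: c0)
  have hz: "homog (int (length c) * k) (z k)" for k
  proof (cases "0 \<le> k")
    case True
    then show ?thesis using homog_mult[OF hw homog_power[OF homog_pth[of c w], of "nat k"]] by (simp add: z_def)
  next
    case False
    then show ?thesis using homog_mult[OF hw homog_power[OF homog_gst[of c w], of "nat (- k)"]] by (simp add: z_def)
  qed
  have wFA: "lookup (vx w :: ('v,'e) gen list \<Rightarrow>\<^sub>0 'k) \<in> FA V0 E1" using w(1) by (rule vx_FA)
  have pFA: "lookup (vx w * x ^ n) \<in> FA V0 E1" if "lookup x \<in> FA V0 E1" for x :: "('v,'e) gen list \<Rightarrow>\<^sub>0 'k" and n
  proof (induction n)
    case 0 then show ?case using wFA by simp
  next
    case (Suc n)
    then have "lookup (vx w * x ^ n * x) \<in> FA V0 E1" by (rule FA_mult[OF _ that])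
    then show ?case by (simp only: power_Suc2 mult.assoc)
  qed
  have fz: "lookup (z k) \<in> FA V0 E1" for k
    unfolding z_def using w(1) cE by (auto intro!: pFA mon_valid_FA)
  have z0: "z 0 = vx w" by (simp add: z_def)
  have "\<exists>a b d. corner_rep Q V0 E1 s r w (card (short_paths w)) a b d (int (length c)) z True"
  proof (rule corner_rep_intro[OF graded w fin m z0 zz hz fz])
    fix p e assume p: "p \<in> short_paths w" "ends_at w (e # p)" "e # p \<notin> short_paths w"
    have ep: "e # p = c" by (rule short_paths_Cons[OF c p])
    have "ed e * (pth p * vx w) = ?C" unfolding ep[symmetric] by (simp only: pth_Cons mult.assoc)
    also have "\<dots> \<approx> vx w * (vx w * ?C)"
      using cong_trans[OF cong_mult_l[OF C(1)] C(1)] by (rule cong_sym)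
    also have "\<dots> = pth [] * vx w * z 1" by (simp add: z_def mon_Nil mult.assoc)
    finally show "\<exists>q\<in>short_paths w. \<exists>k. (True \<or> k = 0) \<and> ed e * (pth p * vx w) \<approx> pth q * vx w * z k"
      using Nil_short by blast
  next
    fix e
    show "gh e * vx w \<approx> 0 \<or> (\<exists>q\<in>short_paths w. \<exists>k. (True \<or> k = 0) \<and> gh e * vx w \<approx> pth q * vx w * z k)"
    proof (cases "e \<in> E1 \<and> s e = w")
      case False
      then show ?thesis using gv[of w e] cong_mult_0l[OF inv_g[of e]] by blast
    next
      case True
      then have e: "e = e0" using c(2,3) unfolding no_exit_iff c0 by auto
      have r: "r e = src w c'" using ends by (simp add: c0 e)
      \<comment> \<open>Expanding \<open>w\<close> as \<open>c\<close> times its ghost and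
        cancelling the first edge gives \<open>tl c\<close> times the power with exponent
        \<open>-1\<close>.\<close>
      have "gh e * vx w \<approx> gh e * (pth c * (vx w * gst c))" by (intro cong_mult_l cong_sym[OF pg])
      also have "\<dots> = (gh e * ed e) * ((pth c' * vx w) * gst c)" by (simp only: c0 e pth_Cons mult.assoc)
      also have "\<dots> \<approx> vx (r e) * ((pth c' * vx w) * gst c)" using True by (intro cong_mult_r ge') simp
      also have "\<dots> = (vx (r e) * (pth c' * vx w)) * gst c" by (simp only: mult.assoc)
      also have "\<dots> \<approx> (pth c' * vx w) * gst c" unfolding r by (intro cong_mult_r src_pth)
      also have "\<dots> = pth c' * (vx w * gst c)" by (simp only: mult.assoc)
      also have "\<dots> \<approx> pth c' * (vx w * (vx w * ?D))"
        by (intro cong_mult_l cong_sym[OF cong_trans[OF cong_mult_l[OF D(1)] D(1)]])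
      also have "\<dots> = pth c' * vx w * z (-1)" by (simp add: z_def mult.assoc)
      finally show ?thesis using c'T by blast
    qed
  qed
  then show ?thesis by blast
qed

end

section \<open>From the path condition to matrix quotients\<close>

context digraph
begin

lemma graph: "graph V0 E1 s r"
  by (simp add: graph_def src_V0 rng_V0)

text \<open>If some vertex outside \<open>Q\<close> lies on a cycle, it is used. Otherwise the paths
  ending outside \<open>Q\<close> have length below \<open>n\<close>, and a longest one ends at a
  vertex all of whose edges lead into \<open>Q\<close>, for any other edge would prolong it.\<close>

theorem cond2_quot_iso:
  assumes c2: "cond2 V0 E1 s r n" and P: "graded_prime V0 E1 s r (P :: (('v,'e) gen list \<Rightarrow> 'k::field) set)"
  shows "\<exists>t b. 1 \<le> t \<and> t \<le> n \<and> quot_iso V0 E1 P t b"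
proof -
  define Q where "Q = lift_ideal V0 E1 P"
  have fP: "fideal V0 E1 P" and JP: "LJ V0 E1 s r \<subseteq> P" and gP: "\<forall>p\<in>P. \<forall>d. hcomp d p \<in> P" and neP: "P \<noteq> FA V0 E1"
    using P unfolding graded_prime_def by blast+
  interpret leavitt_ideal Q V0 E1 s r
    unfolding Q_def by (rule lift_leavitt_ideal[OF fP JP graph])
  have Qgr: "x \<in> Q \<Longrightarrow> hc d x \<in> Q" for x d unfolding Q_def by (rule lift_graded[OF gP])
  have QP: "lookup x \<in> FA V0 E1 \<Longrightarrow> x \<in> Q \<longleftrightarrow> lookup x \<in> P" for x unfolding Q_def by (rule lift_mem)
  have fin: "finite (short_paths w)" "card (short_paths w) \<le> n" if "w \<in> V0" for w
    using c2 that card_short_paths[of w n] unfolding cond2_def by blast+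
  have noex: "\<not> has_exit E1 s c" if "is_cycle E1 s r c" for c using c2 that unfolding cond2_def by blast
  have result: ?thesis if "corner_rep Q V0 E1 s r w (card (short_paths w)) a b d m z B" "w \<in> V0" for w a b d m z B
  proof -
    have "card (short_paths w) \<noteq> 0" using fin(1)[OF that(2)] Nil_short[of w] by auto
    then show ?thesis using corner_rep.quot_iso[OF that(1) Q_def P] fin(2)[OF that(2)]
      by (intro exI[of _ "card (short_paths w)"] exI[of _ B]) simp
  qed
  show ?thesis
  proof (cases "\<exists>w\<in>V0. vx w \<notin> Q \<and> (\<exists>c. is_cycle E1 s r c \<and> w \<in> s ` set c)")
    case True
    then obtain w c0 where w: "w \<in> V0" "vx w \<notin> Q" "is_cycle E1 s r c0" "w \<in> s ` set c0" by blast
    obtain c where c: "is_cycle E1 s r c" "s (hd c) = w" using cycle_rotate[OF w(3,4)] by blast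
    show ?thesis
      using corner_rep_cycle[OF Qgr w(1,2) fin(1)[OF w(1)] c noex[OF c(1)]] result w(1) by blast
  next
    case False
    then have acyc: "w \<notin> s ` set c" if "w \<in> V0" "vx w \<notin> Q" "is_cycle E1 s r c" for w c
      using that by blast
    define S where "S = {l. \<exists>p w. l = length p \<and> ends_at w p \<and> w \<in> V0 \<and> vx w \<notin> Q}"
    have "l < n" if "l \<in> S" for l
      using that acyclic_path_length[OF fin] acyc unfolding S_def by blast
    then have finS: "finite S" by (meson finite_nat_iff_bounded lessThan_iff subsetI)
    \<comment> \<open>Each letter has a vertex as a local unit, so if all vertices were in
      \<open>Q\<close>, then so would be every nonempty word, and \<open>P\<close> would not be
      proper.\<close>
    have "\<exists>v\<in>V0. vx v \<notin> Q"
    proof (rule ccontr)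
      assume "\<not> (\<exists>v\<in>V0. vx v \<notin> Q)"
      then have v0: "cong (vx v) 0" for v using inv_v[of v] by (auto simp: cong_0)
      have g0: "mon [g] \<in> Q" for g
      proof (cases g)
        case (Vx v) then show ?thesis using v0 by (simp add: cong_0)
      next
        case (Ed e)
        have "cong (vx (s e) * ed e) 0" by (rule cong_mult_0l[OF v0])
        then show ?thesis unfolding Ed using cong_mem[OF se[of e]] by (simp only: cong_0)
      next
        case (Gh e)
        have "cong (vx (r e) * gh e) 0" by (rule cong_mult_0l[OF v0])
        then show ?thesis unfolding Gh using cong_mem[OF rg[of e]] by (simp only: cong_0)
      qed
      have u0: "mon u \<in> Q" if une: "u \<noteq> []" for u
      proof -
        obtain g u' where u: "u = g # u'" using une by (cases u) auto
        have "mon [g] * mon u' \<in> Q" using g0 by (rule mult_r)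
        then show ?thesis by (simp add: u mon_mult)
      qed
      have "FA V0 E1 \<subseteq> P"
      proof
        fix p :: "('v,'e) gen list \<Rightarrow> 'k" assume p: "p \<in> FA V0 E1"
        let ?x = "Abs_poly_mapping p"
        have x: "lookup ?x = p" using p by (rule FA_lookup)
        have "(\<Sum>u\<in>keys ?x. scal (lookup ?x u) * mon u) \<in> Q"
        proof (intro sum_mem mult_l u0)
          fix u assume "u \<in> keys ?x" then show "u \<noteq> []" using p x FA_iff[of ?x V0 E1] by auto
        qed
        then have "?x \<in> Q" using poly_mapping_expand[of ?x] by (simp add: scal_mon)
        then show "p \<in> P" using QP[of ?x] p unfolding x by blast
      qed
      then show False using neP fP unfolding fideal_def by blast
    qed
    then have "S \<noteq> {}" unfolding S_def using ends_at.simps(1) by blast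
    then have "Max S \<in> S" using finS by (intro Max_in)
    then obtain p w where p: "Max S = length p" "ends_at w p" "w \<in> V0" "vx w \<notin> Q" unfolding S_def by blast
    have out: "vx (r e) \<in> Q" if e: "e \<in> E1" "s e = w" for e
    proof (rule ccontr)
      assume "vx (r e) \<notin> Q"
      moreover have "ends_at (r e) (p @ [e])" using p(2) e by (simp add: ends_at_append)
      ultimately have "length (p @ [e]) \<in> S" using rng_V0[OF e(1)] unfolding S_def by blast
      then show False using Max_ge[OF finS] p(1) by fastforce
    qed
    show ?thesis
      using corner_rep_singular[OF Qgr p(3,4) fin(1)[OF p(3)] acyc[OF p(3,4)] out] result p(3) by blast
  qed
qed

end

section \<open>Matrices over Laurent polynomials\<close>

text \<open>Gaussian elimination without division: cross-multiplication with a pivot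
  \<open>v i0 t\<close> clears coordinate \<open>t\<close> of the other vectors, and the coefficient
  of \<open>i0\<close> is chosen so that the relation holds for the original ones.\<close>

lemma dependent_vectors:
  fixes v :: "'i \<Rightarrow> nat \<Rightarrow> 'a::idom"
  assumes "finite I" "t < card I"
  shows "\<exists>c. (\<exists>i\<in>I. c i \<noteq> 0) \<and> (\<forall>j<t. (\<Sum>i\<in>I. c i * v i j) = 0)"
  using assms
proof (induction t arbitrary: I v)
  case 0
  then have "I \<noteq> {}" by auto
  then show ?case by (intro exI[of _ "\<lambda>_. 1"]) auto
next
  case (Suc t)
  show ?case
  proof (cases "\<forall>i\<in>I. v i t = 0")
    case True
    obtain c where c: "\<exists>i\<in>I. c i \<noteq> 0" "\<forall>j<t. (\<Sum>i\<in>I. c i * v i j) = 0" using Suc.IH[of I v] Suc.prems by auto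
    moreover have "(\<Sum>i\<in>I. c i * v i t) = 0" using True by simp
    ultimately show ?thesis by (intro exI[of _ c]) (auto simp: less_Suc_eq)
  next
    case False
    then obtain i0 where i0: "i0 \<in> I" "v i0 t \<noteq> 0" by blast
    let ?J = "I - {i0}"
    let ?v = "\<lambda>i j. v i0 t * v i j - v i t * v i0 j"
    have "t < card ?J" "finite ?J" using Suc.prems i0 by auto
    then obtain c where c: "\<exists>i\<in>?J. c i \<noteq> 0" "\<forall>j<t. (\<Sum>i\<in>?J. c i * ?v i j) = 0" using Suc.IH[of ?J ?v] by blast
    let ?c = "\<lambda>i. if i = i0 then - (\<Sum>i\<in>?J. c i * v i t) else c i * v i0 t"
    have eq: "(\<Sum>i\<in>I. ?c i * v i j) = (\<Sum>i\<in>?J. c i * ?v i j)" for j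
    proof -
      have "(\<Sum>i\<in>I. ?c i * v i j) = ?c i0 * v i0 j + (\<Sum>i\<in>?J. ?c i * v i j)"
        using Suc.prems(1) i0(1) by (rule sum.remove)
      also have "(\<Sum>i\<in>?J. ?c i * v i j) = (\<Sum>i\<in>?J. c i * v i0 t * v i j)" by (rule sum.cong) auto
      also have "?c i0 * v i0 j = - (\<Sum>i\<in>?J. c i * v i t * v i0 j)" by (simp add: sum_distrib_right)
      also have "- (\<Sum>i\<in>?J. c i * v i t * v i0 j) + (\<Sum>i\<in>?J. c i * v i0 t * v i j) = (\<Sum>i\<in>?J. c i * ?v i j)"
        by (simp add: right_diff_distrib sum_subtractf mult.assoc)
      finally show ?thesis .
    qed
    have "(\<Sum>i\<in>I. ?c i * v i j) = 0" if "j < Suc t" for j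
      unfolding eq using that c(2) by (cases "j = t") (auto simp: algebra_simps)
    moreover have "\<exists>i\<in>I. ?c i \<noteq> 0" using c(1) i0(2) by auto
    ultimately show ?thesis by (intro exI[of _ ?c]) auto
  qed
qed

definition mv :: "nat \<Rightarrow> (nat \<Rightarrow> nat \<Rightarrow> 'a::comm_ring_1) \<Rightarrow> (nat \<Rightarrow> 'a) \<Rightarrow> nat \<Rightarrow> 'a" where
  "mv t A v = (\<lambda>i. if i < t then \<Sum>l<t. A i l * v l else 0)"

lemma mv_0: "mv t A (\<lambda>i. 0) = (\<lambda>i. 0)" by (auto simp: mv_def)

lemma mv_funpow_0: "(mv t A ^^ k) (\<lambda>i. 0) = (\<lambda>i. 0)"
  by (induction k) (simp_all add: mv_0)

lemma mv_sum: "mv t A (\<lambda>j. \<Sum>i\<in>I. c i * v i j) = (\<lambda>j. \<Sum>i\<in>I. c i * mv t A (v i) j)"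
proof (rule ext)
  fix j
  have "(\<Sum>l<t. A j l * (\<Sum>i\<in>I. c i * v i l)) = (\<Sum>l<t. \<Sum>i\<in>I. c i * (A j l * v i l))"
    by (simp add: sum_distrib_left algebra_simps)
  also have "\<dots> = (\<Sum>i\<in>I. c i * (\<Sum>l<t. A j l * v i l))"
    unfolding sum_distrib_left by (rule sum.swap)
  finally show "mv t A (\<lambda>j. \<Sum>i\<in>I. c i * v i j) j = (\<Sum>i\<in>I. c i * mv t A (v i) j)"
    by (simp add: mv_def)
qed

lemma mv_funpow_sum: "(mv t A ^^ k) (\<lambda>j. \<Sum>i\<in>I. c i * v i j) = (\<lambda>j. \<Sum>i\<in>I. c i * (mv t A ^^ k) (v i) j)"
proof (induction k)
  case (Suc k)
  then show ?case by (simp add: mv_sum)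
qed simp

text \<open>If \<open>m\<close> is least with \<open>A^m v = 0\<close>, then
  \<open>v, A v, ..., A^(m-1) v\<close> are independent; they live in \<open>t\<close> coordinates,
  so \<open>m\<close> is at most \<open>t\<close>.\<close>

lemma mv_nilpotent:
  fixes A :: "nat \<Rightarrow> nat \<Rightarrow> 'a::idom"
  assumes v: "\<And>i. t \<le> i \<Longrightarrow> v i = 0" and nil: "(mv t A ^^ k) v = (\<lambda>i. 0)" and n: "t \<le> n"
  shows "(mv t A ^^ n) v = (\<lambda>i. 0)"
proof -
  let ?u = "\<lambda>k. (mv t A ^^ k) v"
  define m where "m = (LEAST m. ?u m = (\<lambda>i. 0))"
  have m: "?u m = (\<lambda>i. 0)" unfolding m_def using nil by (rule LeastI)
  have least: "?u l \<noteq> (\<lambda>i. 0)" if "l < m" for l using not_less_Least that unfolding m_def by blast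
  have ge: "?u l = (\<lambda>i. 0)" if "m \<le> l" for l
  proof -
    have "?u l = (mv t A ^^ (l - m)) (?u m)" using that by (simp add: funpow_add[symmetric, THEN fun_cong, unfolded o_def])
    then show ?thesis by (simp add: m mv_funpow_0)
  qed
  have supp: "?u l i = 0" if "t \<le> i" for l i using that v by (cases l) (auto simp: mv_def)
  have "m \<le> t"
  proof (rule ccontr)
    assume "\<not> m \<le> t"
    then have "t < card {..<m}" by simp
    then obtain c where c: "\<exists>i\<in>{..<m}. c i \<noteq> 0" "\<forall>j<t. (\<Sum>i\<in>{..<m}. c i * ?u i j) = 0"
      using dependent_vectors[of "{..<m}" t ?u] by blast
    have z: "(\<lambda>j. \<Sum>i<m. c i * ?u i j) = (\<lambda>j. 0)"
    proof
      fix j show "(\<Sum>i<m. c i * ?u i j) = 0" using c(2) supp[of j] by (cases "j < t") auto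
    qed
    \<comment> \<open>The first index with nonzero coefficient. Applying the power
      \<open>m - 1 - i0\<close> moves its vector to the last nonzero one and all later vectors to
      0.\<close>
    define i0 where "i0 = (LEAST i. i < m \<and> c i \<noteq> 0)"
    have i0: "i0 < m" "c i0 \<noteq> 0" using c(1) LeastI_ex[of "\<lambda>i. i < m \<and> c i \<noteq> 0"] unfolding i0_def by auto
    have small: "c i = 0" if "i < i0" for i
      using not_less_Least[of i "\<lambda>i. i < m \<and> c i \<noteq> 0"] that i0(1) unfolding i0_def[symmetric] by auto
    have "(\<lambda>j. \<Sum>i<m. c i * ?u (m - 1 - i0 + i) j) = (\<lambda>j. 0)"
    proof -
      have "(mv t A ^^ (m - 1 - i0)) (\<lambda>j. \<Sum>i<m. c i * ?u i j) = (\<lambda>j. 0)" unfolding z by (rule mv_funpow_0)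
      then show ?thesis unfolding mv_funpow_sum by (simp add: funpow_add)
    qed
    moreover have "(\<Sum>i<m. c i * ?u (m - 1 - i0 + i) j) = c i0 * ?u (m - 1) j" for j
    proof -
      have "c i * ?u (m - 1 - i0 + i) j = (if i = i0 then c i0 * ?u (m - 1) j else 0)" if "i < m" for i
      proof (cases "i < i0")
        case True then show ?thesis using small by simp
      next
        case False
        then show ?thesis using i0(1) ge[of "m - 1 - i0 + i"] by (cases "i = i0") auto
      qed
      then have "(\<Sum>i<m. c i * ?u (m - 1 - i0 + i) j) = (\<Sum>i<m. if i = i0 then c i0 * ?u (m - 1) j else 0)"
        by (intro sum.cong) auto
      then show ?thesis using i0(1) by simp
    qed
    ultimately have "c i0 * ?u (m - 1) j = 0" for j by (metis (no_types, lifting))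
    then have "?u (m - 1) = (\<lambda>j. 0)" using i0(2) by auto
    moreover have "m - 1 < m" using i0(1) by simp
    ultimately show False using least by blast
  qed
  then show ?thesis using ge n by simp
qed

text \<open>Entries of a product of matrices without an identity matrix at the end; the value at
  \<open>[]\<close> is a placeholder.\<close>

fun eprod :: "nat \<Rightarrow> (nat \<Rightarrow> nat \<Rightarrow> nat \<Rightarrow> 'a::comm_ring_1) \<Rightarrow> nat list \<Rightarrow> nat \<Rightarrow> nat \<Rightarrow> 'a" where
  "eprod t A [] i j = 0"
| "eprod t A (x # u) i j = (if u = [] then A x i j else (\<Sum>l<t. A x i l * eprod t A u l j))"

text \<open>The index path is \<open>i # q @ [j]\<close>, with one step per factor, so
  \<open>q\<close> has one entry less than there are factors.\<close>

lemma eprod_paths: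
  "u \<noteq> [] \<Longrightarrow> eprod t A u i j = (\<Sum>q\<in>{q. set q \<subseteq> {..<t} \<and> length q = length u - 1}.
      \<Prod>k<length u. A (u ! k) ((i # q @ [j]) ! k) ((i # q @ [j]) ! Suc k))"
proof (induction u arbitrary: i)
  case (Cons x u)
  show ?case
  proof (cases "u = []")
    case True
    have "{q. set q \<subseteq> {..<t} \<and> length q = 0} = {[]}" by auto
    then show ?thesis using True by simp
  next
    case False
    define n where "n = length u - 1"
    have n: "length u = Suc n" using False by (simp add: n_def)
    let ?S = "{q. set q \<subseteq> {..<t} \<and> length q = n}"
    have S: "{q. set q \<subseteq> {..<t} \<and> length q = Suc n} = (\<lambda>(l, q). l # q) ` ({..<t} \<times> ?S)"
      by (auto simp: length_Suc_conv image_iff)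
    have finS: "finite ?S" by (rule finite_lists_length_eq) simp
    have "(\<Sum>q\<in>{q. set q \<subseteq> {..<t} \<and> length q = Suc n}.
        \<Prod>k<Suc (Suc n). A ((x # u) ! k) ((i # q @ [j]) ! k) ((i # q @ [j]) ! Suc k)) =
      (\<Sum>(l, q)\<in>{..<t} \<times> ?S. \<Prod>k<Suc (Suc n). A ((x # u) ! k) ((i # (l # q) @ [j]) ! k) ((i # (l # q) @ [j]) ! Suc k))"
      unfolding S by (subst sum.reindex) (auto simp: inj_on_def intro!: sum.cong)
    also have "\<dots> = (\<Sum>l<t. \<Sum>q\<in>?S. \<Prod>k<Suc (Suc n). A ((x # u) ! k) ((i # (l # q) @ [j]) ! k) ((i # (l # q) @ [j]) ! Suc k))"
      by (rule sum.cartesian_product[symmetric])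
    also have "\<dots> = (\<Sum>l<t. \<Sum>q\<in>?S. A x i l * (\<Prod>k<Suc n. A (u ! k) ((l # q @ [j]) ! k) ((l # q @ [j]) ! Suc k)))"
      by (simp add: prod.lessThan_Suc_shift del: prod.lessThan_Suc)
    also have "\<dots> = (\<Sum>l<t. A x i l * eprod t A u l j)"
      using Cons.IH[OF False] by (simp add: sum_distrib_left n)
    finally show ?thesis using False by (simp add: n)
  qed
qed simp

text \<open>Expanding along index paths, the standard polynomial becomes a sum of determinants whose
  rows are indexed by the steps of a path; there are only \<open>t\<^sup>2\<close> possible steps, so two rows agree.\<close>

lemma standard_identity:
  fixes A :: "nat \<Rightarrow> nat \<Rightarrow> nat \<Rightarrow> 'a::comm_ring_1"
  assumes M: "t * t < M" and ij: "i < t" "j < t"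
  shows "(\<Sum>\<pi> | \<pi> permutes {0..<M}. signof \<pi> * eprod t A (map \<pi> [0..<M]) i j) = 0"
proof -
  let ?S = "{q. set q \<subseteq> {..<t} \<and> length q = M - 1}"
  let ?P = "\<lambda>q. i # q @ [j]"
  let ?D = "\<lambda>q. mat M M (\<lambda>(k, l). A l (?P q ! k) (?P q ! Suc k))"
  have M0: "0 < M" using M by simp
  have "(\<Sum>\<pi> | \<pi> permutes {0..<M}. signof \<pi> * eprod t A (map \<pi> [0..<M]) i j) =
     (\<Sum>\<pi> | \<pi> permutes {0..<M}. \<Sum>q\<in>?S. signof \<pi> * (\<Prod>k<M. A (\<pi> k) (?P q ! k) (?P q ! Suc k)))"
    using M0 by (intro sum.cong refl) (simp add: eprod_paths sum_distrib_left)
  also have "\<dots> = (\<Sum>q\<in>?S. \<Sum>\<pi> | \<pi> permutes {0..<M}. signof \<pi> * (\<Prod>k<M. A (\<pi> k) (?P q ! k) (?P q ! Suc k)))"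
    by (rule sum.swap)
  also have "\<dots> = (\<Sum>q\<in>?S. det (?D q))"
  proof (rule sum.cong[OF refl])
    fix q
    have "?D q \<in> carrier_mat M M" by simp
    then have "det (?D q) = (\<Sum>\<pi> | \<pi> permutes {0..<M}. signof \<pi> * (\<Prod>k=0..<M. ?D q $$ (k, \<pi> k)))"
      by (rule det_def')
    also have "\<dots> = (\<Sum>\<pi> | \<pi> permutes {0..<M}. signof \<pi> * (\<Prod>k<M. A (\<pi> k) (?P q ! k) (?P q ! Suc k)))"
      unfolding atLeast0LessThan
    proof (intro sum.cong refl arg_cong2[of _ _ _ _ "(*)"] prod.cong)
      fix \<pi> k assume "\<pi> \<in> {\<pi>. \<pi> permutes {..<M}}" "k \<in> {..<M}"
      then have "k < M" "\<pi> k < M" using permutes_in_image[of \<pi> "{..<M}" k] by auto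
      then show "?D q $$ (k, \<pi> k) = A (\<pi> k) (?P q ! k) (?P q ! Suc k)" by simp
    qed
    finally show "(\<Sum>\<pi> | \<pi> permutes {0..<M}. signof \<pi> * (\<Prod>k<M. A (\<pi> k) (?P q ! k) (?P q ! Suc k))) = det (?D q)" by simp
  qed
  also have "\<dots> = 0"
  proof (rule sum.neutral, rule ballI)
    fix q assume q: "q \<in> ?S"
    have P: "?P q ! k < t" if "k \<le> M" for k
    proof -
      have "k < length (?P q)" using q that M0 by simp
      then have "?P q ! k \<in> set (?P q)" by (rule nth_mem)
      then show ?thesis using q ij by auto
    qed
    let ?f = "\<lambda>k. (?P q ! k, ?P q ! Suc k)"
    have "?f ` {..<M} \<subseteq> {..<t} \<times> {..<t}"
    proof (intro image_subsetI SigmaI)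
      fix k assume "k \<in> {..<M}"
      then show "?P q ! k \<in> {..<t}" "?P q ! Suc k \<in> {..<t}" using P[of k] P[of "Suc k"] by simp_all
    qed
    then have "card (?f ` {..<M}) \<le> t * t"
      using card_mono[of "{..<t} \<times> {..<t}" "?f ` {..<M}"] by (simp add: card_cartesian_product)
    then have "\<not> inj_on ?f {..<M}" using M card_image[of ?f "{..<M}"] by auto
    then obtain k k' where k: "k < M" "k' < M" "k \<noteq> k'" "?f k = ?f k'" by (auto simp: inj_on_def)
    have "row (?D q) k = row (?D q) k'" using k by (intro eq_vecI) auto
    then show "det (?D q) = 0" using k det_identical_rows[of "?D q" M k k'] by simp
  qed
  finally show ?thesis .
qed

section \<open>Surjections onto matrix rings\<close>

locale matrix_hom =
  fixes V0 :: "'v set" and E1 :: "'e set" and t m d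
    and \<phi> :: "(('v,'e) gen list \<Rightarrow> 'k::field) \<Rightarrow> nat \<Rightarrow> nat \<Rightarrow> int \<Rightarrow> 'k" and b :: bool
  assumes hom: "ghom V0 E1 t m d \<phi>" and onto: "\<phi> ` FA V0 E1 = MatSet t b"
begin

text \<open>The image of \<open>x\<close> with entries in
  \<open>int \<Rightarrow>\<^sub>0 'k\<close>, an integral domain to which the statements about
  matrices apply.\<close>

definition F :: "(('v,'e) gen list \<Rightarrow>\<^sub>0 'k) \<Rightarrow> nat \<Rightarrow> nat \<Rightarrow> int \<Rightarrow>\<^sub>0 'k" where
  "F x = (SOME F. matv t b F \<and> \<phi> (lookup x) = (\<lambda>i j. lookup (F i j)))"

lemma F:
  assumes "lookup x \<in> FA V0 E1"
  shows "matv t b (F x)" "\<phi> (lookup x) = (\<lambda>i j. lookup (F x i j))"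
proof -
  have "\<phi> (lookup x) \<in> MatSet t b" using onto assms by blast
  then have ex: "\<exists>F. matv t b F \<and> \<phi> (lookup x) = (\<lambda>i j. lookup (F i j))" by (rule MatSet_matv)
  show "matv t b (F x)" "\<phi> (lookup x) = (\<lambda>i j. lookup (F x i j))"
    using someI_ex[OF ex] unfolding F_def by blast+
qed

lemma lookup_mat_inject: "(\<lambda>i j. lookup (G i j)) = (\<lambda>i j. lookup (H i j)) \<Longrightarrow> G = H"
  by (intro ext, rule lookup_inject, drule fun_cong, drule fun_cong)

lemma F_add: "lookup x \<in> FA V0 E1 \<Longrightarrow> lookup y \<in> FA V0 E1 \<Longrightarrow> F (x + y) = (\<lambda>i j. F x i j + F y i j)"
proof (rule lookup_mat_inject)
  assume xy: "lookup x \<in> FA V0 E1" "lookup y \<in> FA V0 E1"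
  have "\<phi> (lookup (x + y)) = madd (\<phi> (lookup x)) (\<phi> (lookup y))"
    using hom xy unfolding ghom_def fadd_lookup[symmetric] by blast
  then show "(\<lambda>i j. lookup (F (x + y) i j)) = (\<lambda>i j. lookup (F x i j + F y i j))"
    unfolding F(2)[OF xy(1)] F(2)[OF xy(2)] F(2)[OF FA_add[OF xy]] madd_lookup .
qed

lemma F_mult: "lookup x \<in> FA V0 E1 \<Longrightarrow> lookup y \<in> FA V0 E1 \<Longrightarrow> F (x * y) = (\<lambda>i j. \<Sum>l<t. F x i l * F y l j)"
proof (rule lookup_mat_inject)
  assume xy: "lookup x \<in> FA V0 E1" "lookup y \<in> FA V0 E1"
  have "\<phi> (lookup (x * y)) = mmul t (\<phi> (lookup x)) (\<phi> (lookup y))"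
    using hom xy unfolding ghom_def fmul_lookup[symmetric] by blast
  then show "(\<lambda>i j. lookup (F (x * y) i j)) = (\<lambda>i j. lookup (\<Sum>l<t. F x i l * F y l j))"
    unfolding F(2)[OF xy(1)] F(2)[OF xy(2)] F(2)[OF FA_mult[OF xy]] mmul_lookup .
qed

lemma F_scal: "lookup x \<in> FA V0 E1 \<Longrightarrow> F (scal c * x) = (\<lambda>i j. Poly_Mapping.single 0 c * F x i j)"
proof (rule lookup_mat_inject)
  assume x: "lookup x \<in> FA V0 E1"
  have "\<phi> (lookup (scal c * x)) = msc c (\<phi> (lookup x))"
    using hom x unfolding ghom_def fsc_lookup[symmetric] by blast
  then show "(\<lambda>i j. lookup (F (scal c * x) i j)) = (\<lambda>i j. lookup (Poly_Mapping.single 0 c * F x i j))"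
    unfolding F(2)[OF x] F(2)[OF FA_scal[OF x]] msc_lookup .
qed

lemma F_0: "F 0 i j = 0"
proof -
  have "F 0 = (\<lambda>i j. F 0 i j + F 0 i j)" using F_add[OF FA_0 FA_0] by simp
  from fun_cong[OF fun_cong[OF this]] have "F 0 i j = F 0 i j + F 0 i j" .
  then have "F 0 i j + F 0 i j = F 0 i j + 0" by (simp only: add_0_right)
  then show ?thesis by (simp only: add_left_cancel)
qed

lemma F_sum: "(\<And>i. i \<in> A \<Longrightarrow> lookup (f i) \<in> FA V0 E1) \<Longrightarrow> F (sum f A) = (\<lambda>i j. \<Sum>k\<in>A. F (f k) i j)"
proof (induction A rule: infinite_finite_induct)
  case (insert x A)
  then show ?case by (simp add: F_add FA_sum)
qed (auto simp: F_0 fun_eq_iff)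

lemma F_zero_iff: "lookup x \<in> FA V0 E1 \<Longrightarrow> \<phi> (lookup x) = (\<lambda>i j k. 0) \<longleftrightarrow> (\<forall>i<t. \<forall>j<t. F x i j = 0)"
proof
  assume x: "lookup x \<in> FA V0 E1"
  { assume "\<phi> (lookup x) = (\<lambda>i j k. 0)"
    then have "(\<lambda>i j. lookup (F x i j)) = (\<lambda>i j. lookup ((\<lambda>i j. 0) i j))" unfolding F(2)[OF x] by (simp add: lookup_0_fun)
    then have "F x = (\<lambda>i j. 0)" by (rule lookup_mat_inject)
    then show "\<forall>i<t. \<forall>j<t. F x i j = 0" by simp }
  assume *: "\<forall>i<t. \<forall>j<t. F x i j = 0"
  have "F x i j = 0" for i j
    using * F(1)[OF x] unfolding matv_def by (meson not_less)
  then show "\<phi> (lookup x) = (\<lambda>i j k. 0)" unfolding F(2)[OF x] by (simp add: lookup_0_fun)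
qed

text \<open>Powers are described column by column, through their action on unit vectors, because
  \<open>mv_nilpotent\<close> speaks of single vectors.\<close>

lemma F_power:
  assumes "lookup x \<in> FA V0 E1" "1 \<le> k" "i < t" "j < t"
  shows "F (x ^ k) i j = (mv t (F x) ^^ k) (\<lambda>l. if l = j then 1 else 0) i"
  using assms(2,3)
proof (induction k arbitrary: i rule: nat_induct_at_least)
  case base
  then show ?case using assms(4) by (simp add: mv_def if_distrib cong: if_cong)
next
  case (Suc k)
  have "F (x ^ Suc k) i j = (\<Sum>l<t. F x i l * F (x ^ k) l j)"
    using F_mult[OF assms(1) FA_power[OF assms(1) Suc.hyps]] by simp
  also have "\<dots> = (\<Sum>l<t. F x i l * (mv t (F x) ^^ k) (\<lambda>l. if l = j then 1 else 0) l)"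
    using Suc.IH by (intro sum.cong) auto
  also have "\<dots> = (mv t (F x) ^^ Suc k) (\<lambda>l. if l = j then 1 else 0) i"
    using Suc.prems by (simp add: mv_def)
  finally show ?case .
qed

lemma nilpotent_kernel:
  assumes x: "lookup x \<in> FA V0 E1" and k: "1 \<le> k" "\<phi> (lookup (x ^ k)) = (\<lambda>i j k. 0)" and n: "t \<le> n" "1 \<le> n"
  shows "\<phi> (lookup (x ^ n)) = (\<lambda>i j k. 0)"
  unfolding F_zero_iff[OF FA_power[OF x n(2)]]
proof (intro allI impI)
  fix i j assume ij: "i < t" "j < t"
  let ?e = "\<lambda>l. if l = j then 1 else (0 :: int \<Rightarrow>\<^sub>0 'k)"
  have "(mv t (F x) ^^ k) ?e = (\<lambda>i. 0)"
  proof
    fix l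
    show "(mv t (F x) ^^ k) ?e l = 0"
    proof (cases "l < t")
      case True
      have "F (x ^ k) l j = 0" using k(2) True ij(2) unfolding F_zero_iff[OF FA_power[OF x k(1)]] by blast
      then show ?thesis using F_power[OF x k(1) True ij(2)] by simp
    next
      case False
      then show ?thesis using k(1) by (cases k) (auto simp: mv_def)
    qed
  qed
  then have "(mv t (F x) ^^ n) ?e = (\<lambda>i. 0)" by (rule mv_nilpotent[rotated]) (use ij(2) n(1) in auto)
  then show "F (x ^ n) i j = 0" using F_power[OF x n(2) ij] by simp
qed

lemma F_prod:
  "u \<noteq> [] \<Longrightarrow> (\<And>i. lookup (y i) \<in> FA V0 E1) \<Longrightarrow>
    lookup (prod_list (map y u)) \<in> FA V0 E1 \<and> F (prod_list (map y u)) = (\<lambda>i j. eprod t (\<lambda>x. F (y x)) u i j)"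
proof (induction u)
  case (Cons x u)
  show ?case
  proof (cases "u = []")
    case True then show ?thesis using Cons.prems by simp
  next
    case False
    then have IH: "lookup (prod_list (map y u)) \<in> FA V0 E1" "F (prod_list (map y u)) = (\<lambda>i j. eprod t (\<lambda>x. F (y x)) u i j)"
      using Cons by auto
    show ?thesis using False IH FA_mult[OF Cons.prems(2) IH(1), of x] F_mult[OF Cons.prems(2) IH(1), of x] by simp
  qed
qed simp

lemma standard_kernel:
  assumes y: "\<And>i. lookup (y i) \<in> FA V0 E1" and M: "t * t < M"
  shows "lookup (\<Sum>\<pi> | \<pi> permutes {0..<M}. scal (signof \<pi>) * prod_list (map y (map \<pi> [0..<M]))) \<in> FA V0 E1"
    "\<phi> (lookup (\<Sum>\<pi> | \<pi> permutes {0..<M}. scal (signof \<pi>) * prod_list (map y (map \<pi> [0..<M])))) = (\<lambda>i j k. 0)"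
proof -
  have ne: "map \<pi> [0..<M] \<noteq> []" for \<pi> :: "nat \<Rightarrow> nat" using M by simp
  note P = F_prod[where y = y, OF ne y]
  show FA: "lookup (\<Sum>\<pi> | \<pi> permutes {0..<M}. scal (signof \<pi>) * prod_list (map y (map \<pi> [0..<M]))) \<in> FA V0 E1"
    using P by (intro FA_sum FA_scal) blast
  \<comment> \<open>The sign is a scalar of \<open>'k\<close> in the free algebra and a Laurent
    polynomial in \<open>standard_identity\<close>; in both it is 1 or -1.\<close>
  have single: "Poly_Mapping.single 0 (signof \<pi>) = (signof \<pi> :: int \<Rightarrow>\<^sub>0 'k)" for \<pi> :: "nat \<Rightarrow> nat"
    by (simp add: sign_def single_uminus)
  show "\<phi> (lookup (\<Sum>\<pi> | \<pi> permutes {0..<M}. scal (signof \<pi>) * prod_list (map y (map \<pi> [0..<M])))) = (\<lambda>i j k. 0)"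
    unfolding F_zero_iff[OF FA]
  proof (intro allI impI)
    fix i j assume ij: "i < t" "j < t"
    have "F (\<Sum>\<pi> | \<pi> permutes {0..<M}. scal (signof \<pi>) * prod_list (map y (map \<pi> [0..<M]))) i j =
      (\<Sum>\<pi> | \<pi> permutes {0..<M}. F (scal (signof \<pi>) * prod_list (map y (map \<pi> [0..<M]))) i j)"
      using P by (subst F_sum) (auto intro!: FA_scal)
    also have "\<dots> = (\<Sum>\<pi> | \<pi> permutes {0..<M}. signof \<pi> * eprod t (\<lambda>x. F (y x)) (map \<pi> [0..<M]) i j)"
      using P by (intro sum.cong refl) (simp only: F_scal single)
    also have "\<dots> = 0" by (rule standard_identity[OF M ij])
    finally show "F (\<Sum>\<pi> | \<pi> permutes {0..<M}. scal (signof \<pi>) * prod_list (map y (map \<pi> [0..<M]))) i j = 0" .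
  qed
qed

end

section \<open>Matrix units in the Leavitt path algebra\<close>

context leavitt_ideal
begin

text \<open>The indices are \<open>0, ..., n\<close>, so the size is \<open>n + 1\<close>, one more
  than the bound to be refuted. That the units do not vanish is recorded separately, by a reduction
  of \<open>\<epsilon> 0 0\<close> to a vertex.\<close>

definition matrix_units :: "nat \<Rightarrow> (nat \<Rightarrow> nat \<Rightarrow> ('v,'e) gen list \<Rightarrow>\<^sub>0 'k) \<Rightarrow> bool" where
  "matrix_units n \<epsilon> \<longleftrightarrow> (\<forall>i j. lookup (\<epsilon> i j) \<in> FA V0 E1) \<and>
    (\<forall>i\<le>n. \<forall>j\<le>n. \<forall>k\<le>n. \<forall>l\<le>n. \<epsilon> i j * \<epsilon> k l \<approx> (if j = k then \<epsilon> i l else 0))"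

lemma path_matrix_units:
  assumes w: "w \<in> V0" and many: "\<not> (finite (short_paths w) \<and> card (short_paths w) \<le> n)"
  shows "\<exists>\<epsilon> a b. matrix_units n \<epsilon> \<and> a * \<epsilon> 0 0 * b \<approx> vx w"
proof -
  have "\<exists>S. finite S \<and> card S = Suc n \<and> S \<subseteq> short_paths w"
  proof (cases "finite (short_paths w)")
    case True
    then have "Suc n \<le> card (short_paths w)" using many by simp
    from obtain_subset_with_card_n[OF this] obtain S
      where "S \<subseteq> short_paths w" "card S = Suc n" "finite S" by blast
    then show ?thesis by (intro exI[of _ S] conjI)
  next
    case False
    from infinite_arbitrarily_large[OF this, of "Suc n"] show ?thesis by blast
  qed
  then obtain S where S: "finite S" "card S = Suc n" "S \<subseteq> short_paths w" by blast
  obtain h where h: "bij_betw h {0..<Suc n} S" using ex_bij_betw_nat_finite[OF S(1)] S(2) by auto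
  \<comment> \<open>Units are required in \<open>FA\<close> for all indices; the trivial path fills
    those above \<open>n\<close>.\<close>
  define h' where "h' i = (if i \<le> n then h i else [])" for i
  have hT: "h' i \<in> short_paths w" for i
    using h S(3) Nil_short by (auto simp: h'_def bij_betw_def)
  have inj: "h' i = h' j \<longleftrightarrow> i = j" if "i \<le> n" "j \<le> n" for i j
    using bij_betw_imp_inj_on[OF h] that by (auto simp: h'_def inj_on_def)
  let ?a = "\<lambda>i. pth (h' i) * vx w" and ?b = "\<lambda>i. vx w * gst (h' i)"
  let ?\<epsilon> = "\<lambda>i j. ?a i * ?b j"
  have E: "set (h' i) \<subseteq> E1" for i using ends_at_E1[OF short_paths_ends[OF hT]] .
  have aw: "?a i * vx w \<approx> ?a i" for i unfolding mult.assoc by (rule cong_mult_l[OF vv])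
  have ba: "?b j * ?a k \<approx> (if j = k then vx w else 0)" if "j \<le> n" "k \<le> n" for j k
    using short_paths_delta[OF hT hT, of j k] inj[OF that] by simp
  have "matrix_units n ?\<epsilon>"
    unfolding matrix_units_def
  proof (intro conjI allI impI)
    show "lookup (?\<epsilon> i j) \<in> FA V0 E1" for i j
      by (rule FA_mult[OF mon_valid_FA(1)[OF w E] mon_valid_FA(2)[OF w E]])
    fix i j k l assume "i \<le> n" "j \<le> n" "k \<le> n" "l \<le> n"
    have "?\<epsilon> i j * ?\<epsilon> k l = ?a i * (?b j * ?a k) * ?b l" by (simp only: mult.assoc)
    also have "\<dots> \<approx> ?a i * (if j = k then vx w else 0) * ?b l"
      using ba[OF \<open>j \<le> n\<close> \<open>k \<le> n\<close>] by (intro cong_mult_r cong_mult_l)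
    also have "\<dots> \<approx> (if j = k then ?\<epsilon> i l else 0)"
    proof (cases "j = k")
      case True
      then show ?thesis using cong_mult_r[OF aw[of i], of "?b l"] by simp
    qed simp
    finally show "?\<epsilon> i j * ?\<epsilon> k l \<approx> (if j = k then ?\<epsilon> i l else 0)" .
  qed
  moreover have "?b 0 * ?\<epsilon> 0 0 * ?a 0 \<approx> vx w"
  proof -
    have "?b 0 * ?\<epsilon> 0 0 * ?a 0 = (?b 0 * ?a 0) * (?b 0 * ?a 0)" by (simp only: mult.assoc)
    also have "\<dots> \<approx> vx w * vx w" using ba[of 0 0] by (intro cong_mult) simp_all
    also have "\<dots> \<approx> vx w" by (rule vv)
    finally show ?thesis .
  qed
  ultimately show ?thesis by blast
qed

text \<open>If \<open>c\<close> is a cycle at \<open>w\<close> with an exit, then \<open>w - cc\<^sup>*\<close> is a nonzero idempotent killed by \<open>c\<close>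
  on the right and by \<open>c\<^sup>*\<close> on the left, so the elements \<open>c\<^sup>i (w - cc\<^sup>*) c\<^sup>*\<^sup>j\<close> are matrix units.\<close>

lemma exit_matrix_units:
  assumes c: "is_cycle E1 s r c" and ex: "has_exit E1 s c"
  shows "\<exists>\<epsilon> a b. \<exists>v\<in>V0. matrix_units n \<epsilon> \<and> a * \<epsilon> 0 0 * b \<approx> vx v"
proof -
  obtain f i where f: "f \<in> E1" "i < length c" "s f = s (c ! i)" "f \<noteq> c ! i" using ex unfolding has_exit_def by blast
  define w where "w = s f"
  have wV: "w \<in> V0" using f(1) src_V0 by (simp add: w_def)
  have "w \<in> s ` set c" using f(2,3) nth_mem[OF f(2)] unfolding w_def by simp
  from cycle_rotate[OF c this] obtain c1 where c1: "is_cycle E1 s r c1" "s (hd c1) = w" "set c1 = set c" by blast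
  obtain e0 c' where c0: "c1 = e0 # c'" using c1(1) by (cases c1) (auto simp: is_cycle_iff)
  \<comment> \<open>The sources on \<open>c\<close> are distinct, so the edge of \<open>c\<close>
    leaving \<open>w\<close> is \<open>c ! i\<close>, and the exit \<open>f\<close> differs from
    it.\<close>
  have fe: "f \<noteq> e0"
  proof
    assume "f = e0"
    then have "f \<in> set c" using c1(3) c0 by auto
    moreover have "inj_on s (set c)" using c by (simp add: is_cycle_iff distinct_map)
    ultimately show False using f(2,3,4) nth_mem[OF f(2)] by (auto dest: inj_onD)
  qed
  have ends: "ends_at w c1" using c1(1,2) by (simp add: is_cycle_iff)
  have cE: "set c1 \<subseteq> E1" using ends by (rule ends_at_E1)
  let ?w = "vx w :: ('v,'e) gen list \<Rightarrow>\<^sub>0 'k"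
  let ?C = "pth c1 * ?w" and ?D = "?w * gst c1"
  define x where "x = ?w - ?C * ?D"
  note CD = cycle_corner[OF c1(1,2)]
  note C = CD(1,2) and D = CD(3,4) and DC = CD(5)
  have wx: "?w * x \<approx> x"
  proof -
    have "?w * x = ?w * ?w - (?w * ?C) * ?D" by (simp only: x_def right_diff_distrib mult.assoc)
    also have "\<dots> \<approx> ?w - ?C * ?D" by (intro cong_diff vv cong_mult_r C)
    finally show ?thesis by (simp only: x_def)
  qed
  have xw: "x * ?w \<approx> x"
  proof -
    have "x * ?w = ?w * ?w - ?C * (?D * ?w)" by (simp only: x_def left_diff_distrib mult.assoc)
    also have "\<dots> \<approx> ?w - ?C * ?D" by (intro cong_diff vv cong_mult_l D)
    finally show ?thesis by (simp only: x_def)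
  qed
  have xC: "x * ?C \<approx> 0"
  proof -
    have "x * ?C = ?w * ?C - ?C * (?D * ?C)" by (simp only: x_def left_diff_distrib mult.assoc)
    also have "\<dots> \<approx> ?C - ?C * ?w" by (intro cong_diff C cong_mult_l DC)
    also have "\<dots> \<approx> ?C - ?C" by (intro cong_diff C cong_refl)
    finally show ?thesis by simp
  qed
  have Dx: "?D * x \<approx> 0"
  proof -
    have "?D * x = ?D * ?w - (?D * ?C) * ?D" by (simp only: x_def right_diff_distrib mult.assoc)
    also have "\<dots> \<approx> ?D - ?w * ?D" by (intro cong_diff D cong_mult_r DC)
    also have "\<dots> \<approx> ?D - ?D" by (intro cong_diff D cong_refl)
    finally show ?thesis by simp
  qed
  have xx: "x * x \<approx> x"
  proof -
    have "x * x = x * ?w - (x * ?C) * ?D" by (subst (2) x_def) (simp only: right_diff_distrib mult.assoc)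
    also have "\<dots> \<approx> x - 0" by (intro cong_diff xw cong_mult_0l xC)
    finally show ?thesis by simp
  qed
  have wCx: "?w * (?C ^ k * x) \<approx> ?C ^ k * x" for k
  proof (cases k)
    case 0 then show ?thesis using wx by simp
  next
    case (Suc k')
    have "?w * (?C ^ k * x) = (?w * ?C) * (?C ^ k' * x)" by (simp only: Suc power_Suc mult.assoc)
    also have "\<dots> \<approx> ?C * (?C ^ k' * x)" by (intro cong_mult_r C)
    also have "\<dots> = ?C ^ k * x" by (simp only: Suc power_Suc mult.assoc)
    finally show ?thesis .
  qed
  \<comment> \<open>Factors \<open>?D\<close> and \<open>?C\<close> cancel in pairs; whichever
    remains is killed by one of the outer factors \<open>x\<close>.\<close>
  have mid: "x * ?D ^ j * (?C ^ k * x) \<approx> (if j = k then x else 0)" for j k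
  proof (induction j arbitrary: k)
    case 0
    show ?case
    proof (cases k)
      case 0 then show ?thesis using xx by simp
    next
      case (Suc k')
      have "x * ?C * (?C ^ k' * x) \<approx> 0" by (rule cong_mult_0l[OF xC])
      then show ?thesis by (simp only: Suc power_Suc power_0 mult.assoc mult_1_left) simp
    qed
  next
    case (Suc j)
    show ?case
    proof (cases k)
      case 0
      have "x * ?D ^ j * (?D * x) \<approx> 0" by (rule cong_mult_0r[OF Dx])
      then have "x * ?D ^ Suc j * (?C ^ 0 * x) \<approx> 0" by (simp only: power_Suc2 power_0 mult.assoc mult_1_left)
      then show ?thesis using 0 by simp
    next
      case (Suc k')
      have "x * ?D ^ Suc j * (?C ^ Suc k' * x) = x * ?D ^ j * ((?D * ?C) * (?C ^ k' * x))"
        by (simp only: power_Suc2[of ?D] power_Suc[of ?C] mult.assoc)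
      also have "\<dots> \<approx> x * ?D ^ j * (?w * (?C ^ k' * x))" by (intro cong_mult_l cong_mult_r DC)
      also have "\<dots> \<approx> x * ?D ^ j * (?C ^ k' * x)" by (intro cong_mult_l wCx)
      also have "\<dots> \<approx> (if j = k' then x else 0)" by (rule Suc.IH)
      finally show ?thesis using Suc by simp
    qed
  qed
  let ?\<epsilon> = "\<lambda>i j. ?C ^ i * x * ?D ^ j"
  have CFA: "lookup ?C \<in> FA V0 E1" by (rule mon_valid_FA(1)[OF wV cE])
  have DFA: "lookup ?D \<in> FA V0 E1" by (rule mon_valid_FA(2)[OF wV cE])
  have wFA: "lookup ?w \<in> FA V0 E1" using wV by (rule vx_FA)
  have xFA: "lookup x \<in> FA V0 E1" unfolding x_def by (rule FA_minus[OF wFA FA_mult[OF CFA DFA]])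
  have CxFA: "lookup (?C ^ i * x) \<in> FA V0 E1" for i
  proof (induction i)
    case 0 then show ?case using xFA by simp
  next
    case (Suc i)
    from FA_mult[OF CFA Suc] show ?case by (simp only: power_Suc mult.assoc)
  qed
  have \<epsilon>FA: "lookup (?\<epsilon> i j) \<in> FA V0 E1" for i j
  proof (induction j)
    case 0 then show ?case using CxFA by simp
  next
    case (Suc j)
    from FA_mult[OF Suc DFA] show ?case by (simp only: power_Suc2 mult.assoc)
  qed
  have "matrix_units n ?\<epsilon>"
    unfolding matrix_units_def
  proof (intro conjI allI impI \<epsilon>FA)
    fix i j k l
    have "?\<epsilon> i j * ?\<epsilon> k l \<approx> ?C ^ i * ((if j = k then x else 0) * ?D ^ l)"
    proof (cases "j = k")
      case False
      have m0: "x * ?D ^ j * (?C ^ k * x) \<approx> 0" using mid[of j k] False by simp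
      have "?\<epsilon> i j * ?\<epsilon> k l = ?C ^ i * (x * ?D ^ j * (?C ^ k * x)) * ?D ^ l"
        by (simp only: mult.assoc)
      moreover have "?C ^ i * (x * ?D ^ j * (?C ^ k * x)) * ?D ^ l \<approx> 0"
        by (rule cong_mult_0l[OF cong_mult_0r[OF m0]])
      ultimately show ?thesis using False by simp
    next
      case True
      have "?\<epsilon> i j * ?\<epsilon> k l = ?C ^ i * ((x * ?D ^ j * (?C ^ k * x)) * ?D ^ l)"
        by (simp only: mult.assoc)
      also have "\<dots> \<approx> ?C ^ i * (x * ?D ^ l)"
        using mid[of j k] True by (intro cong_mult_l cong_mult_r) simp
      finally show ?thesis using True by simp
    qed
    then show "?\<epsilon> i j * ?\<epsilon> k l \<approx> (if j = k then ?\<epsilon> i l else 0)"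
      by (cases "j = k") (simp_all add: mult.assoc)
  qed
  \<comment> \<open>The ghost of the exit kills \<open>c\<close>, so only the summand
    \<open>w\<close> of \<open>x\<close> contributes. This shows that the units do not
    vanish.\<close>
  moreover have "gh f * ?\<epsilon> 0 0 * ed f \<approx> vx (r f)"
  proof -
    have "gh f * ?C = (gh f * ed e0) * (pth c' * ?w)" by (simp only: c0 pth_Cons mult.assoc)
    also have "\<dots> \<approx> 0" using fe by (intro cong_mult_0l gf)
    finally have gC: "gh f * ?C \<approx> 0" .
    have "gh f * ?\<epsilon> 0 0 * ed f = gh f * (?w * ed f) - (gh f * ?C) * (?D * ed f)"
      by (simp only: power_0 mult_1_left mult_1_right x_def right_diff_distrib left_diff_distrib mult.assoc)
    also have "\<dots> \<approx> gh f * ed f - 0"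
      unfolding w_def by (intro cong_diff cong_mult_l se cong_mult_0l gC[unfolded w_def])
    also have "\<dots> \<approx> vx (r f)" using ge'[OF f(1)] by simp
    finally show ?thesis .
  qed
  ultimately show ?thesis using rng_V0[OF f(1)] by blast
qed

lemma not_cond2_matrix_units:
  assumes "\<not> cond2 V0 E1 s r n"
  shows "\<exists>\<epsilon> a b. \<exists>v\<in>V0. matrix_units n \<epsilon> \<and> a * \<epsilon> 0 0 * b \<approx> vx v"
proof (cases "\<exists>c. is_cycle E1 s r c \<and> has_exit E1 s c")
  case True
  then show ?thesis using exit_matrix_units by blast
next
  case False
  then obtain v where "v \<in> V0" "\<not> (finite (paths_to E1 s r v) \<and> card (paths_to E1 s r v) + 1 \<le> n)"
    using assms unfolding cond2_def by blast
  then show ?thesis using path_matrix_units[of v n] card_short_paths[of v n] by blast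
qed

section \<open>Evaluation at sums of matrix units\<close>

text \<open>The value substituted for the variable \<open>x\<close>: the steps \<open>j\<close> to
  \<open>j + 1\<close> at all positions \<open>j\<close> where \<open>u\<close> has the letter
  \<open>x\<close>. A product of such values then leads from index \<open>i\<close> exactly along
  the words that occur in \<open>u\<close> at position \<open>i\<close>.\<close>

definition shift_sum :: "(nat \<Rightarrow> nat \<Rightarrow> ('v,'e) gen list \<Rightarrow>\<^sub>0 'k) \<Rightarrow> nat list \<Rightarrow> nat \<Rightarrow> ('v,'e) gen list \<Rightarrow>\<^sub>0 'k" where
  "shift_sum \<epsilon> u x = (\<Sum>j\<in>{j. j < length u \<and> u ! j = x}. \<epsilon> j (Suc j))"

lemma shift_sum_FA: "matrix_units n \<epsilon> \<Longrightarrow> lookup (shift_sum \<epsilon> u x) \<in> FA V0 E1"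
  unfolding shift_sum_def matrix_units_def by (intro FA_sum) blast

lemma unit_shift:
  assumes \<epsilon>: "matrix_units (length u) \<epsilon>" and k: "k \<le> length u" and i: "i \<le> length u"
  shows "\<epsilon> k i * shift_sum \<epsilon> u x \<approx> (if i < length u \<and> u ! i = x then \<epsilon> k (Suc i) else 0)"
proof -
  have "\<epsilon> k i * shift_sum \<epsilon> u x = (\<Sum>j\<in>{j. j < length u \<and> u ! j = x}. \<epsilon> k i * \<epsilon> j (Suc j))"
    unfolding shift_sum_def by (rule sum_distrib_left)
  also have "\<dots> \<approx> (\<Sum>j\<in>{j. j < length u \<and> u ! j = x}. if i = j then \<epsilon> k (Suc j) else 0)"
    using \<epsilon> k i unfolding matrix_units_def by (intro cong_sum) auto
  also have "\<dots> = (if i < length u \<and> u ! i = x then \<epsilon> k (Suc i) else 0)" by simp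
  finally show ?thesis .
qed

lemma unit_shift_prod:
  assumes \<epsilon>: "matrix_units (length u) \<epsilon>" and k: "k \<le> length u"
  shows "i \<le> length u \<Longrightarrow> \<epsilon> k i * prod_list (map (shift_sum \<epsilon> u) w) \<approx>
    (if i + length w \<le> length u \<and> w = take (length w) (drop i u) then \<epsilon> k (i + length w) else 0)"
proof (induction w arbitrary: i)
  case Nil then show ?case by simp
next
  case (Cons x w)
  have "\<epsilon> k i * prod_list (map (shift_sum \<epsilon> u) (x # w)) = (\<epsilon> k i * shift_sum \<epsilon> u x) * prod_list (map (shift_sum \<epsilon> u) w)"
    by (simp add: mult.assoc)
  also have "\<dots> \<approx> (if i < length u \<and> u ! i = x then \<epsilon> k (Suc i) else 0) * prod_list (map (shift_sum \<epsilon> u) w)"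
    by (intro cong_mult_r unit_shift \<epsilon> k Cons.prems)
  also have "\<dots> \<approx> (if i + length (x # w) \<le> length u \<and> x # w = take (length (x # w)) (drop i u)
      then \<epsilon> k (i + length (x # w)) else 0)"
  proof (cases "i < length u \<and> u ! i = x")
    case True
    then have "drop i u = x # drop (Suc i) u" using Cons_nth_drop_Suc[of i u] by simp
    then have conv: "(i + length (x # w) \<le> length u \<and> x # w = take (length (x # w)) (drop i u)) \<longleftrightarrow>
      (Suc i + length w \<le> length u \<and> w = take (length w) (drop (Suc i) u))" by simp
    have idx: "i + length (x # w) = Suc i + length w" by simp
    have i: "Suc i \<le> length u" using True by simp
    show ?thesis unfolding if_P[OF True] conv unfolding idx by (rule Cons.IH[OF i])
  next
    case False
    have nc: "\<not> (i + length (x # w) \<le> length u \<and> x # w = take (length (x # w)) (drop i u))"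
    proof
      assume *: "i + length (x # w) \<le> length u \<and> x # w = take (length (x # w)) (drop i u)"
      then have il: "i < length u" by simp
      then have "drop i u = u ! i # drop (Suc i) u" by (rule Cons_nth_drop_Suc[symmetric])
      then show False using * il False by simp
    qed
    show ?thesis unfolding if_not_P[OF False] if_not_P[OF nc] by simp
  qed
  finally show ?case .
qed

text \<open>From index 0 precisely the prefixes of \<open>u\<close> survive; the closing factor
  \<open>\<epsilon> (length u) 0\<close> rejects the proper ones.\<close>

lemma unit_shift_word:
  assumes \<epsilon>: "matrix_units (length u) \<epsilon>"
  shows "\<epsilon> 0 0 * prod_list (map (shift_sum \<epsilon> u) w) * \<epsilon> (length u) 0 \<approx> (if w = u then \<epsilon> 0 0 else 0)"
proof -
  have "\<epsilon> 0 0 * prod_list (map (shift_sum \<epsilon> u) w) * \<epsilon> (length u) 0 \<approx>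
    (if length w \<le> length u \<and> w = take (length w) u then \<epsilon> 0 (length w) else 0) * \<epsilon> (length u) 0"
    by (rule cong_mult_r[OF unit_shift_prod[OF \<epsilon> le0 le0, of w, unfolded add_0 drop_0]])
  also have "\<dots> \<approx> (if w = u then \<epsilon> 0 0 else 0)"
  proof (cases "length w \<le> length u \<and> w = take (length w) u")
    case True
    then have "\<epsilon> 0 (length w) * \<epsilon> (length u) 0 \<approx> (if length w = length u then \<epsilon> 0 0 else 0)"
      using \<epsilon> unfolding matrix_units_def by simp
    moreover have "length w = length u \<longleftrightarrow> w = u" using True by auto
    ultimately show ?thesis using True by simp
  next
    case False
    then have ne: "w \<noteq> u" by auto
    show ?thesis unfolding if_not_P[OF False] if_not_P[OF ne] by simp
  qed
  finally show ?thesis .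
qed

text \<open>For a constant word the substituted element is the nilpotent Jordan block of size
  \<open>n + 1\<close>, whose power with exponent \<open>n\<close> has the corner entry
  \<open>\<epsilon> 0 n\<close>.\<close>

lemma shift_nilpotent:
  assumes \<epsilon>: "matrix_units n \<epsilon>"
  shows "shift_sum \<epsilon> (replicate n 0) 0 ^ Suc n \<approx> 0"
    "\<epsilon> 0 0 * shift_sum \<epsilon> (replicate n 0) 0 ^ n * \<epsilon> n 0 \<approx> \<epsilon> 0 0"
proof -
  let ?u = "replicate n (0::nat)"
  let ?x = "shift_sum \<epsilon> ?u 0"
  have \<epsilon>': "matrix_units (length ?u) \<epsilon>" using \<epsilon> by simp
  have pow: "prod_list (map (shift_sum \<epsilon> ?u) (replicate m 0)) = ?x ^ m" for m
    by (induction m) simp_all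
  show "\<epsilon> 0 0 * ?x ^ n * \<epsilon> n 0 \<approx> \<epsilon> 0 0"
    using unit_shift_word[OF \<epsilon>', of ?u] unfolding pow by simp
  have "?x ^ Suc n = (\<Sum>j\<in>{j. j < length ?u \<and> ?u ! j = 0}. \<epsilon> j (Suc j) * ?x ^ n)"
    unfolding power_Suc by (subst (1) shift_sum_def) (simp only: sum_distrib_right)
  also have "\<dots> \<approx> 0"
  proof (rule cong_sum_0)
    fix j assume "j \<in> {j. j < length ?u \<and> ?u ! j = 0}"
    then have j: "j < n" by simp
    then show "\<epsilon> j (Suc j) * ?x ^ n \<approx> 0"
      using unit_shift_prod[OF \<epsilon>', of j "Suc j" ?u] unfolding pow by simp
  qed
  finally show "?x ^ Suc n \<approx> 0" .
qed

end

section \<open>The equivalences and the polynomial identity\<close>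

lemma lift_ideal_mono: "P \<subseteq> P' \<Longrightarrow> lift_ideal V0 E1 P \<subseteq> lift_ideal V0 E1 P'"
  by (auto simp: lift_ideal_def)

context digraph
begin

abbreviation JQ :: "(('v,'e) gen list \<Rightarrow>\<^sub>0 'k::field) set" where "JQ \<equiv> lift_ideal V0 E1 (LJ V0 E1 s r)"

lemma JQ_ideal: "leavitt_ideal JQ V0 E1 s r"
  by (rule lift_leavitt_ideal[OF fideal_LJ subset_refl graph])

lemma vx_notin_JQ: "v \<in> V0 \<Longrightarrow> vx v \<notin> JQ"
  by (simp add: lift_mem[OF vx_FA] vx_not_LJ)

lemma nil_index_cond2:
  assumes nil: "nil_index_le V0 E1 s r TYPE('k::field) n" and n: "0 < n"
  shows "cond2 V0 E1 s r n"
proof (rule ccontr)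
  assume "\<not> cond2 V0 E1 s r n"
  interpret leavitt_ideal "JQ :: (('v,'e) gen list \<Rightarrow>\<^sub>0 'k) set" V0 E1 s r by (rule JQ_ideal)
  obtain \<epsilon> a b v where v: "v \<in> V0" and \<epsilon>: "matrix_units n \<epsilon>" and ab: "cong (a * \<epsilon> 0 0 * b) (vx v)"
    using not_cond2_matrix_units[OF \<open>\<not> cond2 V0 E1 s r n\<close>] by blast
  let ?x = "shift_sum \<epsilon> (replicate n 0) 0"
  have xFA: "lookup ?x \<in> FA V0 E1" by (rule shift_sum_FA[OF \<epsilon>])
  note pFA = FA_power[OF xFA]
  have "?x ^ Suc n \<in> JQ" using shift_nilpotent(1)[OF \<epsilon>] by (simp add: cong_0)
  then have "fpow (lookup ?x) (Suc n) \<in> LJ V0 E1 s r"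
    unfolding fpow_lookup using lift_mem[OF pFA[of "Suc n"]] by simp
  then have "fpow (lookup ?x) n \<in> LJ V0 E1 s r"
    using nil xFA unfolding nil_index_le_def by (metis le_add1 plus_1_eq_Suc)
  then have "?x ^ n \<in> JQ" unfolding fpow_lookup using lift_mem[OF pFA[of n]] n by simp
  then have "\<epsilon> 0 0 * ?x ^ n * \<epsilon> n 0 \<in> JQ" by (rule mult)
  then have "\<epsilon> 0 0 \<in> JQ" using cong_mem[OF shift_nilpotent(2)[OF \<epsilon>]] by blast
  then have "a * \<epsilon> 0 0 * b \<in> JQ" by (rule mult)
  then show False using cong_mem[OF ab] vx_notin_JQ[OF v] by blast
qed

lemma quot_iso_matrix_hom:
  assumes "quot_iso V0 E1 P t b"
  obtains \<phi> m d where "0 < m" "ghom V0 E1 t m d \<phi>" "matrix_hom V0 E1 t m d \<phi> b"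
    "{p \<in> FA V0 E1. \<phi> p = (\<lambda>i j k. 0)} = P"
  using assms unfolding quot_iso_def matrix_hom_def by blast

text \<open>The prime is chosen to avoid the very vertex to which \<open>\<epsilon> 0 0\<close>
  reduces, so that the Jordan block keeps its index \<open>n + 1\<close> in a quotient of matrices
  of size at most \<open>n\<close>.\<close>

lemma cond3_cond2:
  assumes c3: "cond3 V0 E1 s r TYPE('k::field) n" and n: "0 < n"
  shows "cond2 V0 E1 s r n"
proof (rule ccontr)
  assume "\<not> cond2 V0 E1 s r n"
  interpret J: leavitt_ideal "JQ :: (('v,'e) gen list \<Rightarrow>\<^sub>0 'k) set" V0 E1 s r by (rule JQ_ideal)
  obtain \<epsilon> a b v where v: "v \<in> V0" and \<epsilon>: "J.matrix_units n \<epsilon>" and ab: "J.cong (a * \<epsilon> 0 0 * b) (vx v)"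
    using J.not_cond2_matrix_units[OF \<open>\<not> cond2 V0 E1 s r n\<close>] by blast
  obtain P :: "(('v,'e) gen list \<Rightarrow> 'k) set" where P: "graded_prime V0 E1 s r P" "lookup (vx v) \<notin> P"
    using graded_prime_avoiding[OF v] by blast
  have JP: "LJ V0 E1 s r \<subseteq> P" and fP: "fideal V0 E1 P" using P(1) unfolding graded_prime_def by blast+
  interpret two_sided "lift_ideal V0 E1 P" by (rule lift_two_sided[OF fP])
  have tr: "cong x y" if "J.cong x y" for x y
    using that lift_ideal_mono[OF JP] unfolding cong_def J.cong_def by blast
  have QP: "lookup x \<in> FA V0 E1 \<Longrightarrow> x \<in> lift_ideal V0 E1 P \<longleftrightarrow> lookup x \<in> P" for x by (rule lift_mem)
  let ?x = "J.shift_sum \<epsilon> (replicate n 0) 0"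
  have xFA: "lookup ?x \<in> FA V0 E1" by (rule J.shift_sum_FA[OF \<epsilon>])
  note pFA = FA_power[OF xFA]
  obtain t bb where t: "t \<le> n" "quot_iso V0 E1 P t bb" using c3 P(1) unfolding cond3_def by blast
  from t(2) obtain \<phi> m d where hom: "matrix_hom V0 E1 t m d \<phi> bb"
    and ker: "{p \<in> FA V0 E1. \<phi> p = (\<lambda>i j k. 0)} = P" by (rule quot_iso_matrix_hom)
  interpret H: matrix_hom V0 E1 t m d \<phi> bb by (rule hom)
  have "?x ^ Suc n \<in> lift_ideal V0 E1 P" using tr[OF J.shift_nilpotent(1)[OF \<epsilon>]] by (simp add: cong_0)
  then have "lookup (?x ^ Suc n) \<in> P" using QP[OF pFA[of "Suc n"]] by simp
  then have "\<phi> (lookup (?x ^ Suc n)) = (\<lambda>i j k. 0)" using ker by blast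
  then have "\<phi> (lookup (?x ^ n)) = (\<lambda>i j k. 0)"
    by (rule H.nilpotent_kernel[OF xFA, of "Suc n", rotated]) (use n t(1) in auto)
  then have "lookup (?x ^ n) \<in> P" using ker pFA[of n] n by auto
  then have "?x ^ n \<in> lift_ideal V0 E1 P" using QP[OF pFA[of n]] n by simp
  then have "\<epsilon> 0 0 * ?x ^ n * \<epsilon> n 0 \<in> lift_ideal V0 E1 P" by (rule mult)
  then have "\<epsilon> 0 0 \<in> lift_ideal V0 E1 P" using cong_mem[OF tr[OF J.shift_nilpotent(2)[OF \<epsilon>]]] by blast
  then have "a * \<epsilon> 0 0 * b \<in> lift_ideal V0 E1 P" by (rule mult)
  then show False using cong_mem[OF tr[OF ab]] QP[OF vx_FA[OF v]] P(2) by blast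
qed

lemma cond2_cond3: "cond2 V0 E1 s r n \<Longrightarrow> cond3 V0 E1 s r TYPE('k::field) n"
  unfolding cond3_def using cond2_quot_iso by blast

lemma cond2_cond4:
  assumes c2: "cond2 V0 E1 s r n"
  shows "cond4 V0 E1 s r TYPE('k::field) n"
proof -
  \<comment> \<open>All admissible homomorphisms at once. Only the inclusion of their common kernel
    in \<open>J\<close> then has content.\<close>
  let ?S = "{(t, b, m, d, \<phi>). 1 \<le> t \<and> t \<le> n \<and> 0 < m \<and> ghom V0 E1 t m d \<phi> \<and>
    \<phi> ` FA V0 E1 = MatSet t b \<and> (\<forall>p\<in>LJ V0 E1 s r. \<phi> p = (\<lambda>i j k. 0))}
    :: (nat \<times> bool \<times> int \<times> (nat \<Rightarrow> int) \<times> ((('v,'e) gen list \<Rightarrow> 'k) \<Rightarrow> nat \<Rightarrow> nat \<Rightarrow> int \<Rightarrow> 'k)) set"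
  interpret J: leavitt_ideal "JQ :: (('v,'e) gen list \<Rightarrow>\<^sub>0 'k) set" V0 E1 s r by (rule JQ_ideal)
  have "p \<in> LJ V0 E1 s r" if p: "p \<in> FA V0 E1" and k: "\<forall>(t, b, m, d, \<phi>) \<in> ?S. \<phi> p = (\<lambda>i j k. 0)" for p
  proof (rule ccontr)
    assume np: "p \<notin> LJ V0 E1 s r"
    define x where "x = Abs_poly_mapping p"
    have x: "lookup x = p" unfolding x_def using p by (rule FA_lookup)
    have xQ: "x \<notin> JQ" using lift_mem[of x V0 E1] p np unfolding x by blast
    \<comment> \<open>The reduction to a vertex is for homogeneous elements, so a component outside
      \<open>J\<close> is taken. Being graded, the prime \<open>P\<close> contains this component
      once it contains \<open>x\<close>.\<close>
    have "\<exists>e. hc e x \<notin> JQ"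
    proof (rule ccontr)
      assume "\<not> (\<exists>e. hc e x \<notin> JQ)"
      then have "(\<Sum>e\<in>gdeg ` keys x. hc e x) \<in> JQ" by (intro J.sum_mem) blast
      then show False using xQ hc_decomp[of x] by simp
    qed
    then obtain e where e: "hc e x \<notin> JQ" ..
    have "lookup (hc e x) \<in> FA V0 E1" by (rule FA_hc) (simp only: x p)
    then have "J.reducible (hc e x)" by (rule J.homogeneous_reducible[OF homog_hc _ e])
    then obtain a b k0 v where red: "k0 \<noteq> 0" "v \<in> V0" "J.cong (a * hc e x * b) (scal k0 * vx v)"
      unfolding J.reducible_def by blast
    obtain P :: "(('v,'e) gen list \<Rightarrow> 'k) set" where P: "graded_prime V0 E1 s r P" "lookup (vx v) \<notin> P"
      using graded_prime_avoiding[OF red(2)] by blast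
    have JP: "LJ V0 E1 s r \<subseteq> P" and fP: "fideal V0 E1 P" and gP: "\<forall>p\<in>P. \<forall>d. hcomp d p \<in> P"
      using P(1) unfolding graded_prime_def by blast+
    obtain t bb where t: "1 \<le> t" "t \<le> n" "quot_iso V0 E1 P t bb" using cond2_quot_iso[OF c2 P(1)] by blast
    obtain \<phi> m d where \<phi>: "0 < m" "ghom V0 E1 t m d \<phi>" "\<phi> ` FA V0 E1 = MatSet t bb"
      "{p \<in> FA V0 E1. \<phi> p = (\<lambda>i j k. 0)} = P"
      using t(3) unfolding quot_iso_def by blast
    have "\<forall>p\<in>LJ V0 E1 s r. \<phi> p = (\<lambda>i j k. 0)" using JP \<phi>(4) by blast
    then have "(t, bb, m, d, \<phi>) \<in> ?S" using t(1,2) \<phi>(1-3) by simp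
    from bspec[OF k this] have "\<phi> p = (\<lambda>i j k. 0)" by simp
    then have "p \<in> P" using \<phi>(4) p by blast
    interpret two_sided "lift_ideal V0 E1 P" by (rule lift_two_sided[OF fP])
    have "x \<in> lift_ideal V0 E1 P" using lift_mem[of x V0 E1 P] p \<open>p \<in> P\<close> unfolding x by blast
    then have "hc e x \<in> lift_ideal V0 E1 P" by (rule lift_graded[OF gP])
    then have "a * hc e x * b \<in> lift_ideal V0 E1 P" by (rule mult)
    moreover have "a * hc e x * b - scal k0 * vx v \<in> lift_ideal V0 E1 P"
      using red(3) lift_ideal_mono[OF JP] unfolding J.cong_def by blast
    ultimately have "a * hc e x * b - (a * hc e x * b - scal k0 * vx v) \<in> lift_ideal V0 E1 P" by (rule diff_mem)
    then have "scal k0 * vx v \<in> lift_ideal V0 E1 P" by simp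
    then have "vx v \<in> lift_ideal V0 E1 P" by (simp only: scal_mem_iff[OF two_sided_axioms red(1)])
    then show False using lift_mem[OF vx_FA[OF red(2)]] P(2) by blast
  qed
  then have sub: "{p \<in> FA V0 E1. \<forall>(t, b, m, d, \<phi>) \<in> ?S. \<phi> p = (\<lambda>i j k. 0)} \<subseteq> LJ V0 E1 s r" by blast
  have sup: "LJ V0 E1 s r \<subseteq> {p \<in> FA V0 E1. \<forall>(t, b, m, d, \<phi>) \<in> ?S. \<phi> p = (\<lambda>i j k. 0)}"
  proof
    fix p :: "('v,'e) gen list \<Rightarrow> 'k" assume p: "p \<in> LJ V0 E1 s r"
    have "\<forall>(t, b, m, d, \<phi>) \<in> ?S. \<phi> p = (\<lambda>i j k. 0)" using p by (intro ballI) clarsimp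
    then show "p \<in> {p \<in> FA V0 E1. \<forall>(t, b, m, d, \<phi>) \<in> ?S. \<phi> p = (\<lambda>i j k. 0)}"
      using LJ_FA[OF p] by (intro CollectI conjI)
  qed
  show ?thesis unfolding cond4_def
  proof (rule exI[of _ ?S], rule conjI)
    show "\<forall>(t, b, m, d, \<phi>) \<in> ?S. 1 \<le> t \<and> t \<le> n \<and> 0 < m \<and> ghom V0 E1 t m d \<phi> \<and>
            \<phi> ` FA V0 E1 = MatSet t b \<and> (\<forall>p \<in> LJ V0 E1 s r. \<phi> p = (\<lambda>i j k. 0))"
      by (rule ballI) (simp only: mem_Collect_eq)
    show "{p \<in> FA V0 E1. \<forall>(t, b, m, d, \<phi>) \<in> ?S. \<phi> p = (\<lambda>i j k. 0)} = LJ V0 E1 s r"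
      using sub sup by (rule equalityI)
  qed
qed

lemma cond4_kernelI:
  assumes "cond4 V0 E1 s r TYPE('k::field) n" and p: "p \<in> FA V0 E1"
    and ker: "\<And>t b m d (\<phi> :: (('v,'e) gen list \<Rightarrow> 'k) \<Rightarrow> nat \<Rightarrow> nat \<Rightarrow> int \<Rightarrow> 'k). 1 \<le> t \<Longrightarrow> t \<le> n \<Longrightarrow>
      matrix_hom V0 E1 t m d \<phi> b \<Longrightarrow> \<forall>p\<in>LJ V0 E1 s r. \<phi> p = (\<lambda>i j k. 0) \<Longrightarrow> \<phi> p = (\<lambda>i j k. 0)"
  shows "p \<in> LJ V0 E1 s r"
proof -
  obtain S :: "(nat \<times> bool \<times> int \<times> (nat \<Rightarrow> int) \<times> ((('v,'e) gen list \<Rightarrow> 'k) \<Rightarrow> nat \<Rightarrow> nat \<Rightarrow> int \<Rightarrow> 'k)) set"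
    where S: "\<forall>(t, b, m, d, \<phi>) \<in> S. 1 \<le> t \<and> t \<le> n \<and> 0 < m \<and> ghom V0 E1 t m d \<phi> \<and>
            \<phi> ` FA V0 E1 = MatSet t b \<and> (\<forall>p \<in> LJ V0 E1 s r. \<phi> p = (\<lambda>i j k. 0))"
      and L: "{p \<in> FA V0 E1. \<forall>(t, b, m, d, \<phi>) \<in> S. \<phi> p = (\<lambda>i j k. 0)} = LJ V0 E1 s r"
    using assms(1) unfolding cond4_def by blast
  have "\<phi> p = (\<lambda>i j k. 0)" if "(t, b, m, d, \<phi>) \<in> S" for t b m d \<phi>
  proof (rule ker)
    show "1 \<le> t" "t \<le> n" "\<forall>p\<in>LJ V0 E1 s r. \<phi> p = (\<lambda>i j k. 0)" "matrix_hom V0 E1 t m d \<phi> b"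
      using bspec[OF S that] by (simp_all add: matrix_hom_def)
  qed
  then have "p \<in> {p \<in> FA V0 E1. \<forall>(t, b, m, d, \<phi>) \<in> S. \<phi> p = (\<lambda>i j k. 0)}" using p by auto
  then show ?thesis unfolding L .
qed

lemma cond4_nil_index:
  assumes c4: "cond4 V0 E1 s r TYPE('k::field) n" and n: "0 < n"
  shows "nil_index_le V0 E1 s r TYPE('k) n"
  unfolding nil_index_le_def
proof (intro ballI impI)
  fix p :: "('v,'e) gen list \<Rightarrow> 'k" assume p: "p \<in> FA V0 E1" and "\<exists>k\<ge>1. fpow p k \<in> LJ V0 E1 s r"
  then obtain k where k: "1 \<le> k" "fpow p k \<in> LJ V0 E1 s r" by blast
  define x where "x = Abs_poly_mapping p"
  have x: "p = lookup x" unfolding x_def using FA_lookup[OF p] by simp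
  have xFA: "lookup x \<in> FA V0 E1" using p x by simp
  note pFA = FA_power[OF xFA]
  have "lookup (x ^ n) \<in> LJ V0 E1 s r"
  proof (rule cond4_kernelI[OF c4])
    show "lookup (x ^ n) \<in> FA V0 E1" using n by (intro pFA) simp
    fix t b m d and \<phi> :: "(('v,'e) gen list \<Rightarrow> 'k) \<Rightarrow> nat \<Rightarrow> nat \<Rightarrow> int \<Rightarrow> 'k"
    assume t: "t \<le> n" and H: "matrix_hom V0 E1 t m d \<phi> b" and J: "\<forall>p\<in>LJ V0 E1 s r. \<phi> p = (\<lambda>i j k. 0)"
    have "\<phi> (lookup (x ^ k)) = (\<lambda>i j k. 0)" using J k(2) unfolding x fpow_lookup by blast
    then show "\<phi> (lookup (x ^ n)) = (\<lambda>i j k. 0)"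
      by (rule matrix_hom.nilpotent_kernel[OF H xFA k(1)]) (use n t in auto)
  qed
  then show "fpow p n \<in> LJ V0 E1 s r" unfolding x fpow_lookup .
qed

lemma cond4_PI:
  assumes c4: "cond4 V0 E1 s r TYPE('k::field) n"
  shows "satisfies_PI V0 E1 s r TYPE('k)"
proof -
  \<comment> \<open>Larger than \<open>t * t\<close> for every \<open>t \<le> n\<close>, so one
    standard polynomial serves the whole family.\<close>
  define M where "M = n * n + 1"
  let ?\<Pi> = "{\<pi>. \<pi> permutes {0..<M}}"
  let ?w = "\<lambda>\<pi> :: nat \<Rightarrow> nat. map \<pi> [0..<M]"
  have fin: "finite ?\<Pi>" by (simp add: finite_permutations)
  have inj: "inj_on ?w ?\<Pi>"
  proof (rule inj_onI)
    fix \<pi> \<rho> assume *: "\<pi> \<in> ?\<Pi>" "\<rho> \<in> ?\<Pi>" "?w \<pi> = ?w \<rho>"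
    show "\<pi> = \<rho>"
    proof
      fix i show "\<pi> i = \<rho> i"
        using * by (cases "i \<in> {0..<M}") (auto simp: permutes_def)
    qed
  qed
  \<comment> \<open>The standard polynomial in \<open>M\<close> variables. Different permutations
    give different words, so every coefficient is 1 or -1 and hence nonzero in any
    characteristic.\<close>
  define f :: "nat list \<Rightarrow> 'k" where "f u = (if u \<in> ?w ` ?\<Pi> then signof (the_inv_into ?\<Pi> ?w u) else 0)" for u
  have fw: "f (?w \<pi>) = signof \<pi>" if \<pi>: "\<pi> \<in> ?\<Pi>" for \<pi>
  proof -
    have "?w \<pi> \<in> ?w ` ?\<Pi>" using \<pi> by (rule imageI)
    then have "f (?w \<pi>) = signof (the_inv_into ?\<Pi> ?w (?w \<pi>))" unfolding f_def by (rule if_P)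
    then show ?thesis unfolding the_inv_into_f_f[OF inj \<pi>] .
  qed
  have sgn: "signof \<pi> \<noteq> (0 :: 'k)" for \<pi> :: "nat \<Rightarrow> nat" by (simp add: sign_def)
  have supp: "{u. f u \<noteq> 0} = ?w ` ?\<Pi>"
  proof (intro equalityI subsetI)
    fix u assume "u \<in> {u. f u \<noteq> 0}" then show "u \<in> ?w ` ?\<Pi>" by (auto simp: f_def split: if_splits)
  next
    fix u assume "u \<in> ?w ` ?\<Pi>"
    then obtain \<pi> where "\<pi> \<in> ?\<Pi>" "u = ?w \<pi>" by blast
    then show "u \<in> {u. f u \<noteq> 0}" using fw sgn by simp
  qed
  have "evalp f a \<in> LJ V0 E1 s r" if a: "\<forall>i. a i \<in> FA V0 E1" for a :: "nat \<Rightarrow> ('v,'e) gen list \<Rightarrow> 'k"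
  proof -
    define y where "y i = Abs_poly_mapping (a i)" for i
    have y: "lookup (y i) = a i" for i unfolding y_def using a by (intro FA_lookup) blast
    have yFA: "lookup (y i) \<in> FA V0 E1" for i unfolding y using a by blast
    let ?X = "\<Sum>\<pi>\<in>?\<Pi>. scal (signof \<pi>) * prod_list (map y (?w \<pi>))"
    have "evalp f a = evalp f (\<lambda>i. lookup (y i))" by (simp only: y)
    also have "\<dots> = lookup (\<Sum>u\<in>{u. f u \<noteq> 0}. scal (f u) * prod_list (map y u))"
      by (rule evalp_lookup)
    also have "(\<Sum>u\<in>{u. f u \<noteq> 0}. scal (f u) * prod_list (map y u)) = ?X"
      unfolding supp by (subst sum.reindex[OF inj]) (auto simp: fw intro!: sum.cong)
    finally have ev: "evalp f a = lookup ?X" .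
    have M: "t * t < M" if "t \<le> n" for t using mult_le_mono[OF that that] by (simp add: M_def)
    show ?thesis
      unfolding ev
    proof (rule cond4_kernelI[OF c4])
      show "lookup ?X \<in> FA V0 E1"
      proof (intro FA_sum FA_scal)
        fix \<pi> :: "nat \<Rightarrow> nat"
        have prodFA: "lookup (prod_list (map y u)) \<in> FA V0 E1" if "u \<noteq> []" for u
          using that
        proof (induction u)
          case (Cons x u)
          then show ?case using yFA FA_mult[OF yFA, of "prod_list (map y u)" x] by (cases "u = []") auto
        qed simp
        show "lookup (prod_list (map y (?w \<pi>))) \<in> FA V0 E1" by (rule prodFA) (simp add: M_def)
      qed
      fix t b m d and \<phi> :: "(('v,'e) gen list \<Rightarrow> 'k) \<Rightarrow> nat \<Rightarrow> nat \<Rightarrow> int \<Rightarrow> 'k"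
      assume "t \<le> n" and H: "matrix_hom V0 E1 t m d \<phi> b"
      then show "\<phi> (lookup ?X) = (\<lambda>i j k. 0)" by (intro matrix_hom.standard_kernel(2)[OF H yFA M])
    qed
  qed
  moreover have "f [] = 0" by (auto simp: f_def M_def)
  moreover have "f \<noteq> (\<lambda>u. 0)"
  proof -
    have "f (?w id) \<noteq> 0" using fw[of id] sgn[of id] permutes_id by auto
    then show ?thesis by auto
  qed
  moreover have "finite {u. f u \<noteq> 0}" unfolding supp using fin by simp
  ultimately show ?thesis unfolding satisfies_PI_def by blast
qed

text \<open>The bound is the length of any word occurring in the identity; it is positive because
  there is no constant term. A failure of (2) for it would allow an evaluation isolating that word's
  coefficient.\<close>

lemma PI_cond2:
  assumes "satisfies_PI V0 E1 s r TYPE('k::field)"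
  shows "\<exists>N>0. cond2 V0 E1 s r N"
proof -
  obtain f :: "nat list \<Rightarrow> 'k" where f: "finite {u. f u \<noteq> 0}" "f [] = 0" "f \<noteq> (\<lambda>u. 0)"
    and PI: "\<And>a. \<forall>i. a i \<in> FA V0 E1 \<Longrightarrow> evalp f a \<in> LJ V0 E1 s r"
    using assms unfolding satisfies_PI_def by blast
  obtain u where u: "f u \<noteq> 0" using f(3) by auto
  then have ne: "0 < length u" using f(2) by (cases u) auto
  have "cond2 V0 E1 s r (length u)"
  proof (rule ccontr)
    assume "\<not> cond2 V0 E1 s r (length u)"
    interpret leavitt_ideal "JQ :: (('v,'e) gen list \<Rightarrow>\<^sub>0 'k) set" V0 E1 s r by (rule JQ_ideal)
    obtain \<epsilon> a b v where v: "v \<in> V0" and \<epsilon>: "matrix_units (length u) \<epsilon>" and ab: "cong (a * \<epsilon> 0 0 * b) (vx v)"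
      using not_cond2_matrix_units[OF \<open>\<not> cond2 V0 E1 s r (length u)\<close>] by blast
    let ?y = "shift_sum \<epsilon> u"
    let ?X = "\<Sum>w\<in>{u. f u \<noteq> 0}. scal (f w) * prod_list (map ?y w)"
    have yFA: "lookup (?y i) \<in> FA V0 E1" for i by (rule shift_sum_FA[OF \<epsilon>])
    have "evalp f (\<lambda>i. lookup (?y i)) \<in> LJ V0 E1 s r" using yFA by (intro PI) blast
    then have "lookup ?X \<in> LJ V0 E1 s r" unfolding evalp_lookup .
    then have "?X \<in> JQ" using lift_mem LJ_FA by blast
    then have XQ: "\<epsilon> 0 0 * ?X * \<epsilon> (length u) 0 \<in> JQ" by (rule mult)
    have Xe: "cong (\<epsilon> 0 0 * ?X * \<epsilon> (length u) 0) (scal (f u) * \<epsilon> 0 0)"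
    proof -
      have "\<epsilon> 0 0 * ?X * \<epsilon> (length u) 0 =
        (\<Sum>w\<in>{u. f u \<noteq> 0}. scal (f w) * (\<epsilon> 0 0 * prod_list (map ?y w) * \<epsilon> (length u) 0))"
        by (simp only: sum_distrib_left sum_distrib_right scal_left_commute mult.assoc)
      also have "cong \<dots> (\<Sum>w\<in>{u. f u \<noteq> 0}. scal (f w) * (if w = u then \<epsilon> 0 0 else 0))"
        by (intro cong_sum cong_mult_l unit_shift_word \<epsilon>)
      also have "(\<Sum>w\<in>{u. f u \<noteq> 0}. scal (f w) * (if w = u then \<epsilon> 0 0 else 0)) =
        (\<Sum>w\<in>{u. f u \<noteq> 0}. if w = u then scal (f u) * \<epsilon> 0 0 else 0)" by (rule sum.cong) auto
      also have "\<dots> = scal (f u) * \<epsilon> 0 0" using f(1) u by simp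
      finally show ?thesis .
    qed
    have "scal (f u) * \<epsilon> 0 0 \<in> JQ" using XQ cong_mem[OF Xe] by blast
    then have "\<epsilon> 0 0 \<in> JQ" by (simp only: scal_mem_iff[OF two_sided_axioms u])
    then have "a * \<epsilon> 0 0 * b \<in> JQ" by (rule mult)
    then show False using cong_mem[OF ab] vx_notin_JQ[OF v] by blast
  qed
  then show ?thesis using ne by blast
qed

end

theorem theorem2p2:
  fixes V0 :: "'v set" and E1 :: "'e set" and s r :: "'e \<Rightarrow> 'v" and n :: nat
  assumes "graph V0 E1 s r" and "0 < n"
  shows "(nil_index_le V0 E1 s r TYPE('k::field) n \<longleftrightarrow> cond2 V0 E1 s r n)
       \<and> (cond2 V0 E1 s r n \<longleftrightarrow> cond3 V0 E1 s r TYPE('k) n)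
       \<and> (cond3 V0 E1 s r TYPE('k) n \<longleftrightarrow> cond4 V0 E1 s r TYPE('k) n)
       \<and> ((\<exists>N>0. nil_index_le V0 E1 s r TYPE('k) N) \<longleftrightarrow> satisfies_PI V0 E1 s r TYPE('k))"
proof -
  interpret digraph V0 E1 s r using assms(1) by (auto simp: graph_def digraph_def)
  \<comment> \<open>The circle from (1) to (2) to (4) to (1), for every positive \<open>N\<close>,
    as the last equivalence quantifies over the bound.\<close>
  have nil: "nil_index_le V0 E1 s r TYPE('k) N \<longleftrightarrow> cond2 V0 E1 s r N" if "0 < N" for N
    using nil_index_cond2[OF _ that] cond4_nil_index[OF cond2_cond4 that] by blast
  have "cond2 V0 E1 s r n \<longleftrightarrow> cond3 V0 E1 s r TYPE('k) n"
    using cond2_cond3 cond3_cond2[OF _ assms(2)] by blast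
  moreover have "cond2 V0 E1 s r n \<longleftrightarrow> cond4 V0 E1 s r TYPE('k) n"
    using cond2_cond4 cond4_nil_index[OF _ assms(2)] nil[OF assms(2)] by blast
  moreover have "(\<exists>N>0. nil_index_le V0 E1 s r TYPE('k) N) \<longleftrightarrow> satisfies_PI V0 E1 s r TYPE('k)"
    using nil cond2_cond4 cond4_PI PI_cond2 by blast
  ultimately show ?thesis using nil[OF assms(2)] by blast
qed

end
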